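(* Let $D$ be a Dedekind domain that is not a field. Then $$\mathrm V_{\mathrm{C4}}(D)=\mathrm V_{\mathrm{C4}^*}(D)=\mathrm V_{\text{strong }\mathrm{C4}^*}(D)=\{[P]\in\mathrm V(D):\operatorname{rank}_D P\le1\},$$ whereas $$\mathrm V_{\text{semi-weak-CS}}(D)=\mathrm V(D).$$ Thus the loci $\mathrm V_{\mathrm{C4}}(D)$, $\mathrm V_{\mathrm{C4}^*}(D)$, $\mathrm V_{\text{strong }\mathrm{C4}^*}(D)$ contain every Picard class in rank one (i.e. the class $[I]$ of every invertible ideal $I$) and no class of rank at least two.
   Context: $\mathrm V(D)$ is the abelian monoid of isomorphism classes $[P]$ of finitely generated projective $D$-modules under direct sum, and for a module property $\mathcal Q$, $\mathrm V_{\mathcal Q}(D)=\{[P]\in\mathrm V(D):P\text{ has }\mathcal Q\}$; "strong C4$^*$" denotes the property strongly C4$^*$. $\operatorname{rank}_D P=\dim_K(K\otimes_D P)$ with $K$ the fraction field of $D$. A module $M$ is a C4-module if, whenever $M=A\oplus B$ (internal direct sum) and $f:A\to B$ is a homomorphism such that $\ker f$ is a direct summand of $A$, the image $\operatorname{Im} f$ is a direct summand of $B$. A module is C4$^*$ if every submodule of it is a C4-module. For a module $M$, $\mathcal S(M)$ is the set of triples $(X,Y,\varphi)$ where $X,Y$ are semisimple direct summands of $M$ with $X\cap Y=0$ and $\varphi:X\to Y$ is an isomorphism. It is partially ordered by $(X,Y,\varphi)\preccurlyeq(X',Y',\varphi')$ iff $X\le X'$, $Y\le Y'$ and $\varphi'|_X=\varphi$.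 For a chain $\mathcal C\subseteq\mathcal S(M)$, put $X_{\mathcal C}=\bigcup_{(X,Y,\varphi)\in\mathcal C}X$ and $Y_{\mathcal C}=\bigcup_{(X,Y,\varphi)\in\mathcal C}Y$. The module $M$ is semi-weak-CS if for every chain $\mathcal C\subseteq\mathcal S(M)$ there are direct summands $A,B$ of $M$ such that $X_{\mathcal C}$ is an essential submodule of $A$ and $Y_{\mathcal C}$ is an essential submodule of $B$. A module is strongly C4$^*$ if it is both C4$^*$ and semi-weak-CS. *)

theory Defs
  imports
    "Jordan_Normal_Form.Missing_VectorSpace"
    "HOL-Algebra.Ring_Divisibility"
    "HOL-Algebra.Ideal_Product"
    "HOL-Algebra.Generated_Groups"
    "HOL-Algebra.Free_Abelian_Groups"
begin

text \<open>
  Modules are the records of HOL-Algebra; a submodule \<open>N\<close> of \<open>M\<close>, regarded as a module of its own,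
  is \<open>M\<lparr>carrier := N\<rparr>\<close>.
\<close>

section \<open>Fraction fields and Dedekind domains\<close>

text \<open>\<open>fraction R a b\<close> is the class of the fraction \<open>a/b\<close>.\<close>

definition fraction :: "('a, 'r) ring_scheme \<Rightarrow> 'a \<Rightarrow> 'a \<Rightarrow> ('a \<times> 'a) set" where
  "fraction R a b =
     {(c, d). c \<in> carrier R \<and> d \<in> carrier R - {\<zero>\<^bsub>R\<^esub>} \<and> a \<otimes>\<^bsub>R\<^esub> d = c \<otimes>\<^bsub>R\<^esub> b}"

definition fraction_field :: "('a, 'r) ring_scheme \<Rightarrow> ('a \<times> 'a) set ring" where
  "fraction_field R =
     \<lparr>carrier = {fraction R a b | a b. a \<in> carrier R \<and> b \<in> carrier R - {\<zero>\<^bsub>R\<^esub>}},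
      monoid.mult = (\<lambda>x y. \<Union>(a, b)\<in>x. \<Union>(c, d)\<in>y. fraction R (a \<otimes>\<^bsub>R\<^esub> c) (b \<otimes>\<^bsub>R\<^esub> d)),
      one = fraction R \<one>\<^bsub>R\<^esub> \<one>\<^bsub>R\<^esub>,
      ring.zero = fraction R \<zero>\<^bsub>R\<^esub> \<one>\<^bsub>R\<^esub>,
      add = (\<lambda>x y. \<Union>(a, b)\<in>x. \<Union>(c, d)\<in>y.
               fraction R (a \<otimes>\<^bsub>R\<^esub> d \<oplus>\<^bsub>R\<^esub> c \<otimes>\<^bsub>R\<^esub> b) (b \<otimes>\<^bsub>R\<^esub> d))\<rparr>"

definition frac_embed :: "('a, 'r) ring_scheme \<Rightarrow> 'a \<Rightarrow> ('a \<times> 'a) set" where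
  "frac_embed R a = fraction R a \<one>\<^bsub>R\<^esub>"

definition integral_over :: "('a, 'r) ring_scheme \<Rightarrow> ('a \<times> 'a) set \<Rightarrow> bool" where
  "integral_over R x \<longleftrightarrow>
     (let K = fraction_field R in
      \<exists>(n::nat) c. c \<in> {..<n} \<rightarrow> carrier R \<and>
        x [^]\<^bsub>K\<^esub> n \<oplus>\<^bsub>K\<^esub> (\<Oplus>\<^bsub>K\<^esub>i\<in>{..<n}. frac_embed R (c i) \<otimes>\<^bsub>K\<^esub> x [^]\<^bsub>K\<^esub> i) = \<zero>\<^bsub>K\<^esub>)"

locale dedekind_domain = noetherian_domain R for R (structure) +
  assumes integrally_closed:
      "\<lbrakk>x \<in> carrier (fraction_field R); integral_over R x\<rbrakk> \<Longrightarrow> x \<in> frac_embed R ` carrier R"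
    and nonzero_prime_maximal:
      "\<lbrakk>primeideal P R; P \<noteq> {\<zero>}\<rbrakk> \<Longrightarrow> maximalideal P R"

section \<open>Direct summands and finitely generated projective modules\<close>

definition internal_direct_sum ::
    "('a, 'r) ring_scheme \<Rightarrow> ('a, 'b, 'm) module_scheme \<Rightarrow> 'b set \<Rightarrow> 'b set \<Rightarrow> bool" where
  "internal_direct_sum R M A B \<longleftrightarrow>
     LinearCombinations.submodule R A M \<and> LinearCombinations.submodule R B M \<and> A \<inter> B = {\<zero>\<^bsub>M\<^esub>} \<and>
     LinearCombinations.module.submodule_sum M A B = carrier M"

definition direct_summand ::
    "('a, 'r) ring_scheme \<Rightarrow> ('a, 'b, 'm) module_scheme \<Rightarrow> 'b set \<Rightarrow> bool" where
  "direct_summand R M A \<longleftrightarrow> (\<exists>B. internal_direct_sum R M A B)"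

definition module_isomorphic ::
    "('a, 'r) ring_scheme \<Rightarrow> ('a, 'b, 'm) module_scheme \<Rightarrow> ('a, 'c, 'n) module_scheme \<Rightarrow> bool" where
  "module_isomorphic R M N \<longleftrightarrow>
     (\<exists>f \<in> LinearCombinations.module_hom R M N. bij_betw f (carrier M) (carrier N))"

definition fin_gen_module :: "('a, 'r) ring_scheme \<Rightarrow> ('a, 'b, 'm) module_scheme \<Rightarrow> bool" where
  "fin_gen_module R M \<longleftrightarrow>
     (\<exists>A. finite A \<and> A \<subseteq> carrier M \<and> LinearCombinations.module.span R M A = carrier M)"

definition free_module :: "('a, 'r) ring_scheme \<Rightarrow> 's set \<Rightarrow> ('a, 's \<Rightarrow> 'a) module" where
  "free_module R S =
     (ring.func_space R S)
       \<lparr>carrier := {f \<in> S \<rightarrow>\<^sub>E carrier R. finite {s \<in> S. f s \<noteq> \<zero>\<^bsub>R\<^esub>}}\<rparr>"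

text \<open>
  Projective means isomorphic to a direct summand of a free module. Index sets \<open>S\<close> in the carrier
  type of \<open>P\<close> are enough, because a projective \<open>P\<close> is a direct summand of the free module on the set
  \<open>carrier P\<close>.
\<close>

definition projective_module :: "('a, 'r) ring_scheme \<Rightarrow> ('a, 'b, 'm) module_scheme \<Rightarrow> bool" where
  "projective_module R P \<longleftrightarrow>
     (\<exists>(S :: 'b set) N. direct_summand R (free_module R S) N \<and>
        module_isomorphic R P ((free_module R S)\<lparr>carrier := N\<rparr>))"

definition fgp_module :: "('a, 'r) ring_scheme \<Rightarrow> ('a, 'b, 'm) module_scheme \<Rightarrow> bool" where
  "fgp_module R P \<longleftrightarrow> Module.module R P \<and> fin_gen_module R P \<and> projective_module R P"

section \<open>Isomorphism classes\<close>

text \<open>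
  An isomorphism class has to be formed inside a fixed type of modules. The type used here is large
  enough: every finitely generated projective \<open>R\<close>-module is isomorphic to a submodule of some
  \<open>R\<^sup>n\<close>, hence to a module with carrier in \<open>nat \<Rightarrow> 'a\<close>.
\<close>

type_synonym 'a umodule = "('a, nat \<Rightarrow> 'a) module"

definition iso_class ::
    "('a, 'r) ring_scheme \<Rightarrow> ('a, 'b, 'm) module_scheme \<Rightarrow> 'a umodule set" where
  "iso_class R P = {Q. Module.module R Q \<and> module_isomorphic R P Q}"

definition V_proj :: "('a, 'r) ring_scheme \<Rightarrow> 'a umodule set set" where
  "V_proj R = {iso_class R P | P :: 'a umodule. fgp_module R P}"

definition V_prop :: "('a, 'r) ring_scheme \<Rightarrow> ('a umodule \<Rightarrow> bool) \<Rightarrow> 'a umodule set set" where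
  "V_prop R Q = {iso_class R P | P :: 'a umodule. fgp_module R P \<and> Q P}"

section \<open>Tensor products and rank\<close>

definition tensor_rels ::
    "('a, 'r) ring_scheme \<Rightarrow> ('a, 'b, 'm) module_scheme \<Rightarrow> ('a, 'c, 'n) module_scheme \<Rightarrow>
     (('b \<times> 'c) \<Rightarrow>\<^sub>0 int) set" where
  "tensor_rels R M N =
     {frag_of (x \<oplus>\<^bsub>M\<^esub> x', y) - frag_of (x, y) - frag_of (x', y) | x x' y.
        x \<in> carrier M \<and> x' \<in> carrier M \<and> y \<in> carrier N} \<union>
     {frag_of (x, y \<oplus>\<^bsub>N\<^esub> y') - frag_of (x, y) - frag_of (x, y') | x y y'.
        x \<in> carrier M \<and> y \<in> carrier N \<and> y' \<in> carrier N} \<union>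
     {frag_of (r \<odot>\<^bsub>M\<^esub> x, y) - frag_of (x, r \<odot>\<^bsub>N\<^esub> y) | r x y.
        r \<in> carrier R \<and> x \<in> carrier M \<and> y \<in> carrier N}"

definition tensor_kernel ::
    "('a, 'r) ring_scheme \<Rightarrow> ('a, 'b, 'm) module_scheme \<Rightarrow> ('a, 'c, 'n) module_scheme \<Rightarrow>
     (('b \<times> 'c) \<Rightarrow>\<^sub>0 int) set" where
  "tensor_kernel R M N =
     generate (free_Abelian_group (carrier M \<times> carrier N)) (tensor_rels R M N)"

definition tensor_group ::
    "('a, 'r) ring_scheme \<Rightarrow> ('a, 'b, 'm) module_scheme \<Rightarrow> ('a, 'c, 'n) module_scheme \<Rightarrow>
     (('b \<times> 'c) \<Rightarrow>\<^sub>0 int) set monoid" where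
  "tensor_group R M N =
     free_Abelian_group (carrier M \<times> carrier N) Mod tensor_kernel R M N"

text \<open>The fraction field \<open>K\<close> as an \<open>R\<close>-module.\<close>

definition frac_module :: "('a, 'r) ring_scheme \<Rightarrow> ('a, ('a \<times> 'a) set) module" where
  "frac_module R =
     (let K = fraction_field R in
      \<lparr>carrier = carrier K, monoid.mult = monoid.mult K, one = \<one>\<^bsub>K\<^esub>, ring.zero = \<zero>\<^bsub>K\<^esub>,
       add = ring.add K, smult = (\<lambda>r x. frac_embed R r \<otimes>\<^bsub>K\<^esub> x)\<rparr>)"

text \<open>
  The \<open>K\<close>-vector space \<open>K \<otimes>\<^sub>R P\<close>: scalars act on generators by \<open>k (x \<otimes> p) = (k x) \<otimes> p\<close>.
  The fields \<open>mult\<close> and \<open>one\<close> carry no meaning for a module.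
\<close>

definition frac_tensor ::
    "('a, 'r) ring_scheme \<Rightarrow> ('a, 'b, 'm) module_scheme \<Rightarrow>
     (('a \<times> 'a) set, ((('a \<times> 'a) set \<times> 'b) \<Rightarrow>\<^sub>0 int) set) module" where
  "frac_tensor R P =
     (let K = fraction_field R;
          F = free_Abelian_group (carrier K \<times> carrier P);
          H = tensor_kernel R (frac_module R) P;
          T = tensor_group R (frac_module R) P in
      \<lparr>carrier = carrier T, monoid.mult = (\<lambda>_ _. \<one>\<^bsub>T\<^esub>), one = \<one>\<^bsub>T\<^esub>, ring.zero = \<one>\<^bsub>T\<^esub>,
       add = monoid.mult T,
       smult = (\<lambda>k X. \<Union>c\<in>X. H #>\<^bsub>F\<^esub> frag_extend (\<lambda>(x, p). frag_of (k \<otimes>\<^bsub>K\<^esub> x, p)) c)\<rparr>)"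

definition module_rank :: "('a, 'r) ring_scheme \<Rightarrow> ('a, 'b, 'm) module_scheme \<Rightarrow> nat" where
  "module_rank R P = vectorspace.dim (fraction_field R) (frac_tensor R P)"

section \<open>Invertible ideals\<close>

text \<open>
  Ideals are taken in the fractional sense, as \<open>R\<close>-submodules of the fraction field; an ordinary
  ideal \<open>I\<close> of \<open>R\<close> appears as \<open>frac_embed R ` I\<close>. The operation \<open>ideal_prod\<close> forms all finite sums
  of products.
\<close>

definition invertible_ideal :: "('a, 'r) ring_scheme \<Rightarrow> ('a \<times> 'a) set set \<Rightarrow> bool" where
  "invertible_ideal R I \<longleftrightarrow>
     LinearCombinations.submodule R I (frac_module R) \<and>
     (\<exists>J. LinearCombinations.submodule R J (frac_module R) \<and>
        ideal_prod (fraction_field R) I J = frac_embed R ` carrier R)"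

section \<open>C4-modules\<close>

definition C4_module :: "('a, 'r) ring_scheme \<Rightarrow> ('a, 'b, 'm) module_scheme \<Rightarrow> bool" where
  "C4_module R M \<longleftrightarrow>
     (\<forall>A B f. internal_direct_sum R M A B \<and>
        f \<in> LinearCombinations.module_hom R (M\<lparr>carrier := A\<rparr>) (M\<lparr>carrier := B\<rparr>) \<and>
        direct_summand R (M\<lparr>carrier := A\<rparr>) {x \<in> A. f x = \<zero>\<^bsub>M\<^esub>} \<longrightarrow>
        direct_summand R (M\<lparr>carrier := B\<rparr>) (f ` A))"

definition C4_star_module :: "('a, 'r) ring_scheme \<Rightarrow> ('a, 'b, 'm) module_scheme \<Rightarrow> bool" where
  "C4_star_module R M \<longleftrightarrow>
     (\<forall>N. LinearCombinations.submodule R N M \<longrightarrow> C4_module R (M\<lparr>carrier := N\<rparr>))"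

section \<open>Semi-weak-CS modules\<close>

definition semisimple_module :: "('a, 'r) ring_scheme \<Rightarrow> ('a, 'b, 'm) module_scheme \<Rightarrow> bool" where
  "semisimple_module R M \<longleftrightarrow>
     (\<forall>N. LinearCombinations.submodule R N M \<longrightarrow> direct_summand R M N)"

definition essential_submodule ::
    "('a, 'r) ring_scheme \<Rightarrow> ('a, 'b, 'm) module_scheme \<Rightarrow> 'b set \<Rightarrow> bool" where
  "essential_submodule R M X \<longleftrightarrow>
     LinearCombinations.submodule R X M \<and>
     (\<forall>N. LinearCombinations.submodule R N M \<and> N \<noteq> {\<zero>\<^bsub>M\<^esub>} \<longrightarrow> X \<inter> N \<noteq> {\<zero>\<^bsub>M\<^esub>})"

text \<open>
  The isomorphism \<open>\<phi>\<close> is required to be extensional, so that it is determined by its values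
  on \<open>X\<close>.
\<close>

definition summand_triples ::
    "('a, 'r) ring_scheme \<Rightarrow> ('a, 'b, 'm) module_scheme \<Rightarrow> ('b set \<times> 'b set \<times> ('b \<Rightarrow> 'b)) set" where
  "summand_triples R M =
     {(X, Y, \<phi>). direct_summand R M X \<and> semisimple_module R (M\<lparr>carrier := X\<rparr>) \<and>
        direct_summand R M Y \<and> semisimple_module R (M\<lparr>carrier := Y\<rparr>) \<and>
        X \<inter> Y = {\<zero>\<^bsub>M\<^esub>} \<and>
        \<phi> \<in> extensional X \<and>
        \<phi> \<in> LinearCombinations.module_hom R (M\<lparr>carrier := X\<rparr>) (M\<lparr>carrier := Y\<rparr>) \<and>
        bij_betw \<phi> X Y}"

fun triple_le ::
    "'b set \<times> 'b set \<times> ('b \<Rightarrow> 'b) \<Rightarrow> 'b set \<times> 'b set \<times> ('b \<Rightarrow> 'b) \<Rightarrow> bool" where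
  "triple_le (X, Y, \<phi>) (X', Y', \<phi>') \<longleftrightarrow> X \<subseteq> X' \<and> Y \<subseteq> Y' \<and> (\<forall>x\<in>X. \<phi>' x = \<phi> x)"

text \<open>
  Inserting zero affects the unions for the empty chain only, where it yields the zero submodule
  instead of the empty set.
\<close>

definition semi_weak_CS_module :: "('a, 'r) ring_scheme \<Rightarrow> ('a, 'b, 'm) module_scheme \<Rightarrow> bool" where
  "semi_weak_CS_module R M \<longleftrightarrow>
     (\<forall>C. C \<subseteq> summand_triples R M \<and> Complete_Partial_Order.chain triple_le C \<longrightarrow>
        (\<exists>A B. direct_summand R M A \<and> direct_summand R M B \<and>
           essential_submodule R (M\<lparr>carrier := A\<rparr>) (insert \<zero>\<^bsub>M\<^esub> (\<Union>(X, Y, \<phi>)\<in>C. X)) \<and>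
           essential_submodule R (M\<lparr>carrier := B\<rparr>) (insert \<zero>\<^bsub>M\<^esub> (\<Union>(X, Y, \<phi>)\<in>C. Y))))"

definition strongly_C4_star_module ::
    "('a, 'r) ring_scheme \<Rightarrow> ('a, 'b, 'm) module_scheme \<Rightarrow> bool" where
  "strongly_C4_star_module R M \<longleftrightarrow> C4_star_module R M \<and> semi_weak_CS_module R M"

end

theory Submission
  imports Defs
begin

text \<open>
  A finitely generated projective module \<open>P\<close> embeds into a free module, so its linear functionals
  separate points; it is torsion-free, and its rank is at most one iff any two elements of \<open>P\<close> are
  linearly dependent over \<open>R\<close>. In that case two nonzero submodules always meet, so \<open>P\<close> and its
  submodules are C4 because direct sum decompositions are trivial. If the rank is at least two, a
  nonzero functional \<open>f\<close> has as its image an ideal \<open>I\<close>, which is invertible, so that \<open>f\<close> has a linear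
  section and \<open>P \<cong> I \<oplus> ker f\<close> with \<open>ker f \<noteq> 0\<close>; a nonunit \<open>c\<close> and \<open>0 \<noteq> b \<in> ker f\<close> then give
  the injective map \<open>i \<mapsto> c i b\<close> whose image is not a direct summand, since otherwise \<open>I = c I\<close>.
  Semisimple submodules of torsion-free modules over a domain that is not a field vanish, which
  makes every \<open>P\<close> semi-weak-CS.
\<close>

section \<open>The fraction field\<close>

text \<open>The rank is the dimension of a quotient of a very large free abelian group, which is
  awkward to compute with and to transport. Pairwise dependence is elementary, passes to submodules
  and along isomorphisms, and meets the tensor product only through the maps
  \<open>K \<otimes> P \<rightarrow> K\<close> that extend functionals of \<open>P\<close>. Two
  tools do double duty. The integrality criterion says that a quotient lies in \<open>R\<close> as
  soon as multiplication by it can be iterated inside \<open>R\<close> from some nonzero element.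
  Applied to \<open>a/b\<close> mapping an ideal into itself, it drives the proof that nonzero
  ideals are invertible; applied to \<open>1/c\<close>, it excludes \<open>I = c I\<close> for a
  nonunit \<open>c\<close>. The section of a functional over its image produces the decomposition
  that defeats C4 in rank at least two; applied to a surjection from a free module
  \<open>R^S\<close> onto an ideal, it also shows that ideals are projective, which places the
  classes of invertible ideals inside \<open>V_proj\<close>.\<close>

lemma UN_pairs_constant:
  assumes "p \<in> A" "q \<in> B" "\<And>a b c d. (a, b) \<in> A \<Longrightarrow> (c, d) \<in> B \<Longrightarrow> f a b c d = C"
  shows "(\<Union>(a, b)\<in>A. \<Union>(c, d)\<in>B. f a b c d) = C"
proof -
  have "(\<Union>(a, b)\<in>A. \<Union>(c, d)\<in>B. f a b c d) = (\<Union>_\<in>A. \<Union>_\<in>B. C)"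
    using assms(3) by (intro SUP_cong refl) auto
  with assms(1,2) show ?thesis
    by auto
qed

context domain
begin

abbreviation fraction_field_of ("K") where "K \<equiv> fraction_field R"
abbreviation embedding ("\<epsilon>") where "\<epsilon> \<equiv> frac_embed R"

lemma mem_fraction: "a \<in> carrier R \<Longrightarrow> b \<in> carrier R - {\<zero>} \<Longrightarrow> (a, b) \<in> fraction R a b"
  by (simp add: fraction_def)

text \<open>The class of \<open>a/b\<close> is the solution set of a cross-multiplied equation, so
  the claim is the transitivity of cross multiplication. The absence of zero divisors enters when
  \<open>d\<close> and then \<open>b\<close> are cancelled.\<close>

lemma fraction_eq_iff:
  assumes "a \<in> carrier R" "b \<in> carrier R - {\<zero>}" "c \<in> carrier R" "d \<in> carrier R - {\<zero>}"
  shows "fraction R a b = fraction R c d \<longleftrightarrow> a \<otimes> d = c \<otimes> b"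
proof
  assume "fraction R a b = fraction R c d"
  with mem_fraction[OF assms(3,4)] show "a \<otimes> d = c \<otimes> b"
    by (auto simp: fraction_def)
next
  assume eq: "a \<otimes> d = c \<otimes> b"
  have "a \<otimes> v = u \<otimes> b \<longleftrightarrow> c \<otimes> v = u \<otimes> d" if "u \<in> carrier R" "v \<in> carrier R" for u v
  proof -
    have "a \<otimes> v = u \<otimes> b \<longleftrightarrow> d \<otimes> (a \<otimes> v) = d \<otimes> (u \<otimes> b)"
      using that assms by (auto simp: m_lcancel)
    also have "d \<otimes> (a \<otimes> v) = (a \<otimes> d) \<otimes> v"
      using that assms by (simp add: m_ac)
    also have "\<dots> = b \<otimes> (c \<otimes> v)"
      unfolding eq using that assms by (simp add: m_ac)
    also have "d \<otimes> (u \<otimes> b) = b \<otimes> (u \<otimes> d)"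
      using that assms by (simp add: m_ac)
    also have "b \<otimes> (c \<otimes> v) = b \<otimes> (u \<otimes> d) \<longleftrightarrow> c \<otimes> v = u \<otimes> d"
      using that assms by (auto simp: m_lcancel)
    finally show ?thesis .
  qed
  then show "fraction R a b = fraction R c d"
    by (auto simp: fraction_def)
qed

text \<open>The operations of \<open>fraction_field\<close> are unions over all pairs of
  representatives. Once the result is known not to depend on the representatives, every member of
  the union is the same class, and \<open>UN_pairs_constant\<close> collapses it.\<close>

lemma fraction_mult [simp]:
  assumes "a \<in> carrier R" "b \<in> carrier R - {\<zero>}" "c \<in> carrier R" "d \<in> carrier R - {\<zero>}"
  shows "fraction R a b \<otimes>\<^bsub>K\<^esub> fraction R c d = fraction R (a \<otimes> c) (b \<otimes> d)"
proof -
  have "fraction R (a' \<otimes> c') (b' \<otimes> d') = fraction R (a \<otimes> c) (b \<otimes> d)"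
    if "(a', b') \<in> fraction R a b" "(c', d') \<in> fraction R c d" for a' b' c' d'
  proof -
    have *: "a' \<in> carrier R" "b' \<in> carrier R" "b' \<noteq> \<zero>" "a \<otimes> b' = a' \<otimes> b"
      "c' \<in> carrier R" "d' \<in> carrier R" "d' \<noteq> \<zero>" "c \<otimes> d' = c' \<otimes> d"
      using that by (auto simp: fraction_def)
    have "a' \<otimes> c' \<otimes> (b \<otimes> d) = (a' \<otimes> b) \<otimes> (c' \<otimes> d)"
      using *(1-3,5-7) assms by (simp add: m_ac)
    also have "\<dots> = a \<otimes> c \<otimes> (b' \<otimes> d')"
      unfolding *(4,8)[symmetric] using *(1-3,5-7) assms by (simp add: m_ac)
    finally show ?thesis
      using * assms by (subst fraction_eq_iff) (auto simp: integral_iff)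
  qed
  then show ?thesis
    unfolding fraction_field_def monoid.simps ring.simps
    by (intro UN_pairs_constant[OF mem_fraction[OF assms(1,2)] mem_fraction[OF assms(3,4)]])
qed

lemma fraction_add [simp]:
  assumes "a \<in> carrier R" "b \<in> carrier R - {\<zero>}" "c \<in> carrier R" "d \<in> carrier R - {\<zero>}"
  shows "fraction R a b \<oplus>\<^bsub>K\<^esub> fraction R c d = fraction R (a \<otimes> d \<oplus> c \<otimes> b) (b \<otimes> d)"
proof -
  have "fraction R (a' \<otimes> d' \<oplus> c' \<otimes> b') (b' \<otimes> d') = fraction R (a \<otimes> d \<oplus> c \<otimes> b) (b \<otimes> d)"
    if "(a', b') \<in> fraction R a b" "(c', d') \<in> fraction R c d" for a' b' c' d'
  proof -
    have *: "a' \<in> carrier R" "b' \<in> carrier R" "b' \<noteq> \<zero>" "a \<otimes> b' = a' \<otimes> b"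
      "c' \<in> carrier R" "d' \<in> carrier R" "d' \<noteq> \<zero>" "c \<otimes> d' = c' \<otimes> d"
      using that by (auto simp: fraction_def)
    have "(a' \<otimes> d' \<oplus> c' \<otimes> b') \<otimes> (b \<otimes> d) = (a' \<otimes> b) \<otimes> (d' \<otimes> d) \<oplus> (c' \<otimes> d) \<otimes> (b' \<otimes> b)"
      using *(1-3,5-7) assms by (simp add: m_ac l_distr r_distr)
    also have "\<dots> = (a \<otimes> d \<oplus> c \<otimes> b) \<otimes> (b' \<otimes> d')"
      unfolding *(4,8)[symmetric] using *(1-3,5-7) assms by (simp add: m_ac l_distr r_distr)
    finally show ?thesis
      using * assms by (subst fraction_eq_iff) (auto simp: integral_iff)
  qed
  then show ?thesis
    unfolding fraction_field_def monoid.simps ring.simps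
    by (intro UN_pairs_constant[OF mem_fraction[OF assms(1,2)] mem_fraction[OF assms(3,4)]])
qed

lemma fraction_closed [simp]:
  "a \<in> carrier R \<Longrightarrow> b \<in> carrier R - {\<zero>} \<Longrightarrow> fraction R a b \<in> carrier K"
  by (auto simp: fraction_field_def)

lemma fraction_field_cases:
  assumes "x \<in> carrier K"
  obtains a b where "a \<in> carrier R" "b \<in> carrier R - {\<zero>}" "x = fraction R a b"
  using assms by (auto simp: fraction_field_def)

lemma fraction_field_cases3:
  assumes "x \<in> carrier K" "y \<in> carrier K" "z \<in> carrier K"
  obtains a b c d p q where "a \<in> carrier R" "b \<in> carrier R - {\<zero>}" "x = fraction R a b"
    "c \<in> carrier R" "d \<in> carrier R - {\<zero>}" "y = fraction R c d"
    "p \<in> carrier R" "q \<in> carrier R - {\<zero>}" "z = fraction R p q"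
  using assms by (elim fraction_field_cases)

lemma fraction_one: "\<one>\<^bsub>K\<^esub> = fraction R \<one> \<one>" and fraction_zero: "\<zero>\<^bsub>K\<^esub> = fraction R \<zero> \<one>"
  by (simp_all add: fraction_field_def)

lemma cring_fraction_field: "cring K"
proof (rule cringI)
  show "abelian_group K"
  proof (rule abelian_groupI)
    fix x y z assume "x \<in> carrier K" "y \<in> carrier K" "z \<in> carrier K"
    then obtain a b c d p q where *: "a \<in> carrier R" "b \<in> carrier R - {\<zero>}" "x = fraction R a b"
      "c \<in> carrier R" "d \<in> carrier R - {\<zero>}" "y = fraction R c d"
      "p \<in> carrier R" "q \<in> carrier R - {\<zero>}" "z = fraction R p q"
      by (rule fraction_field_cases3)
    show "x \<oplus>\<^bsub>K\<^esub> y \<in> carrier K"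
      using * by (simp add: integral_iff)
    show "x \<oplus>\<^bsub>K\<^esub> y = y \<oplus>\<^bsub>K\<^esub> x"
      using * by (simp add: a_comm m_comm)
    have "(a \<otimes> d \<oplus> c \<otimes> b) \<otimes> q \<oplus> p \<otimes> (b \<otimes> d) = a \<otimes> (d \<otimes> q) \<oplus> (c \<otimes> q \<oplus> p \<otimes> d) \<otimes> b"
      using *(1,2,4,5,7,8) by (simp add: l_distr r_distr a_assoc m_ac)
    then show "x \<oplus>\<^bsub>K\<^esub> y \<oplus>\<^bsub>K\<^esub> z = x \<oplus>\<^bsub>K\<^esub> (y \<oplus>\<^bsub>K\<^esub> z)"
      using * by (simp add: integral_iff m_assoc)
  next
    fix x assume "x \<in> carrier K"
    then obtain a b where *: "a \<in> carrier R" "b \<in> carrier R - {\<zero>}" "x = fraction R a b"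
      by (auto elim!: fraction_field_cases)
    show "\<zero>\<^bsub>K\<^esub> \<oplus>\<^bsub>K\<^esub> x = x"
      using * by (simp add: fraction_zero)
    have "fraction R (\<ominus> a) b \<oplus>\<^bsub>K\<^esub> x = \<zero>\<^bsub>K\<^esub>"
      using * by (simp add: fraction_zero fraction_eq_iff integral_iff l_minus l_neg)
    then show "\<exists>y\<in>carrier K. y \<oplus>\<^bsub>K\<^esub> x = \<zero>\<^bsub>K\<^esub>"
      using * by (intro bexI[of _ "fraction R (\<ominus> a) b"]) auto
  qed (simp add: fraction_zero)
  show "Group.comm_monoid K"
  proof (rule comm_monoidI)
    fix x y z assume "x \<in> carrier K" "y \<in> carrier K" "z \<in> carrier K"
    then obtain a b c d p q where *: "a \<in> carrier R" "b \<in> carrier R - {\<zero>}" "x = fraction R a b"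
      "c \<in> carrier R" "d \<in> carrier R - {\<zero>}" "y = fraction R c d"
      "p \<in> carrier R" "q \<in> carrier R - {\<zero>}" "z = fraction R p q"
      by (rule fraction_field_cases3)
    show "x \<otimes>\<^bsub>K\<^esub> y \<in> carrier K" "x \<otimes>\<^bsub>K\<^esub> y = y \<otimes>\<^bsub>K\<^esub> x"
      "x \<otimes>\<^bsub>K\<^esub> y \<otimes>\<^bsub>K\<^esub> z = x \<otimes>\<^bsub>K\<^esub> (y \<otimes>\<^bsub>K\<^esub> z)" "\<one>\<^bsub>K\<^esub> \<otimes>\<^bsub>K\<^esub> x = x"
      using * by (simp_all add: integral_iff fraction_one m_ac)
  qed (simp add: fraction_one)
  fix x y z assume "x \<in> carrier K" "y \<in> carrier K" "z \<in> carrier K"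
  then obtain a b c d p q where *: "a \<in> carrier R" "b \<in> carrier R - {\<zero>}" "x = fraction R a b"
    "c \<in> carrier R" "d \<in> carrier R - {\<zero>}" "y = fraction R c d"
    "p \<in> carrier R" "q \<in> carrier R - {\<zero>}" "z = fraction R p q"
    by (rule fraction_field_cases3)
  \<comment> \<open>The numerator of \<open>x + y\<close> is kept as an atom, so that sorting the
    factors does not expand it. On the other side of the law, adding over a common denominator
    leaves an additional factor \<open>q\<close> in numerator and denominator.\<close>
  define s where "s = a \<otimes> d \<oplus> c \<otimes> b"
  have s: "s \<in> carrier R"
    using * by (auto simp: s_def)
  have "a \<otimes> p \<otimes> (d \<otimes> q) \<oplus> c \<otimes> p \<otimes> (b \<otimes> q) = s \<otimes> (p \<otimes> q)"
    unfolding s_def using *(1,2,4,5,7,8) by (simp add: l_distr r_distr m_ac)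
  moreover have "s \<otimes> p \<otimes> (b \<otimes> q \<otimes> (d \<otimes> q)) = s \<otimes> (p \<otimes> q) \<otimes> (b \<otimes> d \<otimes> q)"
    using s *(1,2,4,5,7,8) by (simp add: m_ac)
  ultimately have "fraction R (s \<otimes> p) (b \<otimes> d \<otimes> q)
      = fraction R (a \<otimes> p \<otimes> (d \<otimes> q) \<oplus> c \<otimes> p \<otimes> (b \<otimes> q)) (b \<otimes> q \<otimes> (d \<otimes> q))"
    using *(1,2,4,5,7,8) s by (subst fraction_eq_iff) (auto simp: integral_iff)
  then show "(x \<oplus>\<^bsub>K\<^esub> y) \<otimes>\<^bsub>K\<^esub> z = x \<otimes>\<^bsub>K\<^esub> z \<oplus>\<^bsub>K\<^esub> y \<otimes>\<^bsub>K\<^esub> z"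
    using * s by (simp add: integral_iff s_def)
qed

lemma field_fraction_field: "field K"
proof -
  interpret K: cring K by (rule cring_fraction_field)
  have ne: "\<zero>\<^bsub>K\<^esub> \<noteq> \<one>\<^bsub>K\<^esub>"
    by (simp add: fraction_zero fraction_one fraction_eq_iff)
  have "x \<in> Units K" if "x \<in> carrier K" "x \<noteq> \<zero>\<^bsub>K\<^esub>" for x
  proof -
    obtain a b where *: "a \<in> carrier R" "b \<in> carrier R - {\<zero>}" "x = fraction R a b"
      using \<open>x \<in> carrier K\<close> by (auto elim!: fraction_field_cases)
    with that have "a \<noteq> \<zero>"
      by (auto simp: fraction_zero fraction_eq_iff)
    with * have "fraction R b a \<otimes>\<^bsub>K\<^esub> x = \<one>\<^bsub>K\<^esub>"
      by (simp add: fraction_one fraction_eq_iff integral_iff m_comm)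
    moreover have "fraction R b a \<in> carrier K"
      using * \<open>a \<noteq> \<zero>\<close> by auto
    moreover from calculation have "x \<otimes>\<^bsub>K\<^esub> fraction R b a = \<one>\<^bsub>K\<^esub>"
      using that by (simp add: K.m_comm)
    ultimately show ?thesis
      using that by (auto simp: Units_def)
  qed
  moreover have "\<zero>\<^bsub>K\<^esub> \<notin> Units K"
    using ne by (metis K.Units_l_inv_ex K.r_null)
  ultimately have "Units K = carrier K - {\<zero>\<^bsub>K\<^esub>}"
    using K.Units_closed by auto
  then show ?thesis
    by (rule K.cring_fieldI)
qed

end

text \<open>
  Declaring this sublocale for \<open>domain\<close> itself would not terminate, since the field of fractions is
  again a domain.
\<close>

locale domain_with_fractions = domain

sublocale domain_with_fractions \<subseteq> K: field "fraction_field R"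
  by (rule field_fraction_field)

context domain_with_fractions
begin

lemma frac_embed_hom: "ring_hom_cring R K \<epsilon>"
  by (intro ring_hom_cringI ring_hom_memI is_cring K.is_cring)
    (simp_all add: frac_embed_def fraction_one)

lemma frac_embed_closed [simp]: "a \<in> carrier R \<Longrightarrow> \<epsilon> a \<in> carrier K"
  and frac_embed_mult: "a \<in> carrier R \<Longrightarrow> b \<in> carrier R \<Longrightarrow> \<epsilon> (a \<otimes> b) = \<epsilon> a \<otimes>\<^bsub>K\<^esub> \<epsilon> b"
  and frac_embed_add: "a \<in> carrier R \<Longrightarrow> b \<in> carrier R \<Longrightarrow> \<epsilon> (a \<oplus> b) = \<epsilon> a \<oplus>\<^bsub>K\<^esub> \<epsilon> b"
  and frac_embed_one [simp]: "\<epsilon> \<one> = \<one>\<^bsub>K\<^esub>"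
  and frac_embed_zero [simp]: "\<epsilon> \<zero> = \<zero>\<^bsub>K\<^esub>"
  by (simp_all add: frac_embed_def fraction_one fraction_zero)

lemma frac_embed_eq_iff [simp]:
  "a \<in> carrier R \<Longrightarrow> b \<in> carrier R \<Longrightarrow> \<epsilon> a = \<epsilon> b \<longleftrightarrow> a = b"
  by (simp add: frac_embed_def fraction_eq_iff)

lemma frac_embed_eq_0_iff [simp]: "a \<in> carrier R \<Longrightarrow> \<epsilon> a = \<zero>\<^bsub>K\<^esub> \<longleftrightarrow> a = \<zero>"
  by (simp add: frac_embed_def fraction_zero fraction_eq_iff)

lemma fraction_times_denominator:
  "a \<in> carrier R \<Longrightarrow> b \<in> carrier R - {\<zero>} \<Longrightarrow> fraction R a b \<otimes>\<^bsub>K\<^esub> \<epsilon> b = \<epsilon> a"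
  by (simp add: frac_embed_def fraction_eq_iff integral_iff)

end

section \<open>Ideals of a Dedekind domain\<close>

lemma (in cring) ideal_criterion:
  assumes "I \<subseteq> carrier R" "\<zero> \<in> I"
    and add: "\<And>x y. x \<in> I \<Longrightarrow> y \<in> I \<Longrightarrow> x \<oplus> y \<in> I"
    and mult: "\<And>r x. r \<in> carrier R \<Longrightarrow> x \<in> I \<Longrightarrow> r \<otimes> x \<in> I"
  shows "ideal I R"
proof (rule idealI)
  show "subgroup I (add_monoid R)"
  proof (rule add.subgroupI)
    fix x assume "x \<in> I"
    with mult[of "\<ominus> \<one>" x] assms(1) show "\<ominus> x \<in> I"
      by (auto simp: l_minus)
  qed (use assms in auto)
  show "x \<otimes> a \<in> I" "a \<otimes> x \<in> I" if "a \<in> I" "x \<in> carrier R" for a x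
    using mult[OF that(2,1)] that assms(1) by (auto simp: m_comm)
qed (rule ring_axioms)

text \<open>Zorn's lemma applies to an arbitrary family \<open>S\<close>, because in a noetherian
  ring a nonempty chain of ideals contains its own union, which therefore belongs to
  \<open>S\<close>.\<close>

lemma (in noetherian_ring) exists_maximal_in_ideals:
  assumes "S \<noteq> {}" "\<And>I. I \<in> S \<Longrightarrow> ideal I R"
  obtains M where "M \<in> S" "\<And>I. I \<in> S \<Longrightarrow> M \<subseteq> I \<Longrightarrow> I = M"
proof -
  have "\<exists>M\<in>S. \<forall>I\<in>S. M \<subseteq> I \<longrightarrow> I = M"
  proof (rule subset_Zorn)
    fix C assume C: "subset.chain S C"
    show "\<exists>U\<in>S. \<forall>X\<in>C. X \<subseteq> U"
    proof (cases "C = {}")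
      case False
      from C have "subset.chain {I. ideal I R} C" "C \<subseteq> S"
        using assms(2) by (auto simp: subset_chain_def)
      with ideal_chain_is_trivial[OF False] show ?thesis
        by (intro bexI[of _ "\<Union>C"]) auto
    qed (use assms(1) in auto)
  qed
  with that show thesis
    by blast
qed

text \<open>The ideals of combinations of the first \<open>n\<close> terms form an increasing chain,
  so one of them is the union; from there on new terms are combinations of earlier ones. For a
  geometric sequence such a combination is an equation of integral dependence.\<close>

lemma (in noetherian_domain) sequence_term_combination:
  assumes p: "\<And>n::nat. p n \<in> carrier R"
  obtains n c where "c \<in> {..<n} \<rightarrow> carrier R" "p n = (\<Oplus>i\<in>{..<n}. c i \<otimes> p i)"
proof -
  define L where "L n = {\<Oplus>i\<in>{..<n}. c i \<otimes> p i | c. c \<in> {..<n} \<rightarrow> carrier R}" for n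
  have ideal: "ideal (L n) R" for n
  proof (rule ideal_criterion)
    show "L n \<subseteq> carrier R"
      using p by (auto simp: L_def intro!: finsum_closed)
    have "(\<Oplus>i\<in>{..<n}. \<zero> \<otimes> p i) = \<zero>"
      using p by (simp add: add.finprod_one_eqI)
    then show "\<zero> \<in> L n"
      by (auto simp: L_def intro!: exI[of _ "\<lambda>_. \<zero>"])
  next
    fix x y assume "x \<in> L n" "y \<in> L n"
    then obtain c d where *: "c \<in> {..<n} \<rightarrow> carrier R" "x = (\<Oplus>i\<in>{..<n}. c i \<otimes> p i)"
      "d \<in> {..<n} \<rightarrow> carrier R" "y = (\<Oplus>i\<in>{..<n}. d i \<otimes> p i)"
      by (auto simp: L_def)
    have "x \<oplus> y = (\<Oplus>i\<in>{..<n}. c i \<otimes> p i \<oplus> d i \<otimes> p i)"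
      unfolding * using * p by (intro finsum_addf[symmetric]) auto
    also have "\<dots> = (\<Oplus>i\<in>{..<n}. (c i \<oplus> d i) \<otimes> p i)"
      using * p by (intro finsum_cong') (auto simp: l_distr Pi_iff)
    finally show "x \<oplus> y \<in> L n"
      unfolding L_def using * by (intro CollectI exI[of _ "\<lambda>i. c i \<oplus> d i"]) auto
  next
    fix r x assume r: "r \<in> carrier R" and "x \<in> L n"
    then obtain c where *: "c \<in> {..<n} \<rightarrow> carrier R" "x = (\<Oplus>i\<in>{..<n}. c i \<otimes> p i)"
      by (auto simp: L_def)
    have "r \<otimes> x = (\<Oplus>i\<in>{..<n}. r \<otimes> (c i \<otimes> p i))"
      unfolding * using * p r by (intro finsum_rdistr) auto
    also have "\<dots> = (\<Oplus>i\<in>{..<n}. (r \<otimes> c i) \<otimes> p i)"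
      using * p r by (intro finsum_cong') (auto simp: m_assoc Pi_iff)
    finally show "r \<otimes> x \<in> L n"
      unfolding L_def using * r by (intro CollectI exI[of _ "\<lambda>i. r \<otimes> c i"]) auto
  qed
  \<comment> \<open>Used twice: with \<open>r = \<zero>\<close> it shows that the chain increases,
    with \<open>x = \<zero>\<close> and \<open>r = \<one>\<close> that \<open>p n\<close> enters at
    stage \<open>Suc n\<close>.\<close>
  have L_Suc: "x \<oplus> r \<otimes> p n \<in> L (Suc n)" if "x \<in> L n" and r: "r \<in> carrier R" for x r n
  proof -
    obtain c where *: "c \<in> {..<n} \<rightarrow> carrier R" "x = (\<Oplus>i\<in>{..<n}. c i \<otimes> p i)"
      using \<open>x \<in> L n\<close> by (auto simp: L_def)
    have "(\<Oplus>i\<in>{..<Suc n}. (c(n := r)) i \<otimes> p i)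
      = r \<otimes> p n \<oplus> (\<Oplus>i\<in>{..<n}. (c(n := r)) i \<otimes> p i)"
      unfolding lessThan_Suc using * r p by (subst finsum_insert) (auto simp: Pi_iff)
    also have "(\<Oplus>i\<in>{..<n}. (c(n := r)) i \<otimes> p i) = x"
      unfolding * using * p by (intro finsum_cong') (auto simp: Pi_iff)
    also have "r \<otimes> p n \<oplus> x = x \<oplus> r \<otimes> p n"
      using r p additive_subgroup.a_Hcarr[OF ideal.axioms(1)[OF ideal] \<open>x \<in> L n\<close>]
      by (simp add: a_comm)
    finally show ?thesis
      unfolding L_def using * r by (intro CollectI exI[of _ "c(n := r)"]) (auto simp: Pi_iff)
  qed
  have zero: "\<zero> \<in> L n" for n
    using ideal by (simp add: additive_subgroup.zero_closed ideal.axioms(1))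
  have "L n \<subseteq> L (Suc n)" for n
    using L_Suc[of _ n \<zero>] p additive_subgroup.a_Hcarr[OF ideal.axioms(1)[OF ideal]]
    by fastforce
  then have mono: "L m \<subseteq> L n" if "m \<le> n" for m n
    using that by (rule lift_Suc_mono_le)
  have "subset.chain {I. ideal I R} (range L)"
    using ideal mono by (auto simp: subset_chain_def) (metis linorder_linear subsetD)
  then have "\<Union>(range L) \<in> range L"
    by (intro ideal_chain_is_trivial) auto
  then obtain n where "\<Union>(range L) = L n"
    by blast
  moreover have "p n \<in> L (Suc n)"
    using L_Suc[OF zero, of \<one> n] p by simp
  ultimately have "p n \<in> L n"
    by blast
  with that show thesis
    by (auto simp: L_def)
qed

sublocale dedekind_domain \<subseteq> domain_with_fractions ..

context dedekind_domain
begin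

text \<open>
  If multiplication by \<open>a/b\<close> can be iterated inside \<open>R\<close> starting from some nonzero element, then
  \<open>a/b\<close> is integral by noetherianity. This replaces the determinant trick.
\<close>

lemma divides_if_iterated_multiples:
  assumes a: "a \<in> carrier R" and b: "b \<in> carrier R" "b \<noteq> \<zero>"
    and p: "\<And>n::nat. p n \<in> carrier R" "p 0 \<noteq> \<zero>"
    and step: "\<And>n. a \<otimes> p n = b \<otimes> p (Suc n)"
  obtains r where "r \<in> carrier R" "a = r \<otimes> b"
proof -
  interpret \<epsilon>: ring_hom_cring R K \<epsilon>
    by (rule frac_embed_hom)
  define x where "x = fraction R a b"
  have x: "x \<in> carrier K" and xb: "x \<otimes>\<^bsub>K\<^esub> \<epsilon> b = \<epsilon> a"
    using a b by (simp_all add: x_def fraction_times_denominator)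
  \<comment> \<open>In the fraction field the recursion says that \<open>p\<close> is geometric with
    ratio \<open>x = a/b\<close>. A combination expressing \<open>p n\<close> by earlier terms thus
    becomes, after cancelling \<open>p 0\<close>, a monic equation for \<open>x\<close>.\<close>
  have pn: "\<epsilon> (p n) = \<epsilon> (p 0) \<otimes>\<^bsub>K\<^esub> x [^]\<^bsub>K\<^esub> n" for n
  proof (induction n)
    case (Suc n)
    have "\<epsilon> b \<otimes>\<^bsub>K\<^esub> \<epsilon> (p (Suc n)) = \<epsilon> (a \<otimes> p n)"
      using b p by (simp add: step)
    also have "\<dots> = x \<otimes>\<^bsub>K\<^esub> \<epsilon> b \<otimes>\<^bsub>K\<^esub> (\<epsilon> (p 0) \<otimes>\<^bsub>K\<^esub> x [^]\<^bsub>K\<^esub> n)"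
      using a p by (simp add: xb Suc)
    also have "\<dots> = \<epsilon> b \<otimes>\<^bsub>K\<^esub> (\<epsilon> (p 0) \<otimes>\<^bsub>K\<^esub> x [^]\<^bsub>K\<^esub> Suc n)"
      using x b p by (simp add: K.m_ac)
    finally show ?case
      using x b p by (subst (asm) K.m_lcancel) auto
  qed (use p in simp)
  obtain n c where c: "c \<in> {..<n} \<rightarrow> carrier R" "p n = (\<Oplus>i\<in>{..<n}. c i \<otimes> p i)"
    using sequence_term_combination[OF p(1)] .
  have "\<epsilon> (p 0) \<otimes>\<^bsub>K\<^esub> x [^]\<^bsub>K\<^esub> n = (\<Oplus>\<^bsub>K\<^esub>i\<in>{..<n}. \<epsilon> (c i \<otimes> p i))"
    using c p by (simp flip: pn) (simp add: Pi_iff comp_def)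
  also have "\<dots> = (\<Oplus>\<^bsub>K\<^esub>i\<in>{..<n}. \<epsilon> (p 0) \<otimes>\<^bsub>K\<^esub> (\<epsilon> (c i) \<otimes>\<^bsub>K\<^esub> x [^]\<^bsub>K\<^esub> i))"
  proof (rule K.finsum_cong')
    fix i assume "i \<in> {..<n}"
    with c p x show "\<epsilon> (c i \<otimes> p i) = \<epsilon> (p 0) \<otimes>\<^bsub>K\<^esub> (\<epsilon> (c i) \<otimes>\<^bsub>K\<^esub> x [^]\<^bsub>K\<^esub> i)"
      by (simp add: Pi_iff pn[of i] K.m_lcomm)
  qed (use c p x in \<open>auto simp: Pi_iff\<close>)
  also have "\<dots> = \<epsilon> (p 0) \<otimes>\<^bsub>K\<^esub> (\<Oplus>\<^bsub>K\<^esub>i\<in>{..<n}. \<epsilon> (c i) \<otimes>\<^bsub>K\<^esub> x [^]\<^bsub>K\<^esub> i)"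
    using c p x by (intro K.finsum_rdistr[symmetric]) (auto simp: Pi_iff)
  finally have eq: "x [^]\<^bsub>K\<^esub> n = (\<Oplus>\<^bsub>K\<^esub>i\<in>{..<n}. \<epsilon> (c i) \<otimes>\<^bsub>K\<^esub> x [^]\<^bsub>K\<^esub> i)"
    using c p x by (subst (asm) K.m_lcancel) (auto simp: Pi_iff intro!: K.finsum_closed)
  have "(\<Oplus>\<^bsub>K\<^esub>i\<in>{..<n}. \<epsilon> (\<ominus> c i) \<otimes>\<^bsub>K\<^esub> x [^]\<^bsub>K\<^esub> i)
      = (\<Oplus>\<^bsub>K\<^esub>i\<in>{..<n}. (\<ominus>\<^bsub>K\<^esub> \<one>\<^bsub>K\<^esub>) \<otimes>\<^bsub>K\<^esub> (\<epsilon> (c i) \<otimes>\<^bsub>K\<^esub> x [^]\<^bsub>K\<^esub> i))"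
    using c x by (intro K.finsum_cong') (auto simp: Pi_iff K.l_minus)
  also have "\<dots> = (\<ominus>\<^bsub>K\<^esub> \<one>\<^bsub>K\<^esub>) \<otimes>\<^bsub>K\<^esub> x [^]\<^bsub>K\<^esub> n"
    unfolding eq using c x by (intro K.finsum_rdistr[symmetric]) (auto simp: Pi_iff)
  finally have "x [^]\<^bsub>K\<^esub> n \<oplus>\<^bsub>K\<^esub> (\<Oplus>\<^bsub>K\<^esub>i\<in>{..<n}. \<epsilon> (\<ominus> c i) \<otimes>\<^bsub>K\<^esub> x [^]\<^bsub>K\<^esub> i) = \<zero>\<^bsub>K\<^esub>"
    using x by (simp add: K.l_minus K.r_neg)
  moreover have "(\<lambda>i. \<ominus> c i) \<in> {..<n} \<rightarrow> carrier R"
    using c by auto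
  ultimately have "integral_over R x"
    unfolding integral_over_def Let_def by blast
  with integrally_closed[OF x] obtain r where r: "r \<in> carrier R" "x = \<epsilon> r"
    by auto
  with xb a b have "\<epsilon> (r \<otimes> b) = \<epsilon> a"
    by simp
  with r a b have "a = r \<otimes> b"
    by (subst (asm) frac_embed_eq_iff) auto
  with r that show thesis
    by blast
qed

lemma exists_maximal_ideal_above:
  assumes "ideal I R" "\<one> \<notin> I"
  obtains P where "maximalideal P R" "I \<subseteq> P"
proof -
  define S where "S = {J. ideal J R \<and> I \<subseteq> J \<and> \<one> \<notin> J}"
  have "I \<in> S"
    using assms by (simp add: S_def)
  then have "S \<noteq> {}"
    by auto
  then obtain P where P: "P \<in> S" "\<And>J. J \<in> S \<Longrightarrow> P \<subseteq> J \<Longrightarrow> J = P"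
    by (rule exists_maximal_in_ideals) (auto simp: S_def)
  have "maximalideal P R"
  proof (rule maximalidealI)
    fix J assume J: "ideal J R" "P \<subseteq> J" "J \<subseteq> carrier R"
    show "J = P \<or> J = carrier R"
    proof (cases "\<one> \<in> J")
      case True
      with ideal.one_imp_carrier[OF J(1)] show ?thesis
        by simp
    next
      case False
      with J P(1) have "J \<in> S"
        by (auto simp: S_def)
      with P(2) J(2) show ?thesis
        by simp
    qed
  qed (use P in \<open>auto simp: S_def\<close>)
  with P that show thesis
    by (auto simp: S_def)
qed

text \<open>
  Among the annihilators of elements of \<open>R/(b)\<close> contained in a maximal ideal \<open>P\<close>, a maximal one is
  prime, hence equal to \<open>P\<close>.
\<close>

lemma exists_nonmultiple_annihilated:
  assumes I: "ideal I R" "\<one> \<notin> I" and b: "b \<in> I" "b \<noteq> \<zero>"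
  shows "\<exists>a\<in>carrier R. (\<forall>r\<in>carrier R. a \<noteq> r \<otimes> b) \<and> (\<forall>i\<in>I. \<exists>r\<in>carrier R. a \<otimes> i = r \<otimes> b)"
proof -
  obtain P where P: "maximalideal P R" "I \<subseteq> P"
    using exists_maximal_ideal_above[OF I] .
  interpret P: maximalideal P R
    by (rule P)
  have bc: "b \<in> carrier R"
    using I b by (auto dest: ideal.Icarr)
  \<comment> \<open>\<open>ann a\<close> is the annihilator of the class of \<open>a\<close> in
    \<open>R/(b)\<close>; in particular \<open>ann \<one>\<close> is the ideal \<open>(b)\<close>,
    which lies in \<open>P\<close> because \<open>b \<in> I\<close>.\<close>
  define ann where "ann a = {r \<in> carrier R. \<exists>s\<in>carrier R. a \<otimes> r = s \<otimes> b}" for a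
  have ideal_ann: "ideal (ann a) R" if a: "a \<in> carrier R" for a
  proof (rule ideal_criterion)
    show "\<zero> \<in> ann a"
      using a bc unfolding ann_def by (intro CollectI conjI bexI[of _ \<zero>]) simp_all
  next
    fix x y assume "x \<in> ann a" "y \<in> ann a"
    then obtain s t where "x \<in> carrier R" "y \<in> carrier R" "s \<in> carrier R" "t \<in> carrier R"
      "a \<otimes> x = s \<otimes> b" "a \<otimes> y = t \<otimes> b"
      by (auto simp: ann_def)
    then show "x \<oplus> y \<in> ann a"
      using a bc unfolding ann_def by (intro CollectI conjI bexI[of _ "s \<oplus> t"]) (simp_all add: r_distr l_distr)
  next
    fix r x assume "r \<in> carrier R" "x \<in> ann a"
    then obtain s where "r \<in> carrier R" "x \<in> carrier R" "s \<in> carrier R" "a \<otimes> x = s \<otimes> b"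
      by (auto simp: ann_def)
    then show "r \<otimes> x \<in> ann a"
      using a bc unfolding ann_def
      by (intro CollectI conjI bexI[of _ "r \<otimes> s"]) (simp_all add: m_lcomm[of a r] m_assoc)
  qed (auto simp: ann_def)
  have "ann \<one> \<subseteq> P"
    using P(2) b P.I_l_closed by (auto simp: ann_def)
  then have "{ann a | a. a \<in> carrier R \<and> ann a \<subseteq> P} \<noteq> {}"
    by auto
  then obtain Q where Q: "Q \<in> {ann a | a. a \<in> carrier R \<and> ann a \<subseteq> P}"
    "\<And>J. J \<in> {ann a | a. a \<in> carrier R \<and> ann a \<subseteq> P} \<Longrightarrow> Q \<subseteq> J \<Longrightarrow> J = Q"
    by (rule exists_maximal_in_ideals) (use ideal_ann in auto)
  then obtain a where a: "a \<in> carrier R" "ann a \<subseteq> P" "Q = ann a"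
    by auto
  have Qmax: "ann a' = ann a" if "a' \<in> carrier R" "ann a' \<subseteq> P" "ann a \<subseteq> ann a'" for a'
    using Q(2)[of "ann a'"] that a by auto
  have mult: "ann a \<subseteq> ann (a \<otimes> x)" if x: "x \<in> carrier R" for x
  proof
    fix r assume "r \<in> ann a"
    then obtain s where "r \<in> carrier R" "s \<in> carrier R" "a \<otimes> r = s \<otimes> b"
      by (auto simp: ann_def)
    moreover from this have "a \<otimes> x \<otimes> r = (x \<otimes> s) \<otimes> b"
      using a(1) x bc by (simp add: m_assoc m_lcomm[of a x])
    ultimately show "r \<in> ann (a \<otimes> x)"
      using x by (auto simp: ann_def)
  qed
  have swap: "r \<in> ann (a \<otimes> x) \<longleftrightarrow> x \<otimes> r \<in> ann a"
    if "x \<in> carrier R" "r \<in> carrier R" for x r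
    using that a(1) by (simp add: ann_def m_assoc)
  have "primeideal (ann a) R"
  proof (rule primeidealI)
    show "carrier R \<noteq> ann a"
      using a(2) P.I_notcarr P.a_subset by auto
  next
    fix x y assume xy: "x \<in> carrier R" "y \<in> carrier R" "x \<otimes> y \<in> ann a"
    show "x \<in> ann a \<or> y \<in> ann a"
    proof (cases "ann (a \<otimes> x) \<subseteq> P")
      case True
      then have "ann (a \<otimes> x) = ann a"
        using a(1) xy(1) mult by (intro Qmax) simp_all
      with swap[OF xy(1,2)] xy(3) show ?thesis
        by simp
    next
      case False
      then obtain s where s: "s \<in> ann (a \<otimes> x)" "s \<notin> P"
        by auto
      then have sc: "s \<in> carrier R"
        by (auto simp: ann_def)
      \<comment> \<open>If \<open>s \<otimes> t\<close> kills \<open>a\<close> modulo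
        \<open>b\<close>, it lies in the prime ideal \<open>P\<close>, while \<open>s\<close> does
        not; hence \<open>t \<in> P\<close>. Maximality now gives
        \<open>ann (a \<otimes> s) = ann a\<close>, and \<open>x\<close> lies in the former because
        \<open>x \<otimes> s\<close> kills \<open>a\<close>.\<close>
      have "ann (a \<otimes> s) \<subseteq> P"
      proof
        fix t assume t: "t \<in> ann (a \<otimes> s)"
        then have tc: "t \<in> carrier R"
          by (auto simp: ann_def)
        with t have "s \<otimes> t \<in> ann a"
          using swap[OF sc] by simp
        with a(2) have "s \<otimes> t \<in> P"
          by blast
        with s tc sc show "t \<in> P"
          using primeideal.I_prime[OF maximalideal_prime[OF P.is_maximalideal], of s t] by simp
      qed
      then have "ann (a \<otimes> s) = ann a"
        using a(1) sc mult by (intro Qmax) simp_all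
      moreover have "x \<otimes> s \<in> ann a"
        using s(1) swap[OF xy(1) sc] by simp
      ultimately show ?thesis
        using swap[OF sc xy(1)] xy(1) sc by (simp add: m_comm)
    qed
  qed (use ideal_ann a is_cring in auto)
  moreover have "b \<in> ann a"
    using a bc by (auto simp: ann_def)
  ultimately have "maximalideal (ann a) R"
    using b(2) nonzero_prime_maximal by blast
  then have "ann a = P"
    using maximalideal.I_maximal[of "ann a" R P] a P.ideal_axioms P.I_notcarr P.a_subset by auto
  with P(2) have "\<exists>r\<in>carrier R. a \<otimes> i = r \<otimes> b" if "i \<in> I" for i
    using that by (auto simp: ann_def)
  moreover have "a \<noteq> r \<otimes> b" if "r \<in> carrier R" for r
  proof
    assume "a = r \<otimes> b"
    then have "\<one> \<in> P"
      unfolding \<open>ann a = P\<close>[symmetric] using \<open>r \<in> carrier R\<close> bc by (auto simp: ann_def)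
    then show False
      using P.one_imp_carrier P.I_notcarr by auto
  qed
  ultimately show ?thesis
    using a(1) by auto
qed

section \<open>Invertibility of nonzero ideals\<close>

text \<open>This is invertibility expressed inside \<open>R\<close>: the two conditions together say
  \<open>I J = (a)\<close> with \<open>a \<noteq> 0\<close>, so that \<open>(1/a) J\<close> is the
  inverse of \<open>I\<close> as a fractional ideal.\<close>

definition has_cofactor where
  "has_cofactor I \<longleftrightarrow> (\<exists>J a. ideal J R \<and> a \<in> ideal_prod R I J \<and> a \<noteq> \<zero> \<and>
     (\<forall>i\<in>I. \<forall>j\<in>J. \<exists>r\<in>carrier R. i \<otimes> j = a \<otimes> r))"

text \<open>
  For an ideal \<open>I\<close> maximal without cofactor, \<open>I + (a/b) I\<close> is strictly larger for suitable \<open>a\<close> and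
  \<open>b\<close>, and a cofactor \<open>J\<close> of it gives the cofactor \<open>b J + a J\<close> of \<open>I\<close>.
\<close>

theorem nonzero_ideal_has_cofactor:
  assumes "ideal I R" "I \<noteq> {\<zero>}"
  shows "has_cofactor I"
proof (rule ccontr)
  assume "\<not> has_cofactor I"
  with assms have "{I. ideal I R \<and> I \<noteq> {\<zero>} \<and> \<not> has_cofactor I} \<noteq> {}"
    by auto
  then obtain M where M: "M \<in> {I. ideal I R \<and> I \<noteq> {\<zero>} \<and> \<not> has_cofactor I}"
    and max: "\<And>I. I \<in> {I. ideal I R \<and> I \<noteq> {\<zero>} \<and> \<not> has_cofactor I} \<Longrightarrow> M \<subseteq> I \<Longrightarrow> I = M"
    by (rule exists_maximal_in_ideals) auto
  interpret M: ideal M R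
    using M by simp
  have "has_cofactor (carrier R)"
    unfolding has_cofactor_def
    using oneideal ideal_prod.prod[of \<one> "carrier R" \<one> "carrier R" R]
    by (intro exI[of _ "carrier R"] exI[of _ \<one>]) auto
  with M have "\<one> \<notin> M"
    using M.one_imp_carrier by auto
  obtain b where b: "b \<in> M" "b \<noteq> \<zero>"
    using M M.zero_closed by fastforce
  have bc: "b \<in> carrier R"
    using b by simp
  obtain a where a: "a \<in> carrier R" "\<And>r. r \<in> carrier R \<Longrightarrow> a \<noteq> r \<otimes> b"
    "\<And>i. i \<in> M \<Longrightarrow> \<exists>r\<in>carrier R. a \<otimes> i = r \<otimes> b"
    using exists_nonmultiple_annihilated[OF M.ideal_axioms \<open>\<one> \<notin> M\<close> b] by blast
  \<comment> \<open>\<open>N\<close> is \<open>M + (a/b) M\<close> with the denominator cleared. It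
    consists of elements of \<open>R\<close> because \<open>b\<close> divides
    \<open>a \<otimes> i\<close> for every \<open>i \<in> M\<close>.\<close>
  define N where "N = {r \<in> carrier R. \<exists>i\<in>M. \<exists>j\<in>M. b \<otimes> r = b \<otimes> i \<oplus> a \<otimes> j}"
  have "ideal N R"
  proof (rule ideal_criterion)
    show "\<zero> \<in> N"
      using a(1) bc by (auto simp: N_def intro!: bexI[of _ \<zero>])
  next
    fix x y assume "x \<in> N" "y \<in> N"
    then obtain i j k l where *: "x \<in> carrier R" "y \<in> carrier R" "i \<in> M" "j \<in> M" "k \<in> M" "l \<in> M"
      "b \<otimes> x = b \<otimes> i \<oplus> a \<otimes> j" "b \<otimes> y = b \<otimes> k \<oplus> a \<otimes> l"
      by (auto simp: N_def)
    then have "b \<otimes> (x \<oplus> y) = b \<otimes> (i \<oplus> k) \<oplus> a \<otimes> (j \<oplus> l)"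
      using a(1) bc by (simp add: r_distr a_ac)
    with * show "x \<oplus> y \<in> N"
      unfolding N_def by blast
  next
    fix r x assume "r \<in> carrier R" "x \<in> N"
    then obtain i j where *: "r \<in> carrier R" "x \<in> carrier R" "i \<in> M" "j \<in> M"
      "b \<otimes> x = b \<otimes> i \<oplus> a \<otimes> j"
      by (auto simp: N_def)
    have "b \<otimes> (r \<otimes> x) = r \<otimes> (b \<otimes> x)"
      using *(1,2) bc by (simp add: m_lcomm)
    also have "\<dots> = b \<otimes> (r \<otimes> i) \<oplus> a \<otimes> (r \<otimes> j)"
      unfolding *(5) using *(1-4) a(1) bc by (simp add: m_lcomm[of r] r_distr)
    finally have "b \<otimes> (r \<otimes> x) = b \<otimes> (r \<otimes> i) \<oplus> a \<otimes> (r \<otimes> j)" .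
    with * show "r \<otimes> x \<in> N"
      unfolding N_def using bc
      by (intro CollectI conjI bexI[of _ "r \<otimes> i"] bexI[of _ "r \<otimes> j"]) (auto intro: M.I_l_closed)
  qed (auto simp: N_def)
  have "M \<subseteq> N"
  proof
    fix x assume "x \<in> M"
    with a(1) bc show "x \<in> N"
      unfolding N_def by (intro CollectI conjI bexI[of _ x] bexI[of _ \<zero>]) auto
  qed
  have step: "\<exists>r\<in>N. a \<otimes> i = b \<otimes> r" if "i \<in> M" for i
  proof -
    obtain r where "r \<in> carrier R" "a \<otimes> i = r \<otimes> b"
      using a(3)[OF \<open>i \<in> M\<close>] by blast
    then show ?thesis
      unfolding N_def using that a(1) bc
      by (intro bexI[of _ r] CollectI conjI bexI[of _ \<zero>] bexI[of _ i]) (simp_all add: m_comm)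
  qed
  \<comment> \<open>Otherwise multiplication by \<open>a/b\<close> maps \<open>M\<close> into
    itself. Iterating it from the nonzero element \<open>b\<close> of \<open>M\<close> never leaves
    \<open>R\<close>, so \<open>a\<close> would be a multiple of \<open>b\<close>, contrary to its
    choice.\<close>
  have "N \<noteq> M"
  proof
    assume "N = M"
    with step have "\<forall>i\<in>M. \<exists>r. r \<in> M \<and> a \<otimes> i = b \<otimes> r"
      by auto
    from bchoice[OF this] obtain g
      where g: "\<And>i. i \<in> M \<Longrightarrow> g i \<in> M" "\<And>i. i \<in> M \<Longrightarrow> a \<otimes> i = b \<otimes> g i"
      by blast
    have gn: "(g ^^ n) b \<in> M" for n
      by (induction n) (simp_all add: b g(1))
    obtain r where "r \<in> carrier R" "a = r \<otimes> b"
    proof (rule divides_if_iterated_multiples[of a b "\<lambda>n. (g ^^ n) b"])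
      show "a \<otimes> (g ^^ n) b = b \<otimes> (g ^^ Suc n) b" for n
        using g(2)[OF gn[of n]] by simp
    qed (use a(1) bc b gn in auto)
    with a show False
      by auto
  qed
  moreover have "N \<noteq> {\<zero>}"
    using \<open>M \<subseteq> N\<close> b by auto
  ultimately have "has_cofactor N"
    using max[of N] \<open>ideal N R\<close> \<open>M \<subseteq> N\<close> by auto
  then obtain J c where J: "ideal J R" and c: "c \<in> ideal_prod R N J" "c \<noteq> \<zero>"
    and NJ: "\<And>i j. i \<in> N \<Longrightarrow> j \<in> J \<Longrightarrow> \<exists>r\<in>carrier R. i \<otimes> j = c \<otimes> r"
    unfolding has_cofactor_def by blast
  interpret J: ideal J R
    by (rule J)
  have cc: "c \<in> carrier R"
    using ideal_prod_in_carrier[OF \<open>ideal N R\<close> J] c by auto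
  define J' where "J' = {b \<otimes> j \<oplus> a \<otimes> k | j k. j \<in> J \<and> k \<in> J}"
  have "ideal J' R"
  proof (rule ideal_criterion)
    show "\<zero> \<in> J'"
      unfolding J'_def using a(1) bc by (intro CollectI exI[of _ \<zero>]) simp
  next
    fix x y assume "x \<in> J'" "y \<in> J'"
    then obtain j k l m where *: "j \<in> J" "k \<in> J" "l \<in> J" "m \<in> J"
      "x = b \<otimes> j \<oplus> a \<otimes> k" "y = b \<otimes> l \<oplus> a \<otimes> m"
      by (auto simp: J'_def)
    then have "x \<oplus> y = b \<otimes> (j \<oplus> l) \<oplus> a \<otimes> (k \<oplus> m)"
      using a(1) bc by (simp add: r_distr a_ac)
    with * show "x \<oplus> y \<in> J'"
      unfolding J'_def by blast
  next
    fix r x assume "r \<in> carrier R" "x \<in> J'"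
    then obtain j k where *: "r \<in> carrier R" "j \<in> J" "k \<in> J" "x = b \<otimes> j \<oplus> a \<otimes> k"
      by (auto simp: J'_def)
    then have "r \<otimes> x = b \<otimes> (r \<otimes> j) \<oplus> a \<otimes> (r \<otimes> k)"
      using a(1) bc by (simp add: m_lcomm[of _ r] r_distr)
    with * show "r \<otimes> x \<in> J'"
      unfolding J'_def using J.I_l_closed by blast
  qed (use a(1) bc in \<open>auto simp: J'_def\<close>)
  \<comment> \<open>For \<open>n \<in> N\<close> with \<open>b n = b i + a k\<close>, the product
    \<open>b n j\<close> regroups as \<open>i (b j) + k (a j)\<close>, a sum of two products from
    \<open>M\<close> and \<open>J'\<close>. So \<open>b\<close> times \<open>N J\<close> lies in
    \<open>M J'\<close>, and the generator \<open>c\<close> of \<open>N J\<close> is replaced by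
    \<open>b c\<close>.\<close>
  have "b \<otimes> z \<in> ideal_prod R M J' \<and> z \<in> carrier R" if "z \<in> ideal_prod R N J" for z
    using that
  proof induction
    case (prod n j)
    then obtain i k where *: "n \<in> carrier R" "i \<in> M" "k \<in> M" "b \<otimes> n = b \<otimes> i \<oplus> a \<otimes> k"
      by (auto simp: N_def)
    have "b \<otimes> (n \<otimes> j) = (b \<otimes> n) \<otimes> j"
      using *(1) prod bc by (simp add: m_assoc)
    also have "\<dots> = i \<otimes> (b \<otimes> j) \<oplus> k \<otimes> (a \<otimes> j)"
      unfolding * using *(1-3) prod bc a(1) by (simp add: l_distr m_assoc m_lcomm)
    finally have eq: "b \<otimes> (n \<otimes> j) = i \<otimes> (b \<otimes> j) \<oplus> k \<otimes> (a \<otimes> j)" .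
    have "b \<otimes> j \<in> J'" "a \<otimes> j \<in> J'"
      unfolding J'_def
      by (rule CollectI, rule exI[of _ j], rule exI[of _ \<zero>], use prod a(1) bc in simp)
        (rule CollectI, rule exI[of _ \<zero>], rule exI[of _ j], use prod a(1) bc in simp)
    with * prod show ?case
      unfolding eq by (auto intro!: ideal_prod.intros)
  next
    case (sum x y)
    then show ?case
      using bc by (auto simp: r_distr intro!: ideal_prod.sum)
  qed
  with c have "b \<otimes> c \<in> ideal_prod R M J'"
    by blast
  moreover have "b \<otimes> c \<noteq> \<zero>"
    using b c bc cc integral by blast
  \<comment> \<open>Conversely \<open>i (b j + a k) = b (i j + r k)\<close>, where \<open>r\<close>
    is \<open>a i / b\<close> and lies in \<open>N\<close>. Both \<open>i j\<close> and
    \<open>r k\<close> are then products from \<open>N\<close> and \<open>J\<close>, hence multiples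
    of \<open>c\<close>.\<close>
  moreover have "\<exists>r\<in>carrier R. i \<otimes> y = b \<otimes> c \<otimes> r" if "i \<in> M" "y \<in> J'" for i y
  proof -
    obtain j k where *: "j \<in> J" "k \<in> J" "y = b \<otimes> j \<oplus> a \<otimes> k"
      using \<open>y \<in> J'\<close> by (auto simp: J'_def)
    obtain r where r: "r \<in> N" "a \<otimes> i = b \<otimes> r"
      using step \<open>i \<in> M\<close> by blast
    have ic: "i \<in> carrier R" "r \<in> carrier R"
      using that r by (auto simp: N_def)
    have "\<exists>u\<in>carrier R. i \<otimes> j = c \<otimes> u"
      using NJ * that \<open>M \<subseteq> N\<close> by blast
    then obtain u where u: "u \<in> carrier R" "i \<otimes> j = c \<otimes> u"
      by blast
    obtain v where v: "v \<in> carrier R" "r \<otimes> k = c \<otimes> v"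
      using NJ * r by blast
    have "i \<otimes> y = b \<otimes> (i \<otimes> j) \<oplus> (a \<otimes> i) \<otimes> k"
      unfolding * using *(1,2) ic a(1) bc by (simp add: r_distr m_ac)
    also have "\<dots> = b \<otimes> (i \<otimes> j) \<oplus> b \<otimes> (r \<otimes> k)"
      unfolding r using *(1,2) ic bc by (simp add: m_assoc)
    also have "\<dots> = b \<otimes> c \<otimes> (u \<oplus> v)"
      unfolding u v using u(1) v(1) cc bc by (simp add: r_distr m_assoc)
    finally show ?thesis
      using u v by blast
  qed
  ultimately have "has_cofactor M"
    unfolding has_cofactor_def using \<open>ideal J' R\<close>
    by (intro exI[of _ J'] exI[of _ "b \<otimes> c"]) auto
  with M show False
    by simp
qed

end

section \<open>Torsionless modules of rank at most one\<close>

text \<open>The target is the ring itself, which is not a module record, so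
  \<open>module_hom\<close> cannot express it.\<close>

definition linear_functional ::
    "('a, 'r) ring_scheme \<Rightarrow> ('a, 'b, 'm) module_scheme \<Rightarrow> ('b \<Rightarrow> 'a) \<Rightarrow> bool" where
  "linear_functional R M f \<longleftrightarrow> f \<in> carrier M \<rightarrow> carrier R \<and>
     (\<forall>x\<in>carrier M. \<forall>y\<in>carrier M. f (x \<oplus>\<^bsub>M\<^esub> y) = f x \<oplus>\<^bsub>R\<^esub> f y) \<and>
     (\<forall>r\<in>carrier R. \<forall>x\<in>carrier M. f (r \<odot>\<^bsub>M\<^esub> x) = r \<otimes>\<^bsub>R\<^esub> f x)"

definition torsionless :: "('a, 'r) ring_scheme \<Rightarrow> ('a, 'b, 'm) module_scheme \<Rightarrow> bool" where
  "torsionless R M \<longleftrightarrow>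
     (\<forall>x\<in>carrier M. x \<noteq> \<zero>\<^bsub>M\<^esub> \<longrightarrow> (\<exists>f. linear_functional R M f \<and> f x \<noteq> \<zero>\<^bsub>R\<^esub>))"

definition torsion_free :: "('a, 'r) ring_scheme \<Rightarrow> ('a, 'b, 'm) module_scheme \<Rightarrow> bool" where
  "torsion_free R M \<longleftrightarrow>
     (\<forall>r\<in>carrier R. \<forall>x\<in>carrier M. r \<odot>\<^bsub>M\<^esub> x = \<zero>\<^bsub>M\<^esub> \<longrightarrow> r = \<zero>\<^bsub>R\<^esub> \<or> x = \<zero>\<^bsub>M\<^esub>)"

lemma torsion_freeD:
  assumes "torsion_free R M" "r \<in> carrier R" "x \<in> carrier M" "r \<odot>\<^bsub>M\<^esub> x = \<zero>\<^bsub>M\<^esub>"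
  shows "r = \<zero>\<^bsub>R\<^esub> \<or> x = \<zero>\<^bsub>M\<^esub>"
  using assms unfolding torsion_free_def by simp

text \<open>For torsion-free modules over a domain this says that the rank is at most one.\<close>

definition pairwise_dependent :: "('a, 'r) ring_scheme \<Rightarrow> ('a, 'b, 'm) module_scheme \<Rightarrow> bool" where
  "pairwise_dependent R M \<longleftrightarrow>
     (\<forall>x\<in>carrier M. \<forall>y\<in>carrier M. \<exists>r\<in>carrier R. \<exists>s\<in>carrier R.
        (r \<noteq> \<zero>\<^bsub>R\<^esub> \<or> s \<noteq> \<zero>\<^bsub>R\<^esub>) \<and> r \<odot>\<^bsub>M\<^esub> x = s \<odot>\<^bsub>M\<^esub> y)"

lemma linear_functionalD:
  assumes "linear_functional R M f"
  shows "x \<in> carrier M \<Longrightarrow> f x \<in> carrier R"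
    "x \<in> carrier M \<Longrightarrow> y \<in> carrier M \<Longrightarrow> f (x \<oplus>\<^bsub>M\<^esub> y) = f x \<oplus>\<^bsub>R\<^esub> f y"
    "r \<in> carrier R \<Longrightarrow> x \<in> carrier M \<Longrightarrow> f (r \<odot>\<^bsub>M\<^esub> x) = r \<otimes>\<^bsub>R\<^esub> f x"
  using assms by (auto simp: linear_functional_def)

lemma (in Module.module) linear_functional_zero:
  assumes "linear_functional R M f"
  shows "f \<zero>\<^bsub>M\<^esub> = \<zero>"
  using linear_functionalD(3)[OF assms, of \<zero> "\<zero>\<^bsub>M\<^esub>"] linear_functionalD(1)[OF assms, of "\<zero>\<^bsub>M\<^esub>"]
  by simp

lemma (in Module.module) internal_direct_sum_iff:
  "internal_direct_sum R M A B \<longleftrightarrow>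
     LinearCombinations.submodule R A M \<and> LinearCombinations.submodule R B M \<and>
     A \<inter> B = {\<zero>\<^bsub>M\<^esub>} \<and> (\<forall>x\<in>carrier M. \<exists>a\<in>A. \<exists>b\<in>B. x = a \<oplus>\<^bsub>M\<^esub> b)"
proof -
  have "submodule_sum A B = carrier M \<longleftrightarrow> (\<forall>x\<in>carrier M. \<exists>a\<in>A. \<exists>b\<in>B. x = a \<oplus>\<^bsub>M\<^esub> b)"
    if "A \<subseteq> carrier M" "B \<subseteq> carrier M"
  proof -
    have "submodule_sum A B = {a \<oplus>\<^bsub>M\<^esub> b | a b. a \<in> A \<and> b \<in> B}"
      by (auto simp: submodule_sum_def)
    moreover have "{a \<oplus>\<^bsub>M\<^esub> b | a b. a \<in> A \<and> b \<in> B} \<subseteq> carrier M"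
      using that by auto
    ultimately show ?thesis
      by blast
  qed
  then show ?thesis
    unfolding internal_direct_sum_def by (auto dest: LinearCombinations.submodule.subset)
qed

lemma (in Module.module) zero_submodule: "LinearCombinations.submodule R {\<zero>\<^bsub>M\<^esub>} M"
  by (rule LinearCombinations.submodule.intro) (auto intro: module_axioms)

lemma (in Module.module) carrier_submodule: "LinearCombinations.submodule R (carrier M) M"
  by (rule LinearCombinations.submodule.intro) (auto intro: module_axioms)

lemma (in Module.module) direct_summand_zero: "direct_summand R M {\<zero>\<^bsub>M\<^esub>}"
  unfolding direct_summand_def internal_direct_sum_iff
  using zero_submodule carrier_submodule by (intro exI[of _ "carrier M"]) auto

text \<open>A functional that does not vanish at \<open>x\<close> carries \<open>r x = 0\<close> to
  \<open>r f(x) = 0\<close>, an equation in a domain.\<close>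

lemma (in domain) torsionless_imp_torsion_free:
  assumes "Module.module R M" "torsionless R M"
  shows "torsion_free R M"
  unfolding torsion_free_def
proof (intro ballI impI)
  interpret M: Module.module R M by fact
  fix r x assume *: "r \<in> carrier R" "x \<in> carrier M" "r \<odot>\<^bsub>M\<^esub> x = \<zero>\<^bsub>M\<^esub>"
  show "r = \<zero> \<or> x = \<zero>\<^bsub>M\<^esub>"
  proof (cases "x = \<zero>\<^bsub>M\<^esub>")
    case False
    then obtain f where f: "linear_functional R M f" "f x \<noteq> \<zero>"
      using assms(2) * by (auto simp: torsionless_def)
    have "r \<otimes> f x = \<zero>"
      using M.linear_functional_zero[OF f(1)] linear_functionalD(3)[OF f(1) *(1,2)] * by simp
    then show ?thesis
      using f(2) *(1) linear_functionalD(1)[OF f(1) *(2)] integral by blast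
  qed simp
qed

section \<open>The C4 property under pairwise dependence\<close>

lemma pairwise_dependent_submodule:
  assumes "pairwise_dependent R M" "LinearCombinations.submodule R N M"
  shows "pairwise_dependent R (M\<lparr>carrier := N\<rparr>)"
  using assms LinearCombinations.submodule.subset[OF assms(2)]
  unfolding pairwise_dependent_def by (simp add: subset_iff)

lemma torsion_free_submodule:
  assumes "torsion_free R M" "LinearCombinations.submodule R N M"
  shows "torsion_free R (M\<lparr>carrier := N\<rparr>)"
  using assms LinearCombinations.submodule.subset[OF assms(2)]
  unfolding torsion_free_def by (simp add: subset_iff)

text \<open>Nonzero \<open>a \<in> A\<close> and \<open>b \<in> B\<close> would have a common
  multiple in \<open>A \<inter> B = 0\<close>, and torsion-freeness would make both coefficients
  zero. So \<open>A\<close> or \<open>B\<close> vanishes, every homomorphism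
  \<open>A \<rightarrow> B\<close> is zero, and its image is the zero summand of
  \<open>B\<close>.\<close>

lemma (in domain) pairwise_dependent_imp_C4:
  assumes M: "Module.module R M" and tf: "torsion_free R M" and pd: "pairwise_dependent R M"
  shows "C4_module R M"
  unfolding C4_module_def
proof (intro allI impI, elim conjE)
  interpret M: Module.module R M by (rule M)
  fix A B f
  assume AB: "internal_direct_sum R M A B"
    and f: "f \<in> LinearCombinations.module_hom R (M\<lparr>carrier := A\<rparr>) (M\<lparr>carrier := B\<rparr>)"
  from AB have A: "LinearCombinations.submodule R A M" and B: "LinearCombinations.submodule R B M"
    and inter: "A \<inter> B = {\<zero>\<^bsub>M\<^esub>}"
    by (auto simp: M.internal_direct_sum_iff)
  interpret A: LinearCombinations.submodule R A M by (rule A)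
  interpret B: LinearCombinations.submodule R B M by (rule B)
  interpret B': Module.module R "M\<lparr>carrier := B\<rparr>" by (rule M.submodule_is_module[OF B])
  interpret f: mod_hom R "M\<lparr>carrier := A\<rparr>" "M\<lparr>carrier := B\<rparr>" f
    using M.submodule_is_module[OF A] M.submodule_is_module[OF B] f
    by (simp add: mod_hom_def mod_hom_axioms_def)
  have "A = {\<zero>\<^bsub>M\<^esub>} \<or> B = {\<zero>\<^bsub>M\<^esub>}"
  proof (rule ccontr)
    assume "\<not> ?thesis"
    then obtain a b where ab: "a \<in> A" "a \<noteq> \<zero>\<^bsub>M\<^esub>" "b \<in> B" "b \<noteq> \<zero>\<^bsub>M\<^esub>"
      using A.zero_closed B.zero_closed by fastforce
    then have abc: "a \<in> carrier M" "b \<in> carrier M"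
      using A.subset B.subset by auto
    obtain r s where rs: "r \<in> carrier R" "s \<in> carrier R" "r \<noteq> \<zero> \<or> s \<noteq> \<zero>"
      "r \<odot>\<^bsub>M\<^esub> a = s \<odot>\<^bsub>M\<^esub> b"
      using pd[unfolded pairwise_dependent_def, rule_format, OF abc] by blast
    have "r \<odot>\<^bsub>M\<^esub> a \<in> A \<inter> B"
      using A.smult_closed[OF rs(1) ab(1)] B.smult_closed[OF rs(2) ab(3)] rs(4) by simp
    then have "r \<odot>\<^bsub>M\<^esub> a = \<zero>\<^bsub>M\<^esub>" "s \<odot>\<^bsub>M\<^esub> b = \<zero>\<^bsub>M\<^esub>"
      using inter rs(4) by auto
    then have "r = \<zero>" "s = \<zero>"
      using torsion_freeD[OF tf rs(1) abc(1)] torsion_freeD[OF tf rs(2) abc(2)] ab by simp_all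
    with rs(3) show False
      by simp
  qed
  moreover have f0: "f \<zero>\<^bsub>M\<^esub> = \<zero>\<^bsub>M\<^esub>"
    using f.f0_is_0 by simp
  moreover have "f ` A \<subseteq> B"
    using f.f_im by auto
  moreover have "\<zero>\<^bsub>M\<^esub> \<in> f ` A"
    by (rule image_eqI[where x = "\<zero>\<^bsub>M\<^esub>"]) (use f0 A.zero_closed in simp_all)
  ultimately have "f ` A = {\<zero>\<^bsub>M\<^esub>}"
    by auto
  then show "direct_summand R (M\<lparr>carrier := B\<rparr>) (f ` A)"
    using B'.direct_summand_zero by simp
qed

text \<open>Torsion-freeness and pairwise dependence are inherited by submodules, so the argument
  for C4 applies to each submodule separately.\<close>

lemma (in domain) pairwise_dependent_imp_C4_star:
  assumes "Module.module R M" "torsion_free R M" "pairwise_dependent R M"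
  shows "C4_star_module R M"
  unfolding C4_star_module_def
proof (intro allI impI)
  fix N assume N: "LinearCombinations.submodule R N M"
  show "C4_module R (M\<lparr>carrier := N\<rparr>)"
    using assms N
    by (intro pairwise_dependent_imp_C4 pairwise_dependent_submodule torsion_free_submodule
          LinearCombinations.module.submodule_is_module)
qed

lemma (in Module.module) C4_star_imp_C4:
  assumes "C4_star_module R M"
  shows "C4_module R M"
  using assms carrier_submodule unfolding C4_star_module_def by force

section \<open>Semisimple summands and the semi-weak-CS property\<close>

text \<open>For \<open>x \<noteq> 0\<close> the submodule \<open>N = c R x\<close> would have a
  complement \<open>Y\<close>. Splitting \<open>x = c r x + y\<close> gives
  \<open>y = (1 - c r) x\<close>, and \<open>c y\<close> lies in both \<open>N\<close> and
  \<open>Y\<close>. Hence \<open>c (1 - c r) x = 0\<close>, which forces \<open>c r = 1\<close>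
  although \<open>c\<close> is a nonunit.\<close>

lemma (in domain) semisimple_torsion_free_trivial:
  assumes M: "Module.module R M" and tf: "torsion_free R M" and ss: "semisimple_module R M"
    and c: "c \<in> carrier R" "c \<noteq> \<zero>" "c \<notin> Units R"
  shows "carrier M = {\<zero>\<^bsub>M\<^esub>}"
proof (rule ccontr)
  interpret M: Module.module R M by (rule M)
  assume "carrier M \<noteq> {\<zero>\<^bsub>M\<^esub>}"
  then obtain x where x: "x \<in> carrier M" "x \<noteq> \<zero>\<^bsub>M\<^esub>"
    using M.zero_closed by blast
  define N where "N = (\<lambda>r. (c \<otimes> r) \<odot>\<^bsub>M\<^esub> x) ` carrier R"
  have "LinearCombinations.submodule R N M"
  proof (rule LinearCombinations.submodule.intro)
    show "\<zero>\<^bsub>M\<^esub> \<in> N"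
      unfolding N_def using c x by (intro image_eqI[of _ _ \<zero>]) auto
  next
    fix v w assume "v \<in> N" "w \<in> N"
    then obtain r s where "r \<in> carrier R" "s \<in> carrier R"
      "v = (c \<otimes> r) \<odot>\<^bsub>M\<^esub> x" "w = (c \<otimes> s) \<odot>\<^bsub>M\<^esub> x"
      by (auto simp: N_def)
    then show "v \<oplus>\<^bsub>M\<^esub> w \<in> N"
      unfolding N_def using c x
      by (intro image_eqI[of _ _ "r \<oplus> s"]) (simp_all add: r_distr M.smult_l_distr)
  next
    fix t v assume t: "t \<in> carrier R" and "v \<in> N"
    then obtain r where "r \<in> carrier R" "v = (c \<otimes> r) \<odot>\<^bsub>M\<^esub> x"
      by (auto simp: N_def)
    then show "t \<odot>\<^bsub>M\<^esub> v \<in> N"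
      unfolding N_def using c x t
      by (intro image_eqI[of _ _ "t \<otimes> r"]) (simp_all add: m_lcomm flip: M.smult_assoc1)
  qed (use c x M in \<open>auto simp: N_def\<close>)
  with ss obtain Y where Y: "LinearCombinations.submodule R Y M" "N \<inter> Y = {\<zero>\<^bsub>M\<^esub>}"
    "\<And>x. x \<in> carrier M \<Longrightarrow> \<exists>a\<in>N. \<exists>b\<in>Y. x = a \<oplus>\<^bsub>M\<^esub> b"
    unfolding semisimple_module_def direct_summand_def M.internal_direct_sum_iff by meson
  interpret Y: LinearCombinations.submodule R Y M by (rule Y)
  obtain r y where ry: "r \<in> carrier R" "y \<in> Y" "x = (c \<otimes> r) \<odot>\<^bsub>M\<^esub> x \<oplus>\<^bsub>M\<^esub> y"
    using Y(3)[OF x(1)] by (auto simp: N_def)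
  have yc: "y \<in> carrier M"
    using ry(2) Y.subset by auto
  have "y = (\<one> \<ominus> c \<otimes> r) \<odot>\<^bsub>M\<^esub> x"
  proof -
    have "(\<one> \<ominus> c \<otimes> r) \<odot>\<^bsub>M\<^esub> x = x \<oplus>\<^bsub>M\<^esub> \<ominus>\<^bsub>M\<^esub> ((c \<otimes> r) \<odot>\<^bsub>M\<^esub> x)"
      using x(1) ry(1) c(1) by (simp add: a_minus_def M.smult_l_distr M.smult_l_minus)
    also have "\<dots> = ((c \<otimes> r) \<odot>\<^bsub>M\<^esub> x \<oplus>\<^bsub>M\<^esub> y) \<oplus>\<^bsub>M\<^esub> \<ominus>\<^bsub>M\<^esub> ((c \<otimes> r) \<odot>\<^bsub>M\<^esub> x)"
      by (simp only: ry(3)[symmetric])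
    also have "\<dots> = y"
      using x(1) ry(1) c(1) yc by (simp add: M.a_comm[of "(c \<otimes> r) \<odot>\<^bsub>M\<^esub> x" y] M.a_assoc M.r_neg)
    finally show ?thesis ..
  qed
  then have "c \<odot>\<^bsub>M\<^esub> y = (c \<otimes> (\<one> \<ominus> c \<otimes> r)) \<odot>\<^bsub>M\<^esub> x"
    using x(1) ry(1) c(1) by (simp add: M.smult_assoc1)
  moreover from this have "c \<odot>\<^bsub>M\<^esub> y \<in> N"
    using ry(1) c(1) by (auto simp: N_def)
  moreover have "c \<odot>\<^bsub>M\<^esub> y \<in> Y"
    using c(1) ry(2) by simp
  ultimately have "(c \<otimes> (\<one> \<ominus> c \<otimes> r)) \<odot>\<^bsub>M\<^esub> x = \<zero>\<^bsub>M\<^esub>"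
    using Y(2) by auto
  then have "c \<otimes> (\<one> \<ominus> c \<otimes> r) = \<zero>"
    using torsion_freeD[OF tf _ x(1), of "c \<otimes> (\<one> \<ominus> c \<otimes> r)"] x(2) ry(1) c(1) by simp
  then have "\<one> = c \<otimes> r"
    using c(1,2) ry(1) integral_iff[of c "\<one> \<ominus> c \<otimes> r"] by simp
  with ry(1) have "c divides \<one>"
    unfolding factor_def by (intro bexI[of _ r])
  with c show False
    by (simp add: divides_one)
qed

text \<open>Every triple consists of zero modules, so after inserting zero both unions are the zero
  submodule, for the empty chain as well. The choice \<open>A = B = 0\<close> works because zero is
  essential in itself.\<close>

lemma (in domain) torsion_free_imp_semi_weak_CS:
  assumes M: "Module.module R M" and tf: "torsion_free R M"
    and c: "c \<in> carrier R" "c \<noteq> \<zero>" "c \<notin> Units R"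
  shows "semi_weak_CS_module R M"
  unfolding semi_weak_CS_module_def
proof (intro allI impI, elim conjE)
  interpret M: Module.module R M by (rule M)
  interpret Z: Module.module R "M\<lparr>carrier := {\<zero>\<^bsub>M\<^esub>}\<rparr>"
    by (rule M.submodule_is_module[OF M.zero_submodule])
  fix C assume C: "C \<subseteq> summand_triples R M"
  have trivial: "X = {\<zero>\<^bsub>M\<^esub>}"
    if "direct_summand R M X" "semisimple_module R (M\<lparr>carrier := X\<rparr>)" for X
  proof -
    have X: "LinearCombinations.submodule R X M"
      using that(1) by (auto simp: direct_summand_def internal_direct_sum_def)
    show ?thesis
      using semisimple_torsion_free_trivial[OF M.submodule_is_module[OF X]
          torsion_free_submodule[OF tf X] that(2) c] by simp
  qed
  have "X = {\<zero>\<^bsub>M\<^esub>} \<and> Y = {\<zero>\<^bsub>M\<^esub>}" if "(X, Y, \<phi>) \<in> C" for X Y \<phi>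
  proof -
    have "(X, Y, \<phi>) \<in> summand_triples R M"
      using C that by blast
    then show ?thesis
      using trivial[of X] trivial[of Y] by (simp add: summand_triples_def)
  qed
  then have unions: "insert \<zero>\<^bsub>M\<^esub> (\<Union>(X, Y, \<phi>)\<in>C. X) = {\<zero>\<^bsub>M\<^esub>}"
    "insert \<zero>\<^bsub>M\<^esub> (\<Union>(X, Y, \<phi>)\<in>C. Y) = {\<zero>\<^bsub>M\<^esub>}"
    by blast+
  have "essential_submodule R (M\<lparr>carrier := {\<zero>\<^bsub>M\<^esub>}\<rparr>) {\<zero>\<^bsub>M\<^esub>}"
    unfolding essential_submodule_def
  proof (intro conjI allI impI)
    show "LinearCombinations.submodule R {\<zero>\<^bsub>M\<^esub>} (M\<lparr>carrier := {\<zero>\<^bsub>M\<^esub>}\<rparr>)"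
      using Z.zero_submodule by simp
  next
    fix N
    assume "LinearCombinations.submodule R N (M\<lparr>carrier := {\<zero>\<^bsub>M\<^esub>}\<rparr>) \<and>
      N \<noteq> {\<zero>\<^bsub>M\<lparr>carrier := {\<zero>\<^bsub>M\<^esub>}\<rparr>\<^esub>}"
    then have "N \<subseteq> {\<zero>\<^bsub>M\<^esub>}" "\<zero>\<^bsub>M\<^esub> \<in> N" "N \<noteq> {\<zero>\<^bsub>M\<^esub>}"
      by (auto simp: LinearCombinations.submodule_def)
    then show "{\<zero>\<^bsub>M\<^esub>} \<inter> N \<noteq> {\<zero>\<^bsub>M\<lparr>carrier := {\<zero>\<^bsub>M\<^esub>}\<rparr>\<^esub>}"
      by auto
  qed
  then show "\<exists>A B. direct_summand R M A \<and> direct_summand R M B \<and>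
      essential_submodule R (M\<lparr>carrier := A\<rparr>) (insert \<zero>\<^bsub>M\<^esub> (\<Union>(X, Y, \<phi>)\<in>C. X)) \<and>
      essential_submodule R (M\<lparr>carrier := B\<rparr>) (insert \<zero>\<^bsub>M\<^esub> (\<Union>(X, Y, \<phi>)\<in>C. Y))"
    unfolding unions using M.direct_summand_zero by blast
qed

section \<open>Splitting a functional over its image\<close>

text \<open>\<open>\<sigma>\<close> splits the surjection \<open>f\<close> onto its image
  \<open>I\<close>; as \<open>I\<close> is an ideal and not a module record, linearity of
  \<open>\<sigma>\<close> is spelled out. \<open>I\<close> is a parameter tied to \<open>f\<close>
  by an equation, so that the locale can also be entered with an ideal given beforehand.\<close>

locale functional_section = dedekind_domain R + M: Module.module R M
  for R (structure) and M (structure) +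
  fixes f \<sigma> I
  assumes functional: "linear_functional R M f"
    and I_def: "I = f ` carrier M"
    and section_closed: "i \<in> I \<Longrightarrow> \<sigma> i \<in> carrier M"
    and section_add: "\<lbrakk>i \<in> I; j \<in> I\<rbrakk> \<Longrightarrow> \<sigma> (i \<oplus>\<^bsub>R\<^esub> j) = \<sigma> i \<oplus>\<^bsub>M\<^esub> \<sigma> j"
    and section_mult: "\<lbrakk>r \<in> carrier R; i \<in> I\<rbrakk> \<Longrightarrow> \<sigma> (r \<otimes>\<^bsub>R\<^esub> i) = r \<odot>\<^bsub>M\<^esub> \<sigma> i"
    and section_right_inverse [simp]: "i \<in> I \<Longrightarrow> f (\<sigma> i) = i"

lemma (in cring) functional_image_ideal:
  assumes M: "Module.module R M" and f: "linear_functional R M f"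
  shows "ideal (f ` carrier M) R"
proof (rule ideal_criterion)
  interpret M: Module.module R M by (rule M)
  note fD = linear_functionalD[OF f]
  show "f ` carrier M \<subseteq> carrier R"
    using fD(1) by auto
  show "\<zero> \<in> f ` carrier M"
    by (rule image_eqI[where x = "\<zero>\<^bsub>M\<^esub>"]) (simp_all add: M.linear_functional_zero[OF f])
next
  interpret M: Module.module R M by (rule M)
  note fD = linear_functionalD[OF f]
  fix x y assume "x \<in> f ` carrier M" "y \<in> f ` carrier M"
  then obtain u v where "u \<in> carrier M" "v \<in> carrier M" "x = f u" "y = f v"
    by auto
  then show "x \<oplus> y \<in> f ` carrier M"
    by (intro image_eqI[where x = "u \<oplus>\<^bsub>M\<^esub> v"]) (simp_all add: fD)
next
  interpret M: Module.module R M by (rule M)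
  fix r x assume "r \<in> carrier R" "x \<in> f ` carrier M"
  then obtain u where "r \<in> carrier R" "u \<in> carrier M" "x = f u"
    by auto
  then show "r \<otimes> x \<in> f ` carrier M"
    by (intro image_eqI[where x = "r \<odot>\<^bsub>M\<^esub> u"]) (simp_all add: linear_functionalD[OF f])
qed

text \<open>
  If \<open>J\<close> is a cofactor of the image \<open>I\<close>, say \<open>I J = (a)\<close>, then every \<open>z \<in> I J\<close> is realised by a
  linear map \<open>\<tau>\<close> with \<open>a f (\<tau> i) = z i\<close>; the section is obtained for \<open>z = a\<close>.
\<close>

theorem (in dedekind_domain) exists_functional_section:
  assumes M: "Module.module R M" and f: "linear_functional R M f"
    and nz: "f ` carrier M \<noteq> {\<zero>}"
  shows "\<exists>\<sigma>. functional_section R M f \<sigma> (f ` carrier M)"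
proof -
  interpret M: Module.module R M by (rule M)
  note fD = linear_functionalD[OF f]
  define I where "I = f ` carrier M"
  have I: "ideal I R"
    unfolding I_def by (rule functional_image_ideal[OF M f])
  interpret I: ideal I R by (rule I)
  have "has_cofactor I"
    by (rule nonzero_ideal_has_cofactor[OF I]) (use nz I_def in simp)
  then obtain J a where J: "ideal J R" and a: "a \<in> ideal_prod R I J" "a \<noteq> \<zero>"
    and IJ: "\<forall>i\<in>I. \<forall>j\<in>J. \<exists>r\<in>carrier R. i \<otimes> j = a \<otimes> r"
    unfolding has_cofactor_def by auto
  interpret J: ideal J R by (rule J)
  have ac: "a \<in> carrier R"
    using ideal_prod_in_carrier[OF I J] a(1) by auto
  have "\<exists>\<tau>. (\<forall>i\<in>I. \<tau> i \<in> carrier M \<and> a \<otimes> f (\<tau> i) = z \<otimes> i) \<and>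
      (\<forall>i\<in>I. \<forall>j\<in>I. \<tau> (i \<oplus> j) = \<tau> i \<oplus>\<^bsub>M\<^esub> \<tau> j) \<and>
      (\<forall>r\<in>carrier R. \<forall>i\<in>I. \<tau> (r \<otimes> i) = r \<odot>\<^bsub>M\<^esub> \<tau> i)" if "z \<in> ideal_prod R I J" for z
    using that
  proof induction
    case (prod k j)
    then obtain m where m: "m \<in> carrier M" "k = f m"
      by (auto simp: I_def)
    \<comment> \<open>For a single product \<open>z = k j\<close> with \<open>k = f m\<close>, the
      map is \<open>i \<mapsto> (i j / a) m\<close>. The coefficient \<open>q i = i j / a\<close>
      lies in \<open>R\<close> by the choice of the cofactor, and cancelling \<open>a\<close> makes
      it unique, hence linear in \<open>i\<close>.\<close>
    have "\<forall>i\<in>I. \<exists>r. r \<in> carrier R \<and> i \<otimes> j = a \<otimes> r"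
      using IJ prod(2) by auto
    from bchoice[OF this] obtain q
      where q_all: "\<forall>i\<in>I. q i \<in> carrier R \<and> i \<otimes> j = a \<otimes> q i" ..
    have qc: "q i \<in> carrier R" and qe: "i \<otimes> j = a \<otimes> q i" if "i \<in> I" for i
      using q_all that by blast+
    have q_eqI: "q i = r" if "i \<in> I" "r \<in> carrier R" "i \<otimes> j = a \<otimes> r" for i r
      using m_lcancel[OF a(2) ac qc[OF that(1)] that(2)] qe[OF that(1)] that(3) by simp
    have jc: "j \<in> carrier R" and kc: "k \<in> carrier R"
      using prod by simp_all
    have q_add: "q (i \<oplus> i') = q i \<oplus> q i'" if "i \<in> I" "i' \<in> I" for i i'
    proof (rule q_eqI)
      show "(i \<oplus> i') \<otimes> j = a \<otimes> (q i \<oplus> q i')"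
        using qe[OF that(1)] qe[OF that(2)] qc[OF that(1)] qc[OF that(2)] that ac jc
        by (simp add: l_distr r_distr)
    qed (use qc that in simp_all)
    have q_mult: "q (r \<otimes> i) = r \<otimes> q i" if "i \<in> I" "r \<in> carrier R" for i r
    proof (rule q_eqI)
      have "(r \<otimes> i) \<otimes> j = r \<otimes> (i \<otimes> j)"
        using that jc by (simp add: m_assoc)
      also have "\<dots> = r \<otimes> (a \<otimes> q i)"
        by (simp add: qe that)
      also have "\<dots> = a \<otimes> (r \<otimes> q i)"
        using qc that ac by (simp add: m_lcomm)
      finally show "(r \<otimes> i) \<otimes> j = a \<otimes> (r \<otimes> q i)" .
    qed (use qc that in \<open>simp_all add: I.I_l_closed\<close>)
    have eq: "a \<otimes> f (q i \<odot>\<^bsub>M\<^esub> m) = k \<otimes> j \<otimes> i" if i: "i \<in> I" for i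
    proof -
      have ic: "i \<in> carrier R" and qi: "q i \<in> carrier R" "i \<otimes> j = a \<otimes> q i"
        using i qc qe by simp_all
      have "a \<otimes> f (q i \<odot>\<^bsub>M\<^esub> m) = (a \<otimes> q i) \<otimes> k"
        using m kc qi(1) ac by (simp add: fD m_assoc)
      also have "\<dots> = (i \<otimes> j) \<otimes> k"
        by (simp add: qi(2))
      also have "\<dots> = k \<otimes> j \<otimes> i"
        using ic jc kc by (simp add: m_ac)
      finally show ?thesis .
    qed
    show ?case
      by (rule exI[of _ "\<lambda>i. q i \<odot>\<^bsub>M\<^esub> m"])
        (simp add: eq qc m(1) q_add q_mult M.smult_l_distr M.smult_assoc1)
  next
    case (sum z z')
    then obtain \<tau> \<tau>' where t: "\<forall>i\<in>I. \<tau> i \<in> carrier M \<and> a \<otimes> f (\<tau> i) = z \<otimes> i"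
      "\<forall>i\<in>I. \<forall>j\<in>I. \<tau> (i \<oplus> j) = \<tau> i \<oplus>\<^bsub>M\<^esub> \<tau> j" "\<forall>r\<in>carrier R. \<forall>i\<in>I. \<tau> (r \<otimes> i) = r \<odot>\<^bsub>M\<^esub> \<tau> i"
      and t': "\<forall>i\<in>I. \<tau>' i \<in> carrier M \<and> a \<otimes> f (\<tau>' i) = z' \<otimes> i"
      "\<forall>i\<in>I. \<forall>j\<in>I. \<tau>' (i \<oplus> j) = \<tau>' i \<oplus>\<^bsub>M\<^esub> \<tau>' j"
      "\<forall>r\<in>carrier R. \<forall>i\<in>I. \<tau>' (r \<otimes> i) = r \<odot>\<^bsub>M\<^esub> \<tau>' i"
      by auto
    have "z \<in> carrier R" "z' \<in> carrier R"
      using sum(1,2) ideal_prod_in_carrier[OF I J] by auto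
    then have eq: "a \<otimes> f (\<tau> i \<oplus>\<^bsub>M\<^esub> \<tau>' i) = (z \<oplus> z') \<otimes> i" if "i \<in> I" for i
      using bspec[OF t(1) that] bspec[OF t'(1) that] that ac by (simp add: fD r_distr l_distr)
    have closed: "\<tau> i \<in> carrier M" "\<tau>' i \<in> carrier M" if "i \<in> I" for i
      using that t(1) t'(1) by blast+
    show ?case
    proof (intro exI[of _ "\<lambda>i. \<tau> i \<oplus>\<^bsub>M\<^esub> \<tau>' i"] conjI ballI)
      fix i j assume "i \<in> I" "j \<in> I"
      then show "\<tau> (i \<oplus> j) \<oplus>\<^bsub>M\<^esub> \<tau>' (i \<oplus> j) = \<tau> i \<oplus>\<^bsub>M\<^esub> \<tau>' i \<oplus>\<^bsub>M\<^esub> (\<tau> j \<oplus>\<^bsub>M\<^esub> \<tau>' j)"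
        using t(2) t'(2) closed by (simp add: M.a_ac)
    next
      fix r i assume "r \<in> carrier R" "i \<in> I"
      then show "\<tau> (r \<otimes> i) \<oplus>\<^bsub>M\<^esub> \<tau>' (r \<otimes> i) = r \<odot>\<^bsub>M\<^esub> (\<tau> i \<oplus>\<^bsub>M\<^esub> \<tau>' i)"
        using t(3) t'(3) closed by (simp add: M.smult_r_distr)
    qed (use eq closed in simp_all)
  qed
  from this[OF a(1)] obtain \<sigma> where s: "\<forall>i\<in>I. \<sigma> i \<in> carrier M \<and> a \<otimes> f (\<sigma> i) = a \<otimes> i"
    "\<forall>i\<in>I. \<forall>j\<in>I. \<sigma> (i \<oplus> j) = \<sigma> i \<oplus>\<^bsub>M\<^esub> \<sigma> j" "\<forall>r\<in>carrier R. \<forall>i\<in>I. \<sigma> (r \<otimes> i) = r \<odot>\<^bsub>M\<^esub> \<sigma> i"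
    by auto
  have "functional_section R M f \<sigma> I"
  proof (intro functional_section.intro functional_section_axioms.intro)
    fix i assume i: "i \<in> I"
    then have "a \<otimes> f (\<sigma> i) = a \<otimes> i" "f (\<sigma> i) \<in> carrier R" "i \<in> carrier R"
      using s(1) fD(1) by simp_all
    then show "f (\<sigma> i) = i"
      using ac a(2) m_lcancel[of a "f (\<sigma> i)" i] by simp
  qed (use s f in \<open>simp_all add: I_def[symmetric] dedekind_domain_axioms M\<close>)
  then show ?thesis
    unfolding I_def by blast
qed

context functional_section
begin

lemma image_ideal: "ideal I R"
  unfolding I_def by (rule functional_image_ideal[OF M.module_axioms functional])

lemma section_zero: "\<sigma> \<zero>\<^bsub>R\<^esub> = \<zero>\<^bsub>M\<^esub>"
proof -
  interpret I: ideal I R by (rule image_ideal)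
  show ?thesis
    using section_mult[of "\<zero>\<^bsub>R\<^esub>" "\<zero>\<^bsub>R\<^esub>"] section_closed[of "\<zero>\<^bsub>R\<^esub>"] by simp
qed

text \<open>The decomposition is \<open>x = \<sigma> (f x) + (x - \<sigma> (f x))\<close>. The
  intersection is zero because \<open>f (\<sigma> i) = 0\<close> means \<open>i = 0\<close>.\<close>

lemma section_image_direct_sum:
  "internal_direct_sum R M (\<sigma> ` I) {x \<in> carrier M. f x = \<zero>\<^bsub>R\<^esub>}"
  unfolding M.internal_direct_sum_iff
proof (intro conjI ballI)
  interpret I: ideal I R by (rule image_ideal)
  note fD = linear_functionalD[OF functional]
  show "LinearCombinations.submodule R (\<sigma> ` I) M"
  proof (rule LinearCombinations.submodule.intro)
    show "\<zero>\<^bsub>M\<^esub> \<in> \<sigma> ` I"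
      by (rule image_eqI[where x = "\<zero>\<^bsub>R\<^esub>"]) (simp_all add: section_zero)
  next
    fix v w assume "v \<in> \<sigma> ` I" "w \<in> \<sigma> ` I"
    then obtain i j where "i \<in> I" "j \<in> I" "v = \<sigma> i" "w = \<sigma> j"
      by auto
    then show "v \<oplus>\<^bsub>M\<^esub> w \<in> \<sigma> ` I"
      by (intro image_eqI[where x = "i \<oplus>\<^bsub>R\<^esub> j"]) (simp_all add: section_add)
  next
    fix r v assume "r \<in> carrier R" "v \<in> \<sigma> ` I"
    then obtain i where "r \<in> carrier R" "i \<in> I" "v = \<sigma> i"
      by auto
    then show "r \<odot>\<^bsub>M\<^esub> v \<in> \<sigma> ` I"
      by (intro image_eqI[where x = "r \<otimes>\<^bsub>R\<^esub> i"]) (simp_all add: section_mult I.I_l_closed)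
  qed (use section_closed M.module_axioms in auto)
  show "LinearCombinations.submodule R {x \<in> carrier M. f x = \<zero>\<^bsub>R\<^esub>} M"
    by (rule LinearCombinations.submodule.intro)
      (auto simp: fD M.linear_functional_zero[OF functional] M.module_axioms)
  have "\<zero>\<^bsub>M\<^esub> \<in> \<sigma> ` I"
    by (rule image_eqI[where x = "\<zero>\<^bsub>R\<^esub>"]) (simp_all add: section_zero)
  moreover have "v \<in> {\<zero>\<^bsub>M\<^esub>}" if "v \<in> \<sigma> ` I" "f v = \<zero>\<^bsub>R\<^esub>" for v
  proof -
    from that(1) obtain i where "i \<in> I" "v = \<sigma> i"
      by auto
    with that(2) section_right_inverse[of i] section_zero show ?thesis
      by simp
  qed
  ultimately show "\<sigma> ` I \<inter> {x \<in> carrier M. f x = \<zero>\<^bsub>R\<^esub>} = {\<zero>\<^bsub>M\<^esub>}"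
    using M.linear_functional_zero[OF functional] by blast
  fix x assume x: "x \<in> carrier M"
  define a where "a = \<sigma> (f x)"
  have fx: "f x \<in> I" "f x \<in> carrier R"
    using x fD(1) by (auto simp: I_def)
  have ac: "a \<in> carrier M" and aI: "a \<in> \<sigma> ` I" and fa: "f a = f x"
    using section_closed fx by (simp_all add: a_def)
  \<comment> \<open>The difference is written with the scalar \<open>-1\<close>, since
    \<open>f\<close> is assumed to respect sums and scalar multiples.\<close>
  define b where "b = x \<oplus>\<^bsub>M\<^esub> (\<ominus>\<^bsub>R\<^esub> \<one>\<^bsub>R\<^esub>) \<odot>\<^bsub>M\<^esub> a"
  have "f b = f x \<oplus>\<^bsub>R\<^esub> (\<ominus>\<^bsub>R\<^esub> \<one>\<^bsub>R\<^esub>) \<otimes>\<^bsub>R\<^esub> f x"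
    using x ac by (simp add: b_def fD fa)
  then have "f b = \<zero>\<^bsub>R\<^esub>"
    using fx(2) by (simp add: l_minus r_neg)
  moreover have "x = a \<oplus>\<^bsub>M\<^esub> b"
    using x ac by (simp add: b_def M.smult_minus_1 M.a_lcomm[of a x] M.r_neg)
  moreover have "b \<in> carrier M"
    using x ac by (simp add: b_def)
  ultimately show "\<exists>a\<in>\<sigma> ` I. \<exists>b\<in>{x \<in> carrier M. f x = \<zero>\<^bsub>R\<^esub>}. x = a \<oplus>\<^bsub>M\<^esub> b"
    using aI by (intro bexI[of _ a] bexI[of _ b]) simp_all
qed

end

section \<open>Failure of C4 for independent elements\<close>

lemma submodule_homI:
  assumes "\<And>x. x \<in> A \<Longrightarrow> f x \<in> B"
    and "\<And>x y. \<lbrakk>x \<in> A; y \<in> A\<rbrakk> \<Longrightarrow> f (x \<oplus>\<^bsub>M\<^esub> y) = f x \<oplus>\<^bsub>N\<^esub> f y"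
    and "\<And>r x. \<lbrakk>r \<in> carrier R; x \<in> A\<rbrakk> \<Longrightarrow> f (r \<odot>\<^bsub>M\<^esub> x) = r \<odot>\<^bsub>N\<^esub> f x"
  shows "f \<in> LinearCombinations.module_hom R (M\<lparr>carrier := A\<rparr>) (N\<lparr>carrier := B\<rparr>)"
  using assms by (simp add: LinearCombinations.module_hom_def)

text \<open>
  The linear functional \<open>f\<close> splits \<open>M\<close> as \<open>A \<oplus> B\<close> with \<open>A\<close> isomorphic to an ideal \<open>I\<close>. For a
  nonzero nonunit \<open>c\<close> and \<open>b \<in> B\<close>, the map \<open>m \<mapsto> c f(m) b\<close> from \<open>A\<close> to \<open>B\<close> is injective with
  image \<open>c I b\<close>; this being a direct summand would give \<open>I = c I\<close>.
\<close>

lemma (in dedekind_domain) C4_imp_pairwise_dependent: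
  assumes M: "Module.module R M" and tl: "torsionless R M" and C4: "C4_module R M"
    and c: "c \<in> carrier R" "c \<noteq> \<zero>" "c \<notin> Units R"
  shows "pairwise_dependent R M"
proof (rule ccontr)
  interpret M: Module.module R M by (rule M)
  have tf: "torsion_free R M"
    by (rule torsionless_imp_torsion_free[OF M tl])
  assume "\<not> pairwise_dependent R M"
  then obtain x y where xy: "x \<in> carrier M" "y \<in> carrier M"
    and indep: "\<And>r s. \<lbrakk>r \<in> carrier R; s \<in> carrier R; r \<odot>\<^bsub>M\<^esub> x = s \<odot>\<^bsub>M\<^esub> y\<rbrakk> \<Longrightarrow> r = \<zero> \<and> s = \<zero>"
    unfolding pairwise_dependent_def by auto
  have "x \<noteq> \<zero>\<^bsub>M\<^esub>"
  proof
    assume "x = \<zero>\<^bsub>M\<^esub>"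
    then have "\<one> \<odot>\<^bsub>M\<^esub> x = \<zero> \<odot>\<^bsub>M\<^esub> y"
      using xy by simp
    from indep[OF one_closed zero_closed this] show False
      by simp
  qed
  then obtain f where f: "linear_functional R M f" and fx: "f x \<noteq> \<zero>"
    using tl xy(1) unfolding torsionless_def by auto
  note fD = linear_functionalD[OF f]
  have fxc: "f x \<in> carrier R" and fyc: "f y \<in> carrier R"
    using fD(1) xy by simp_all
  have "f ` carrier M \<noteq> {\<zero>}"
    using fx xy(1) by auto
  from exists_functional_section[OF M f this] obtain \<sigma>
    where "functional_section R M f \<sigma> (f ` carrier M)" ..
  then interpret S: functional_section R M f \<sigma> "f ` carrier M" .
  define A where "A = \<sigma> ` f ` carrier M"
  define B where "B = {x \<in> carrier M. f x = \<zero>}"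
  have AB: "internal_direct_sum R M A B"
    unfolding A_def B_def by (rule S.section_image_direct_sum)
  then have A: "LinearCombinations.submodule R A M" and B: "LinearCombinations.submodule R B M"
    by (auto simp: internal_direct_sum_def)
  interpret A: LinearCombinations.submodule R A M by (rule A)
  interpret B: LinearCombinations.submodule R B M by (rule B)
  interpret A': Module.module R "M\<lparr>carrier := A\<rparr>" by (rule M.submodule_is_module[OF A])
  interpret B': Module.module R "M\<lparr>carrier := B\<rparr>" by (rule M.submodule_is_module[OF B])
  \<comment> \<open>The vector \<open>f(x) y - f(y) x\<close> lies in \<open>ker f\<close>. It is
    nonzero because \<open>x\<close> and \<open>y\<close> are independent and the coefficient
    \<open>f x\<close> is nonzero.\<close>
  define b where "b = f x \<odot>\<^bsub>M\<^esub> y \<oplus>\<^bsub>M\<^esub> (\<ominus> f y) \<odot>\<^bsub>M\<^esub> x"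
  have bc: "b \<in> carrier M"
    using xy fxc fyc by (simp add: b_def)
  have "f b = f x \<otimes> f y \<oplus> (\<ominus> f y) \<otimes> f x"
    using xy fxc fyc by (simp add: b_def fD)
  then have "f b = \<zero>"
    using fxc fyc by (simp add: l_minus m_comm[of "f y"] r_neg)
  with bc have bB: "b \<in> B"
    by (simp add: B_def)
  have b0: "b \<noteq> \<zero>\<^bsub>M\<^esub>"
  proof
    assume "b = \<zero>\<^bsub>M\<^esub>"
    then have "f x \<odot>\<^bsub>M\<^esub> y \<ominus>\<^bsub>M\<^esub> f y \<odot>\<^bsub>M\<^esub> x = \<zero>\<^bsub>M\<^esub>"
      using xy fyc by (simp add: b_def M.smult_l_minus a_minus_def)
    then have "f y \<odot>\<^bsub>M\<^esub> x = f x \<odot>\<^bsub>M\<^esub> y"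
      using xy fxc fyc by simp
    from indep[OF fyc fxc this] fx show False
      by simp
  qed
  define g where "g m = (c \<otimes> f m) \<odot>\<^bsub>M\<^esub> b" for m
  have g_hom: "g \<in> LinearCombinations.module_hom R (M\<lparr>carrier := A\<rparr>) (M\<lparr>carrier := B\<rparr>)"
  proof (rule submodule_homI)
    fix m assume "m \<in> A"
    then have "m \<in> carrier M"
      using A.subset by auto
    then show "g m \<in> B"
      unfolding g_def using c(1) fD(1) bB by simp
  next
    fix m n assume "m \<in> A" "n \<in> A"
    then have "m \<in> carrier M" "n \<in> carrier M"
      using A.subset by auto
    then show "g (m \<oplus>\<^bsub>M\<^esub> n) = g m \<oplus>\<^bsub>M\<^esub> g n"
      unfolding g_def using c(1) fD(1) bc by (simp add: fD r_distr M.smult_l_distr)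
  next
    fix r m assume "r \<in> carrier R" "m \<in> A"
    then have "r \<in> carrier R" "m \<in> carrier M"
      using A.subset by auto
    then show "g (r \<odot>\<^bsub>M\<^esub> m) = r \<odot>\<^bsub>M\<^esub> g m"
      unfolding g_def using c(1) fD(1) bc by (simp add: fD m_lcomm flip: M.smult_assoc1)
  qed
  have f_sigma: "f (\<sigma> (f m)) = f m" if "m \<in> carrier M" for m
    using that by simp
  have "{m \<in> A. g m = \<zero>\<^bsub>M\<^esub>} = {\<zero>\<^bsub>M\<^esub>}"
  proof (intro equalityI subsetI)
    fix m assume "m \<in> {m \<in> A. g m = \<zero>\<^bsub>M\<^esub>}"
    then obtain n where n: "n \<in> carrier M" "m = \<sigma> (f n)" "g m = \<zero>\<^bsub>M\<^esub>"
      unfolding A_def by auto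
    then have fm: "f m = f n"
      using f_sigma by simp
    have "c \<otimes> f n = \<zero> \<or> b = \<zero>\<^bsub>M\<^esub>"
      using torsion_freeD[OF tf _ bc, of "c \<otimes> f n"] n(1,3) c(1) fD(1) by (simp add: g_def fm)
    then have "f n = \<zero>"
      using b0 c(1,2) n(1) fD(1) by (simp add: integral_iff)
    then show "m \<in> {\<zero>\<^bsub>M\<^esub>}"
      using n(2) S.section_zero by simp
  next
    fix m assume "m \<in> {\<zero>\<^bsub>M\<^esub>}"
    then show "m \<in> {m \<in> A. g m = \<zero>\<^bsub>M\<^esub>}"
      using c(1) bc M.linear_functional_zero[OF f] by (simp add: g_def)
  qed
  then have "direct_summand R (M\<lparr>carrier := A\<rparr>) {m \<in> A. g m = \<zero>\<^bsub>M\<^esub>}"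
    using A'.direct_summand_zero by simp
  with C4 AB g_hom have "direct_summand R (M\<lparr>carrier := B\<rparr>) (g ` A)"
    unfolding C4_module_def by auto
  then obtain C where C: "LinearCombinations.submodule R C (M\<lparr>carrier := B\<rparr>)"
    "g ` A \<inter> C = {\<zero>\<^bsub>M\<^esub>}" "\<And>x. x \<in> B \<Longrightarrow> \<exists>u\<in>g ` A. \<exists>z\<in>C. x = u \<oplus>\<^bsub>M\<^esub> z"
    unfolding direct_summand_def B'.internal_direct_sum_iff by auto
  interpret C: LinearCombinations.submodule R C "M\<lparr>carrier := B\<rparr>" by (rule C)
  interpret I: ideal "f ` carrier M" R
    by (rule functional_image_ideal[OF M f])
  have "\<exists>j. j \<in> f ` carrier M \<and> \<one> \<otimes> i = c \<otimes> j" if i: "i \<in> f ` carrier M" for i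
  proof -
    have ic: "i \<in> carrier R"
      using i by (rule I.Icarr)
    have "i \<odot>\<^bsub>M\<^esub> b \<in> B"
      using ic bB by simp
    from C(3)[OF this] obtain m z where mz: "m \<in> A" "z \<in> C" "i \<odot>\<^bsub>M\<^esub> b = g m \<oplus>\<^bsub>M\<^esub> z"
      by auto
    have mc: "m \<in> carrier M" and zc: "z \<in> carrier M"
      using mz(1,2) A.subset B.subset C.subset by auto
    define j where "j = f m"
    have j: "j \<in> f ` carrier M" "j \<in> carrier R"
      using mc fD(1) by (auto simp: j_def)
    define d where "d = i \<ominus> c \<otimes> j"
    have d: "d \<in> carrier R" "d \<in> f ` carrier M"
      using i j ic c(1) by (auto simp: d_def a_minus_def intro!: I.a_closed I.a_inv_closed I.I_l_closed)
    have gm: "g m = (c \<otimes> j) \<odot>\<^bsub>M\<^esub> b"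
      by (simp add: g_def j_def)
    have "d \<odot>\<^bsub>M\<^esub> b = (g m \<oplus>\<^bsub>M\<^esub> z) \<oplus>\<^bsub>M\<^esub> \<ominus>\<^bsub>M\<^esub> g m"
      unfolding mz(3)[symmetric] unfolding gm d_def using ic j(2) c(1) bc
      by (simp add: a_minus_def M.smult_l_distr M.smult_l_minus)
    also have "\<dots> = z"
      using zc c(1) j(2) bc by (simp add: gm M.a_comm[of _ z] M.a_assoc M.r_neg)
    finally have dz: "d \<odot>\<^bsub>M\<^esub> b = z" .
    \<comment> \<open>The complement component is \<open>z = d b\<close> with
      \<open>d = i - c j\<close> in the image ideal. Hence
      \<open>c z = c d b = g (\<sigma> d)\<close> lies in the image of \<open>g\<close> as well as
      in \<open>C\<close>, which forces \<open>d = 0\<close> and \<open>i = c j\<close>.\<close>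
    have "c \<odot>\<^bsub>M\<^esub> z \<in> C"
      using C.smult_closed[OF c(1) mz(2)] by simp
    moreover have "c \<odot>\<^bsub>M\<^esub> z = g (\<sigma> d)"
      using d c(1) bc by (simp add: g_def M.smult_assoc1 flip: dz)
    moreover have "g (\<sigma> d) \<in> g ` A"
      using d(2) by (simp add: A_def)
    ultimately have "g (\<sigma> d) = \<zero>\<^bsub>M\<^esub>"
      using C(2) by auto
    then have "c \<otimes> d = \<zero> \<or> b = \<zero>\<^bsub>M\<^esub>"
      using torsion_freeD[OF tf _ bc, of "c \<otimes> d"] d c(1) by (simp add: g_def)
    then have "d = \<zero>"
      using b0 c(1,2) d(1) by (simp add: integral_iff)
    then have "i = c \<otimes> j"
      using ic c(1) j(2) by (simp add: d_def)
    then show ?thesis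
      using j(1) ic by (intro exI[of _ j]) simp
  qed
  then have "\<forall>i\<in>f ` carrier M. \<exists>j. j \<in> f ` carrier M \<and> \<one> \<otimes> i = c \<otimes> j"
    by simp
  from bchoice[OF this] obtain h
    where h_all: "\<forall>i\<in>f ` carrier M. h i \<in> f ` carrier M \<and> \<one> \<otimes> i = c \<otimes> h i" ..
  have hI: "h i \<in> f ` carrier M" and he: "\<one> \<otimes> i = c \<otimes> h i" if "i \<in> f ` carrier M" for i
    using bspec[OF h_all that] by auto
  have hn: "(h ^^ n) (f x) \<in> f ` carrier M" for n
    by (induction n) (simp_all add: xy(1) hI del: S.section_right_inverse)
  obtain r where "r \<in> carrier R" "\<one> = r \<otimes> c"
  proof (rule divides_if_iterated_multiples[of \<one> c "\<lambda>n. (h ^^ n) (f x)"])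
    show "\<one> \<otimes> (h ^^ n) (f x) = c \<otimes> (h ^^ Suc n) (f x)" for n
      using he[OF hn[of n]] by simp
    show "(h ^^ n) (f x) \<in> carrier R" for n
      using hn by (rule I.Icarr)
  qed (use c fx in simp_all)
  then have "c divides \<one>"
    unfolding factor_def using c(1) by (intro bexI[of _ r]) (simp_all add: m_comm)
  with c show False
    by (simp add: divides_one)
qed

section \<open>The vector space spanned by a module\<close>

lemma frac_module_simps [simp]:
  "carrier (frac_module R) = carrier (fraction_field R)"
  "add (frac_module R) = add (fraction_field R)"
  "ring.zero (frac_module R) = \<zero>\<^bsub>fraction_field R\<^esub>"
  "smult (frac_module R) r x = frac_embed R r \<otimes>\<^bsub>fraction_field R\<^esub> x"
  by (simp_all add: frac_module_def Let_def)

lemma keys_diff_subset: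
  "Poly_Mapping.keys a \<subseteq> S \<Longrightarrow> Poly_Mapping.keys b \<subseteq> S \<Longrightarrow> Poly_Mapping.keys (a - b) \<subseteq> S"
  for a b :: "'c \<Rightarrow>\<^sub>0 int"
  using keys_diff[of a b] by blast

lemma keys_add_subset:
  "Poly_Mapping.keys a \<subseteq> S \<Longrightarrow> Poly_Mapping.keys b \<subseteq> S \<Longrightarrow> Poly_Mapping.keys (a + b) \<subseteq> S"
  for a b :: "'c \<Rightarrow>\<^sub>0 int"
  using keys_add[of a b] by blast

locale tensor_module = domain_with_fractions R + M: Module.module R M
  for R (structure) and M (structure)
begin

abbreviation S where "S \<equiv> carrier K \<times> carrier M"
abbreviation F where "F \<equiv> free_Abelian_group S"
abbreviation H where "H \<equiv> tensor_kernel R (frac_module R) M"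
abbreviation T where "T \<equiv> tensor_group R (frac_module R) M"
abbreviation V where "V \<equiv> frac_tensor R M"
abbreviation cls where "cls c \<equiv> H #>\<^bsub>F\<^esub> c"
abbreviation scale where "scale k \<equiv> frag_extend (\<lambda>(x, p). frag_of (k \<otimes>\<^bsub>K\<^esub> x, p))"
abbreviation tensor where "tensor x p \<equiv> cls (frag_of (x, p))"

sublocale F: comm_group F
  by (rule abelian_free_Abelian_group)

lemma rels_keys:
  assumes "c \<in> tensor_rels R (frac_module R) M"
  shows "Poly_Mapping.keys c \<subseteq> S"
  using assms unfolding tensor_rels_def frac_module_simps
  by (elim UnE CollectE exE conjE; hypsubst) (simp_all add: keys_diff_subset keys_frag_of)

lemma rels_carrier: "tensor_rels R (frac_module R) M \<subseteq> carrier F"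
  using rels_keys by (simp add: subset_iff)

lemma H_eq: "H = generate F (tensor_rels R (frac_module R) M)"
  by (simp add: tensor_kernel_def)

lemma H_subgroup: "subgroup H F"
  unfolding H_eq by (rule F.generate_is_subgroup[OF rels_carrier])

lemma H_zero: "0 \<in> H"
  using subgroup.one_closed[OF H_subgroup] by simp

lemma H_keys: "c \<in> H \<Longrightarrow> Poly_Mapping.keys c \<subseteq> S"
  using subgroup.mem_carrier[OF H_subgroup] by simp

lemma H_add: "c \<in> H \<Longrightarrow> d \<in> H \<Longrightarrow> c + d \<in> H"
  using subgroup.m_closed[OF H_subgroup] by simp

lemma H_uminus: "c \<in> H \<Longrightarrow> - c \<in> H"
  using subgroup.m_inv_closed[OF H_subgroup, of c] H_keys[of c] by simp

lemma H_diff: "c \<in> H \<Longrightarrow> d \<in> H \<Longrightarrow> c - d \<in> H"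
  using H_add[of c "- d"] H_uminus by simp

lemma H_add_left:
  "\<lbrakk>x \<in> carrier K; y \<in> carrier K; p \<in> carrier M\<rbrakk> \<Longrightarrow>
     frag_of (x \<oplus>\<^bsub>K\<^esub> y, p) - frag_of (x, p) - frag_of (y, p) \<in> H"
  unfolding H_eq tensor_rels_def frac_module_simps
  by (rule generate.incl) blast

lemma H_add_right:
  "\<lbrakk>x \<in> carrier K; p \<in> carrier M; q \<in> carrier M\<rbrakk> \<Longrightarrow>
     frag_of (x, p \<oplus>\<^bsub>M\<^esub> q) - frag_of (x, p) - frag_of (x, q) \<in> H"
  unfolding H_eq tensor_rels_def frac_module_simps
  by (rule generate.incl) blast

lemma H_smult:
  "\<lbrakk>r \<in> carrier R; x \<in> carrier K; p \<in> carrier M\<rbrakk> \<Longrightarrow>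
     frag_of (\<epsilon> r \<otimes>\<^bsub>K\<^esub> x, p) - frag_of (x, r \<odot>\<^bsub>M\<^esub> p) \<in> H"
  unfolding H_eq tensor_rels_def frac_module_simps
  by (rule generate.incl) blast

lemmas H_rels = H_add_left H_add_right H_smult

lemma mem_cls_iff: "d \<in> cls c \<longleftrightarrow> d - c \<in> H"
  by (auto simp: r_coset_def) (metis add.commute diff_add_cancel)

lemma cls_eq_iff: "cls c = cls d \<longleftrightarrow> c - d \<in> H"
proof
  assume "cls c = cls d"
  then show "c - d \<in> H"
    using mem_cls_iff[of c c] mem_cls_iff[of c d] H_zero by simp
next
  assume cd: "c - d \<in> H"
  have "e - c \<in> H \<longleftrightarrow> e - d \<in> H" for e
    using H_add[OF cd, of "e - c"] H_diff[OF _ cd, of "e - d"] by auto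
  then show "cls c = cls d"
    using mem_cls_iff by blast
qed

lemma T_eq: "T = F Mod H"
  by (simp add: tensor_group_def)

lemma comm_group_T: "comm_group T"
  unfolding T_eq by (rule F.abelian_FactGroup[OF H_subgroup])

lemma V_carrier: "carrier V = {cls c | c. Poly_Mapping.keys c \<subseteq> S}"
  by (auto simp: frac_tensor_def Let_def T_eq FactGroup_def RCOSETS_def)

lemma V_carrierE:
  assumes "X \<in> carrier V"
  obtains c where "Poly_Mapping.keys c \<subseteq> S" "X = cls c"
  using assms by (auto simp: V_carrier)

lemma cls_closed [simp]: "Poly_Mapping.keys c \<subseteq> S \<Longrightarrow> cls c \<in> carrier V"
  by (auto simp: V_carrier)

lemma tensor_closed [simp]: "x \<in> carrier K \<Longrightarrow> p \<in> carrier M \<Longrightarrow> tensor x p \<in> carrier V"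
  by (simp add: keys_frag_of)

lemma V_add:
  "Poly_Mapping.keys c \<subseteq> S \<Longrightarrow> Poly_Mapping.keys d \<subseteq> S \<Longrightarrow> cls c \<oplus>\<^bsub>V\<^esub> cls d = cls (c + d)"
  using normal.rcos_sum[OF F.subgroup_imp_normal[OF H_subgroup], of c d]
  by (simp add: frac_tensor_def Let_def T_eq FactGroup_def)

lemma V_zero: "\<zero>\<^bsub>V\<^esub> = cls 0"
  using mem_cls_iff[of _ 0] by (auto simp: frac_tensor_def Let_def T_eq FactGroup_def)

lemma scale_keys:
  "k \<in> carrier K \<Longrightarrow> Poly_Mapping.keys c \<subseteq> S \<Longrightarrow> Poly_Mapping.keys (scale k c) \<subseteq> S"
  by (rule subset_trans[OF keys_frag_extend]) (auto simp: keys_frag_of K.m_closed)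

text \<open>Multiplying the first coordinate by \<open>k\<close> turns every defining relation into
  one of the same kind; for the relation that moves \<open>r\<close> across the tensor sign this
  uses commutativity of \<open>K\<close>. It is the reason why \<open>K\<close> acts on the
  quotient.\<close>

lemma scale_rels:
  assumes k: "k \<in> carrier K" and c: "c \<in> tensor_rels R (frac_module R) M"
  shows "scale k c \<in> H"
proof -
  have "k \<otimes>\<^bsub>K\<^esub> (\<epsilon> r \<otimes>\<^bsub>K\<^esub> x) = \<epsilon> r \<otimes>\<^bsub>K\<^esub> (k \<otimes>\<^bsub>K\<^esub> x)" if "r \<in> carrier R" "x \<in> carrier K" for r x
    using that k by (simp add: K.m_lcomm)
  then show ?thesis
    using c unfolding tensor_rels_def frac_module_simps
    by (elim UnE CollectE exE conjE; hypsubst) (simp_all add: frag_extend_diff K.r_distr k H_rels)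
qed

lemma scale_H:
  assumes k: "k \<in> carrier K" and c: "c \<in> H"
  shows "scale k c \<in> H"
  using c unfolding H_eq
proof induction
  case one
  show ?case
    using generate.one[of F] by simp
next
  case (incl c)
  then show ?case
    using scale_rels[OF k] by (simp add: H_eq)
next
  case (inv c)
  then have "Poly_Mapping.keys c \<subseteq> S"
    by (rule rels_keys)
  with inv show ?case
    using H_uminus[OF scale_rels[OF k]] by (simp add: H_eq frag_extend_minus)
next
  case (eng c d)
  then show ?case
    using H_add[of "scale k c" "scale k d"] by (simp add: H_eq frag_extend_add)
qed

text \<open>The action in \<open>frac_tensor\<close> is a union over all representatives of a coset.
  Since scaling preserves \<open>H\<close>, they all produce the same coset, and the action can be
  computed on any one of them.\<close>

lemma V_smult:
  assumes k: "k \<in> carrier K" and c: "Poly_Mapping.keys c \<subseteq> S"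
  shows "k \<odot>\<^bsub>V\<^esub> cls c = cls (scale k c)"
proof -
  have "cls (scale k d) = cls (scale k c)" if "d \<in> cls c" for d
  proof -
    have "scale k (d - c) \<in> H"
      using that by (intro scale_H[OF k]) (simp add: mem_cls_iff)
    then show ?thesis
      by (simp add: cls_eq_iff frag_extend_diff)
  qed
  moreover have "c \<in> cls c"
    by (simp add: mem_cls_iff H_zero)
  ultimately have "(\<Union>d\<in>cls c. cls (scale k d)) = cls (scale k c)"
    by blast
  then show ?thesis
    by (simp add: frac_tensor_def Let_def)
qed

lemma V_smult_tensor:
  "k \<in> carrier K \<Longrightarrow> x \<in> carrier K \<Longrightarrow> p \<in> carrier M \<Longrightarrow>
     k \<odot>\<^bsub>V\<^esub> tensor x p = tensor (k \<otimes>\<^bsub>K\<^esub> x) p"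
  by (simp add: V_smult keys_frag_of)

lemma tensor_add_right:
  "x \<in> carrier K \<Longrightarrow> p \<in> carrier M \<Longrightarrow> q \<in> carrier M \<Longrightarrow>
     tensor x (p \<oplus>\<^bsub>M\<^esub> q) = tensor x p \<oplus>\<^bsub>V\<^esub> tensor x q"
  using H_rels(2)[of x p q] by (simp add: V_add keys_frag_of cls_eq_iff diff_diff_eq)

lemma tensor_smult_right:
  "r \<in> carrier R \<Longrightarrow> x \<in> carrier K \<Longrightarrow> p \<in> carrier M \<Longrightarrow>
     tensor x (r \<odot>\<^bsub>M\<^esub> p) = tensor (\<epsilon> r \<otimes>\<^bsub>K\<^esub> x) p"
  by (rule sym) (simp add: cls_eq_iff H_rels(3))

text \<open>This law holds only modulo \<open>H\<close>: on a generator the difference is exactly an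
  additivity relation in the first coordinate. Compatibility with products, in contrast, holds
  already for representatives.\<close>

lemma scale_add:
  assumes "k \<in> carrier K" "l \<in> carrier K" "Poly_Mapping.keys c \<subseteq> S"
  shows "scale (k \<oplus>\<^bsub>K\<^esub> l) c - (scale k c + scale l c) \<in> H"
  using assms(3)
proof (induction c rule: frag_induction)
  case (one x)
  then show ?case
    using assms(1,2) by (auto simp: K.l_distr diff_diff_eq[symmetric] intro!: H_rels)
next
  case (diff c d)
  have "scale (k \<oplus>\<^bsub>K\<^esub> l) (c - d) - (scale k (c - d) + scale l (c - d))
    = (scale (k \<oplus>\<^bsub>K\<^esub> l) c - (scale k c + scale l c)) -
      (scale (k \<oplus>\<^bsub>K\<^esub> l) d - (scale k d + scale l d))"
    by (simp add: frag_extend_diff)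
  with H_diff[OF diff] show ?case
    by simp
qed (simp add: H_zero)

lemma scale_scale:
  assumes "k \<in> carrier K" "l \<in> carrier K" "Poly_Mapping.keys c \<subseteq> S"
  shows "scale (k \<otimes>\<^bsub>K\<^esub> l) c = scale k (scale l c)"
  using assms(3)
  by (induction c rule: frag_induction) (auto simp: frag_extend_diff K.m_assoc assms(1,2))

lemma scale_one: "Poly_Mapping.keys c \<subseteq> S \<Longrightarrow> scale \<one>\<^bsub>K\<^esub> c = c"
  by (induction c rule: frag_induction) (auto simp: frag_extend_diff)

lemma abelian_group_V: "abelian_group V"
proof -
  interpret T: comm_group T by (rule comm_group_T)
  have *: "carrier V = carrier T" "add V = monoid.mult T" "\<zero>\<^bsub>V\<^esub> = \<one>\<^bsub>T\<^esub>"
    by (simp_all add: frac_tensor_def Let_def)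
  show ?thesis
    by (rule abelian_groupI) (simp_all add: * T.m_ac T.l_inv_ex)
qed

sublocale V: vectorspace K V
proof (intro vectorspace.intro moduleI)
  show "field K" ..
  show "cring K" ..
  show "abelian_group V"
    by (rule abelian_group_V)
next
  fix k X assume k: "k \<in> carrier K" and "X \<in> carrier V"
  then obtain c where c: "Poly_Mapping.keys c \<subseteq> S" "X = cls c"
    by (auto simp: V_carrier)
  then show "k \<odot>\<^bsub>V\<^esub> X \<in> carrier V"
    by (simp add: V_smult scale_keys k)
  fix l assume l: "l \<in> carrier K"
  show "(k \<oplus>\<^bsub>K\<^esub> l) \<odot>\<^bsub>V\<^esub> X = k \<odot>\<^bsub>V\<^esub> X \<oplus>\<^bsub>V\<^esub> l \<odot>\<^bsub>V\<^esub> X"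
    using c(1) scale_add[OF k l c(1)] by (simp add: c(2) V_smult V_add scale_keys k l cls_eq_iff)
  show "(k \<otimes>\<^bsub>K\<^esub> l) \<odot>\<^bsub>V\<^esub> X = k \<odot>\<^bsub>V\<^esub> (l \<odot>\<^bsub>V\<^esub> X)"
    using c(1) by (simp add: c(2) V_smult scale_keys k l scale_scale)
next
  fix k X Y assume k: "k \<in> carrier K" and "X \<in> carrier V" "Y \<in> carrier V"
  then obtain c d where c: "Poly_Mapping.keys c \<subseteq> S" "X = cls c"
    and d: "Poly_Mapping.keys d \<subseteq> S" "Y = cls d"
    by (auto simp: V_carrier)
  then show "k \<odot>\<^bsub>V\<^esub> (X \<oplus>\<^bsub>V\<^esub> Y) = k \<odot>\<^bsub>V\<^esub> X \<oplus>\<^bsub>V\<^esub> k \<odot>\<^bsub>V\<^esub> Y"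
    by (simp add: V_smult V_add scale_keys keys_add_subset k frag_extend_add)
next
  fix X assume "X \<in> carrier V"
  then show "\<one>\<^bsub>K\<^esub> \<odot>\<^bsub>V\<^esub> X = X"
    by (auto simp: V_carrier V_smult scale_one)
qed

text \<open>\<open>\<Phi>\<close> is the map \<open>K \<otimes> M \<rightarrow> K\<close> induced by
  \<open>f\<close>, obtained from the universal property of the free abelian group. The conclusion
  records homogeneity and the values on pure tensors, as the applications evaluate
  \<open>\<Phi>\<close> on multiples of a single vector.\<close>

lemma extend_functional:
  assumes f: "linear_functional R M f"
  obtains \<Phi> where "\<And>X. X \<in> carrier V \<Longrightarrow> \<Phi> X \<in> carrier K"
    "\<And>k X. \<lbrakk>k \<in> carrier K; X \<in> carrier V\<rbrakk> \<Longrightarrow> \<Phi> (k \<odot>\<^bsub>V\<^esub> X) = k \<otimes>\<^bsub>K\<^esub> \<Phi> X"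
    "\<And>x p. \<lbrakk>x \<in> carrier K; p \<in> carrier M\<rbrakk> \<Longrightarrow> \<Phi> (tensor x p) = x \<otimes>\<^bsub>K\<^esub> \<epsilon> (f p)"
proof -
  note fD = linear_functionalD[OF f]
  have img: "(\<lambda>(x, p). x \<otimes>\<^bsub>K\<^esub> \<epsilon> (f p)) ` S \<subseteq> carrier (add_monoid K)"
    using fD(1) by auto
  obtain h where h: "h \<in> hom F (add_monoid K)"
    and h_of': "\<And>s. s \<in> S \<Longrightarrow> h (frag_of s) = (\<lambda>(x, p). x \<otimes>\<^bsub>K\<^esub> \<epsilon> (f p)) s"
    using comm_group.free_Abelian_group_universal[OF K.a_comm_group img] by blast
  have h_of: "h (frag_of (x, p)) = x \<otimes>\<^bsub>K\<^esub> \<epsilon> (f p)" if "x \<in> carrier K" "p \<in> carrier M" for x p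
    using h_of'[of "(x, p)"] that by simp
  have h_closed: "h c \<in> carrier K" if "Poly_Mapping.keys c \<subseteq> S" for c
    using hom_in_carrier[OF h, of c] that by simp
  have h_add: "h (c + d) = h c \<oplus>\<^bsub>K\<^esub> h d"
    if "Poly_Mapping.keys c \<subseteq> S" "Poly_Mapping.keys d \<subseteq> S" for c d
    using hom_mult[OF h, of c d] that by simp
  have h_diff: "h (c - d) = h c \<ominus>\<^bsub>K\<^esub> h d"
    if "Poly_Mapping.keys c \<subseteq> S" "Poly_Mapping.keys d \<subseteq> S" for c d
  proof -
    have "h c = h (c - d) \<oplus>\<^bsub>K\<^esub> h d"
      using h_add[of "c - d" d] that by (simp add: keys_diff_subset)
    then show ?thesis
      using h_closed[OF that(2)] h_closed[OF keys_diff_subset[OF that]]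
      by (simp add: a_minus_def K.a_assoc K.r_neg)
  qed
  have h_zero: "h 0 = \<zero>\<^bsub>K\<^esub>"
    using h_diff[of 0 0] h_closed[of 0] by (simp add: a_minus_def K.r_neg)
  \<comment> \<open>This is the form taken by the value of \<open>h\<close> on either additivity
    relation once distributivity has been applied.\<close>
  have cancel: "u \<oplus>\<^bsub>K\<^esub> v \<ominus>\<^bsub>K\<^esub> u \<ominus>\<^bsub>K\<^esub> v = \<zero>\<^bsub>K\<^esub>" if "u \<in> carrier K" "v \<in> carrier K" for u v
  proof -
    have "u \<oplus>\<^bsub>K\<^esub> v \<ominus>\<^bsub>K\<^esub> u = v"
      using that K.a_comm[of "u \<oplus>\<^bsub>K\<^esub> v" "\<ominus>\<^bsub>K\<^esub> u"] K.r_neg1[of u v] by (simp add: a_minus_def)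
    then show ?thesis
      using that by simp
  qed
  have h_rels: "h c = \<zero>\<^bsub>K\<^esub>" if "c \<in> tensor_rels R (frac_module R) M" for c
  proof -
    have 1: "h (frag_of (x \<oplus>\<^bsub>K\<^esub> y, p) - frag_of (x, p) - frag_of (y, p)) = \<zero>\<^bsub>K\<^esub>"
      if "x \<in> carrier K" "y \<in> carrier K" "p \<in> carrier M" for x y p
      using that fD(1)[OF that(3)]
      by (simp add: h_diff h_of keys_diff_subset keys_frag_of K.l_distr cancel del: K.minus_other_side)
    have 2: "h (frag_of (x, p \<oplus>\<^bsub>M\<^esub> q) - frag_of (x, p) - frag_of (x, q)) = \<zero>\<^bsub>K\<^esub>"
      if "x \<in> carrier K" "p \<in> carrier M" "q \<in> carrier M" for x p q
      using that fD(1)[OF that(2)] fD(1)[OF that(3)]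
      by (simp add: h_diff h_of fD frac_embed_add keys_diff_subset keys_frag_of K.r_distr cancel
          del: K.minus_other_side)
    have 3: "h (frag_of (\<epsilon> r \<otimes>\<^bsub>K\<^esub> x, p) - frag_of (x, r \<odot>\<^bsub>M\<^esub> p)) = \<zero>\<^bsub>K\<^esub>"
      if "r \<in> carrier R" "x \<in> carrier K" "p \<in> carrier M" for r x p
      using that fD(1)[OF that(3)]
      by (simp add: h_diff h_of fD frac_embed_mult keys_frag_of K.m_ac)
    show ?thesis
      using that unfolding tensor_rels_def frac_module_simps
      by (elim UnE CollectE exE conjE; hypsubst) (rule 1 2 3; assumption)+
  qed
  have h_H: "h c = \<zero>\<^bsub>K\<^esub>" if "c \<in> H" for c
  proof -
    from that have "c \<in> generate F (tensor_rels R (frac_module R) M)"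
      by (simp add: H_eq)
    then have "Poly_Mapping.keys c \<subseteq> S \<and> h c = \<zero>\<^bsub>K\<^esub>"
    proof (induction rule: generate.induct)
      case (inv c)
      from inv have "Poly_Mapping.keys c \<subseteq> S"
        by (rule rels_keys)
      with h_rels[OF inv] h_diff[of 0 c] show ?case
        by (simp add: h_zero a_minus_def)
    qed (simp_all add: h_zero h_rels rels_keys h_add keys_add_subset)
    then show ?thesis
      by simp
  qed
  have h_scale: "h (scale k c) = k \<otimes>\<^bsub>K\<^esub> h c" if k: "k \<in> carrier K" and c: "Poly_Mapping.keys c \<subseteq> S" for k c
  proof -
    have "Poly_Mapping.keys c \<subseteq> S \<and> h (scale k c) = k \<otimes>\<^bsub>K\<^esub> h c"
      using c
    proof (induction c rule: frag_induction)
      case (one x)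
      then show ?case
        using k fD(1) by (auto simp: h_of keys_frag_of K.m_assoc)
    next
      case (diff c d)
      then show ?case
        using k h_closed[of c] h_closed[of d]
        by (simp add: frag_extend_diff h_diff scale_keys keys_diff_subset a_minus_def K.r_distr K.r_minus)
    qed (use k in \<open>simp add: h_zero\<close>)
    then show ?thesis
      by simp
  qed
  \<comment> \<open>\<open>h\<close> is defined on representatives, so one is chosen in each coset.
    The choice is immaterial because \<open>h\<close> vanishes on \<open>H\<close>.\<close>
  define rep where "rep X = (SOME c. Poly_Mapping.keys c \<subseteq> S \<and> X = cls c)" for X
  have rep: "Poly_Mapping.keys (rep X) \<subseteq> S \<and> X = cls (rep X)" if "X \<in> carrier V" for X
    unfolding rep_def by (rule someI_ex) (use that V_carrier in auto)
  have h_rep: "h (rep (cls c)) = h c" if c: "Poly_Mapping.keys c \<subseteq> S" for c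
  proof -
    have rc: "Poly_Mapping.keys (rep (cls c)) \<subseteq> S" "cls (rep (cls c)) = cls c"
      using rep[OF cls_closed[OF c]] by auto
    then have "rep (cls c) - c \<in> H"
      by (simp add: cls_eq_iff)
    from h_H[OF this] have "h (rep (cls c)) \<ominus>\<^bsub>K\<^esub> h c = \<zero>\<^bsub>K\<^esub>"
      using rc(1) c by (simp add: h_diff)
    then show ?thesis
      using h_closed[OF rc(1)] h_closed[OF c] by simp
  qed
  show thesis
  proof (rule that[of "\<lambda>X. h (rep X)"])
    show "h (rep X) \<in> carrier K" if "X \<in> carrier V" for X
      using rep[OF that] h_closed by simp
    show "h (rep (k \<odot>\<^bsub>V\<^esub> X)) = k \<otimes>\<^bsub>K\<^esub> h (rep X)" if k: "k \<in> carrier K" and "X \<in> carrier V" for k X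
    proof -
      obtain c where c: "Poly_Mapping.keys c \<subseteq> S" "X = cls c"
        by (rule V_carrierE[OF \<open>X \<in> carrier V\<close>])
      then show ?thesis
        by (simp add: V_smult k h_rep scale_keys h_scale)
    qed
    show "h (rep (tensor x p)) = x \<otimes>\<^bsub>K\<^esub> \<epsilon> (f p)" if "x \<in> carrier K" "p \<in> carrier M" for x p
      using that by (simp add: h_rep keys_frag_of h_of)
  qed
qed

end

section \<open>Vector spaces of dimension at most one\<close>

lemma (in Module.module) gen_set_singleton_iff:
  assumes v: "v \<in> carrier M"
  shows "LinearCombinations.module.span R M {v} = carrier M \<longleftrightarrow>
    (\<forall>x\<in>carrier M. \<exists>k\<in>carrier R. x = k \<odot>\<^bsub>M\<^esub> v)"
proof -
  have "LinearCombinations.module.span R M {v} = {k \<odot>\<^bsub>M\<^esub> v | k. k \<in> carrier R}"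
  proof -
    have "LinearCombinations.module.span R M {v} = {lincomb a {v} | a. a \<in> {v} \<rightarrow> carrier R}"
      using v by (intro finite_span) auto
    also have "\<dots> = {a v \<odot>\<^bsub>M\<^esub> v | a. a v \<in> carrier R}"
    proof -
      have "lincomb a {v} = a v \<odot>\<^bsub>M\<^esub> v" if "a v \<in> carrier R" for a
        using that v by (simp add: lincomb_def)
      then show ?thesis
        by (intro Collect_cong ex_cong1) auto
    qed
    also have "\<dots> = {k \<odot>\<^bsub>M\<^esub> v | k. k \<in> carrier R}"
    proof (intro equalityI subsetI)
      fix x assume "x \<in> {k \<odot>\<^bsub>M\<^esub> v | k. k \<in> carrier R}"
      then obtain k where "k \<in> carrier R" "x = k \<odot>\<^bsub>M\<^esub> v"
        by auto
      then show "x \<in> {a v \<odot>\<^bsub>M\<^esub> v | a. a v \<in> carrier R}"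
        by (intro CollectI exI[of _ "\<lambda>_. k"]) simp
    qed auto
    finally show ?thesis .
  qed
  moreover have "{k \<odot>\<^bsub>M\<^esub> v | k. k \<in> carrier R} \<subseteq> carrier M"
    using v by auto
  ultimately show ?thesis
    by blast
qed

lemma (in Module.module) gen_set_empty:
  "LinearCombinations.module.span R M {} = {\<zero>\<^bsub>M\<^esub>}"
  using finite_span[of "{}"] by (simp add: lincomb_def)

context vectorspace
begin

lemma dim_le_one:
  assumes "v \<in> carrier V" "\<And>x. x \<in> carrier V \<Longrightarrow> \<exists>k\<in>carrier K. x = k \<odot>\<^bsub>V\<^esub> v"
  shows "fin_dim" "dim \<le> 1"
proof -
  have gen: "gen_set {v}"
    using assms gen_set_singleton_iff by blast
  then show fin_dim
    unfolding fin_dim_def using assms(1) by (intro exI[of _ "{v}"]) simp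
  show "dim \<le> 1"
    using gen_ge_dim[of "{v}"] gen assms(1) by simp
qed

text \<open>\<open>dim\<close> is the least cardinality of a finite generating set; in finite
  dimension such sets exist, so the minimum is taken.\<close>

lemma dim_attained:
  assumes fin_dim
  obtains A where "finite A" "card A = dim" "A \<subseteq> carrier V" "gen_set A"
proof -
  obtain A where "finite A" "A \<subseteq> carrier V" "gen_set A"
    using assms unfolding fin_dim_def by auto
  then have "\<exists>n A. finite A \<and> card A = n \<and> A \<subseteq> carrier V \<and> gen_set A"
    by auto
  from LeastI_ex[OF this] that show thesis
    unfolding dim_def by auto
qed

lemma dim_le_oneE:
  assumes fin_dim "dim \<le> 1"
  obtains v where "v \<in> carrier V" "\<And>x. x \<in> carrier V \<Longrightarrow> \<exists>k\<in>carrier K. x = k \<odot>\<^bsub>V\<^esub> v"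
proof -
  obtain A where A: "finite A" "card A = dim" "A \<subseteq> carrier V" "gen_set A"
    using dim_attained[OF assms(1)] .
  show thesis
  proof (cases "A = {}")
    case True
    with A(4) gen_set_empty have "carrier V = {\<zero>\<^bsub>V\<^esub>}"
      by simp
    with that[of "\<zero>\<^bsub>V\<^esub>"] show thesis
      by (auto intro!: bexI[of _ "\<zero>\<^bsub>K\<^esub>"])
  next
    case False
    with A(1,2) assms(2) have "card A = 1"
      using card_gt_0_iff[of A] by linarith
    then obtain v where "A = {v}"
      by (auto simp: card_Suc_eq)
    with A that[of v] gen_set_singleton_iff[of v] show thesis
      by simp
  qed
qed

lemma dim_pos:
  assumes fin_dim "x \<in> carrier V" "x \<noteq> \<zero>\<^bsub>V\<^esub>"
  shows "dim \<noteq> 0"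
proof
  assume "dim = 0"
  with dim_attained[OF assms(1)] obtain A where "A = {}" "gen_set A"
    by auto
  with gen_set_empty assms(2,3) show False
    by auto
qed

end

section \<open>Rank and pairwise dependence\<close>

context tensor_module
begin

lemma module_rank_eq: "module_rank R M = V.dim"
  by (simp add: module_rank_def)

text \<open>A pure tensor \<open>x \<otimes> p\<close> is the multiple
  \<open>x (1 \<otimes> p)\<close>, and every class is an integer combination of pure tensors.
  Generation of \<open>V\<close> can therefore be checked on the elements
  \<open>1 \<otimes> p\<close>.\<close>

lemma V_generated_by_tensors:
  assumes W: "LinearCombinations.submodule K W V"
    and one: "\<And>p. p \<in> carrier M \<Longrightarrow> tensor \<one>\<^bsub>K\<^esub> p \<in> W"
  shows "W = carrier V"
proof
  interpret W: LinearCombinations.submodule K W V by (rule W)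
  show "W \<subseteq> carrier V"
    by (rule W.subset)
  have tensor: "tensor x p \<in> W" if "x \<in> carrier K" "p \<in> carrier M" for x p
    using W.smult_closed[OF that(1) one[OF that(2)]] that by (simp only: V_smult_tensor K.one_closed K.r_one)
  have "cls c \<in> W" if "Poly_Mapping.keys c \<subseteq> S" for c
  proof -
    have "Poly_Mapping.keys c \<subseteq> S \<and> cls c \<in> W"
      using that
    proof (induction c rule: frag_induction)
      case zero
      then show ?case
        using W.zero_closed by (simp add: V_zero)
    next
      case (one s)
      then show ?case
        using tensor by (auto simp: keys_frag_of)
    next
      case (diff c d)
      have "(\<ominus>\<^bsub>K\<^esub> \<one>\<^bsub>K\<^esub>) \<odot>\<^bsub>V\<^esub> cls d \<in> W"
        using diff by simp
      also have "(\<ominus>\<^bsub>K\<^esub> \<one>\<^bsub>K\<^esub>) \<odot>\<^bsub>V\<^esub> cls d = \<ominus>\<^bsub>V\<^esub> cls d"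
        using diff by (intro V.smult_minus_1) simp
      finally have "cls c \<oplus>\<^bsub>V\<^esub> \<ominus>\<^bsub>V\<^esub> cls d \<in> W"
        using diff by simp
      moreover have "cls c = cls (c - d) \<oplus>\<^bsub>V\<^esub> cls d"
        using diff by (simp add: V_add keys_diff_subset)
      ultimately show ?case
        using diff by (simp add: keys_diff_subset V.a_assoc V.r_neg)
    qed
    then show ?thesis
      by simp
  qed
  then show "carrier V \<subseteq> W"
    by (auto simp: V_carrier)
qed

text \<open>Without a finite generating set \<open>dim\<close> would be the least element of an
  empty set, and a bound on the rank would carry no information. The tensors
  \<open>1 \<otimes> p\<close> with \<open>p\<close> in a generating set of \<open>M\<close> span
  \<open>V\<close>.\<close>

lemma fin_gen_imp_fin_dim:
  assumes "fin_gen_module R M"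
  shows "V.fin_dim"
proof -
  obtain A where A: "finite A" "A \<subseteq> carrier M" "LinearCombinations.module.span R M A = carrier M"
    using assms unfolding fin_gen_module_def by auto
  define B where "B = (\<lambda>p. tensor \<one>\<^bsub>K\<^esub> p) ` A"
  have B: "finite B" "B \<subseteq> carrier V"
    using A by (auto simp: B_def simp del: cls_closed)
  define W where "W = LinearCombinations.module.span K V B"
  have W: "LinearCombinations.submodule K W V"
    unfolding W_def by (rule V.span_is_submodule[OF B(2)])
  interpret W: LinearCombinations.submodule K W V by (rule W)
  \<comment> \<open>Instead of expanding elements of \<open>M\<close> as linear combinations, those
    whose tensor lies in \<open>W\<close> are collected into a submodule; it contains the generators
    and so is all of \<open>M\<close>.\<close>
  define N where "N = {p \<in> carrier M. tensor \<one>\<^bsub>K\<^esub> p \<in> W}"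
  have "LinearCombinations.submodule R N M"
  proof (rule LinearCombinations.submodule.intro)
    have "tensor \<one>\<^bsub>K\<^esub> (\<zero> \<odot>\<^bsub>M\<^esub> \<zero>\<^bsub>M\<^esub>) = \<zero>\<^bsub>K\<^esub> \<odot>\<^bsub>V\<^esub> tensor \<one>\<^bsub>K\<^esub> \<zero>\<^bsub>M\<^esub>"
      by (simp only: tensor_smult_right V_smult_tensor frac_embed_zero zero_closed M.zero_closed
          K.one_closed K.zero_closed)
    also have "\<dots> \<in> W"
      by simp
    finally show "\<zero>\<^bsub>M\<^esub> \<in> N"
      by (simp add: N_def)
  next
    fix p q assume "p \<in> N" "q \<in> N"
    then show "p \<oplus>\<^bsub>M\<^esub> q \<in> N"
      by (simp add: N_def tensor_add_right)
  next
    fix r p assume r: "r \<in> carrier R" and "p \<in> N"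
    then have p: "p \<in> carrier M" "tensor \<one>\<^bsub>K\<^esub> p \<in> W"
      by (simp_all add: N_def)
    have "tensor \<one>\<^bsub>K\<^esub> (r \<odot>\<^bsub>M\<^esub> p) = \<epsilon> r \<odot>\<^bsub>V\<^esub> tensor \<one>\<^bsub>K\<^esub> p"
      using r p(1) by (simp only: tensor_smult_right V_smult_tensor frac_embed_closed K.one_closed)
    also have "\<dots> \<in> W"
      using r p(2) by simp
    finally show "r \<odot>\<^bsub>M\<^esub> p \<in> N"
      using r p(1) by (simp add: N_def)
  qed (auto simp: N_def M.module_axioms)
  moreover have "A \<subseteq> N"
    using A(2) V.in_own_span[OF B(2)] by (auto simp: N_def W_def B_def)
  ultimately have "carrier M \<subseteq> N"
    using M.span_is_subset[of A N] A(3) by simp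
  then have "W = carrier V"
    by (intro V_generated_by_tensors[OF W]) (auto simp: N_def)
  then show ?thesis
    unfolding V.fin_dim_def using B by (auto simp: W_def)
qed

text \<open>
  The functionals of \<open>M\<close> detect linear dependence: if \<open>f x \<noteq> 0\<close> but \<open>f(y) x \<noteq> f(x) y\<close>, some
  \<open>g\<close> separates the two sides, although \<open>(f, g)\<close> has rank one on a one-dimensional space.
\<close>

lemma rank_le_one_imp_pairwise_dependent:
  assumes tl: "torsionless R M" and fg: "fin_gen_module R M" and rank: "module_rank R M \<le> 1"
  shows "pairwise_dependent R M"
  unfolding pairwise_dependent_def
proof (intro ballI)
  fix x y assume x: "x \<in> carrier M" and y: "y \<in> carrier M"
  obtain v where v: "v \<in> carrier V" "\<And>X. X \<in> carrier V \<Longrightarrow> \<exists>k\<in>carrier K. X = k \<odot>\<^bsub>V\<^esub> v"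
    using V.dim_le_oneE[OF fin_gen_imp_fin_dim[OF fg]] rank module_rank_eq by auto
  show "\<exists>r\<in>carrier R. \<exists>s\<in>carrier R. (r \<noteq> \<zero> \<or> s \<noteq> \<zero>) \<and> r \<odot>\<^bsub>M\<^esub> x = s \<odot>\<^bsub>M\<^esub> y"
  proof (cases "x = \<zero>\<^bsub>M\<^esub>")
    case True
    then show ?thesis
      using y by (intro bexI[of _ \<one>] bexI[of _ \<zero>]) simp_all
  next
    case False
    then obtain f where f: "linear_functional R M f" "f x \<noteq> \<zero>"
      using tl x unfolding torsionless_def by auto
    have fx: "f x \<in> carrier R" and fy: "f y \<in> carrier R"
      using linear_functionalD(1)[OF f(1)] x y by simp_all
    have "f y \<odot>\<^bsub>M\<^esub> x = f x \<odot>\<^bsub>M\<^esub> y"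
    proof (rule ccontr)
      assume ne: "f y \<odot>\<^bsub>M\<^esub> x \<noteq> f x \<odot>\<^bsub>M\<^esub> y"
      define d where "d = f y \<odot>\<^bsub>M\<^esub> x \<oplus>\<^bsub>M\<^esub> (\<ominus> f x) \<odot>\<^bsub>M\<^esub> y"
      have d: "d \<in> carrier M"
        using x y fx fy by (simp add: d_def)
      have "d = f y \<odot>\<^bsub>M\<^esub> x \<ominus>\<^bsub>M\<^esub> f x \<odot>\<^bsub>M\<^esub> y"
        using x y fx fy by (simp add: d_def a_minus_def M.smult_l_minus)
      with ne have "d \<noteq> \<zero>\<^bsub>M\<^esub>"
        using x y fx fy by simp
      then obtain g where g: "linear_functional R M g" "g d \<noteq> \<zero>"
        using tl d unfolding torsionless_def by auto
      have gx: "g x \<in> carrier R" and gy: "g y \<in> carrier R"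
        using linear_functionalD(1)[OF g(1)] x y by simp_all
      obtain \<Phi> where \<Phi>: "\<Phi> v \<in> carrier K"
        "\<And>k. k \<in> carrier K \<Longrightarrow> \<Phi> (k \<odot>\<^bsub>V\<^esub> v) = k \<otimes>\<^bsub>K\<^esub> \<Phi> v"
        "\<And>p. p \<in> carrier M \<Longrightarrow> \<Phi> (tensor \<one>\<^bsub>K\<^esub> p) = \<one>\<^bsub>K\<^esub> \<otimes>\<^bsub>K\<^esub> \<epsilon> (f p)"
        by (rule extend_functional[OF f(1)]) (use v(1) K.one_closed in metis)
      obtain \<Psi> where \<Psi>: "\<Psi> v \<in> carrier K"
        "\<And>k. k \<in> carrier K \<Longrightarrow> \<Psi> (k \<odot>\<^bsub>V\<^esub> v) = k \<otimes>\<^bsub>K\<^esub> \<Psi> v"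
        "\<And>p. p \<in> carrier M \<Longrightarrow> \<Psi> (tensor \<one>\<^bsub>K\<^esub> p) = \<one>\<^bsub>K\<^esub> \<otimes>\<^bsub>K\<^esub> \<epsilon> (g p)"
        by (rule extend_functional[OF g(1)]) (use v(1) K.one_closed in metis)
      obtain k where k: "k \<in> carrier K" "tensor \<one>\<^bsub>K\<^esub> x = k \<odot>\<^bsub>V\<^esub> v"
        using v(2)[OF tensor_closed[OF K.one_closed x]] by auto
      obtain l where l: "l \<in> carrier K" "tensor \<one>\<^bsub>K\<^esub> y = l \<odot>\<^bsub>V\<^esub> v"
        using v(2)[OF tensor_closed[OF K.one_closed y]] by auto
      have e: "\<epsilon> (f x) = k \<otimes>\<^bsub>K\<^esub> \<Phi> v" "\<epsilon> (f y) = l \<otimes>\<^bsub>K\<^esub> \<Phi> v"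
        "\<epsilon> (g x) = k \<otimes>\<^bsub>K\<^esub> \<Psi> v" "\<epsilon> (g y) = l \<otimes>\<^bsub>K\<^esub> \<Psi> v"
        using \<Phi>(3)[OF x] \<Phi>(3)[OF y] \<Psi>(3)[OF x] \<Psi>(3)[OF y] fx fy gx gy
        unfolding k(2) l(2) \<Phi>(2)[OF k(1)] \<Phi>(2)[OF l(1)] \<Psi>(2)[OF k(1)] \<Psi>(2)[OF l(1)]
        by simp_all
      \<comment> \<open>All four values are coefficients \<open>k\<close>, \<open>l\<close> times
        \<open>\<Phi> v\<close> or \<open>\<Psi> v\<close>, so the two-by-two determinant of
        \<open>f\<close> and \<open>g\<close> at \<open>x\<close> and \<open>y\<close> vanishes.
        This determinant is \<open>g d\<close>, contradicting the choice of
        \<open>g\<close>.\<close>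
      have "\<epsilon> (f y \<otimes> g x) = \<epsilon> (f x \<otimes> g y)"
        unfolding frac_embed_mult[OF fy gx] frac_embed_mult[OF fx gy] e
        using k(1) l(1) \<Phi>(1) \<Psi>(1) by (simp add: K.m_ac)
      then have "f y \<otimes> g x = f x \<otimes> g y"
        using fx fy gx gy by (subst (asm) frac_embed_eq_iff) simp_all
      moreover have "g d = f y \<otimes> g x \<ominus> f x \<otimes> g y"
        using x y fx fy gx gy
        by (simp add: d_def linear_functionalD[OF g(1)] a_minus_def l_minus)
      ultimately have "g d = \<zero>"
        using fx gy by (simp add: a_minus_def r_neg)
      with g(2) show False
        by simp
    qed
    then show ?thesis
      using f(2) fx fy by (intro bexI[of _ "f y"] bexI[of _ "f x"]) simp_all
  qed
qed

text \<open>From \<open>r p = s x\<close> with \<open>r \<noteq> 0\<close>, moving scalars across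
  the tensor sign gives \<open>1 \<otimes> p = (s/r) (1 \<otimes> x)\<close>; for
  \<open>x \<noteq> 0\<close>, torsion-freeness excludes \<open>r = 0\<close>. The premise on
  \<open>x = 0\<close> lets the zero module be covered by the same statement.\<close>

lemma V_spanned_by_one:
  assumes tf: "torsion_free R M" and pd: "pairwise_dependent R M" and x: "x \<in> carrier M"
    and ne: "x = \<zero>\<^bsub>M\<^esub> \<Longrightarrow> carrier M = {\<zero>\<^bsub>M\<^esub>}"
    and X: "X \<in> carrier V"
  shows "\<exists>k\<in>carrier K. X = k \<odot>\<^bsub>V\<^esub> tensor \<one>\<^bsub>K\<^esub> x"
proof -
  define W where "W = LinearCombinations.module.span K V {tensor \<one>\<^bsub>K\<^esub> x}"
  have W: "LinearCombinations.submodule K W V"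
    unfolding W_def using x by (intro V.span_is_submodule) simp
  interpret W: LinearCombinations.submodule K W V by (rule W)
  have xW: "tensor \<one>\<^bsub>K\<^esub> x \<in> W"
    using V.in_own_span[of "{tensor \<one>\<^bsub>K\<^esub> x}"] x by (simp add: W_def)
  have "tensor \<one>\<^bsub>K\<^esub> p \<in> W" if p: "p \<in> carrier M" for p
  proof -
    have "\<exists>r\<in>carrier R - {\<zero>}. \<exists>s\<in>carrier R. r \<odot>\<^bsub>M\<^esub> p = s \<odot>\<^bsub>M\<^esub> x"
    proof (cases "x = \<zero>\<^bsub>M\<^esub>")
      case True
      then show ?thesis
        using p ne by (intro bexI[of _ \<one>] bexI[of _ \<zero>]) simp_all
    next
      case False
      obtain r s where rs: "r \<in> carrier R" "s \<in> carrier R" "r \<noteq> \<zero> \<or> s \<noteq> \<zero>"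
        "r \<odot>\<^bsub>M\<^esub> p = s \<odot>\<^bsub>M\<^esub> x"
        using pd[unfolded pairwise_dependent_def, rule_format, OF p x] by blast
      have "r \<noteq> \<zero>"
      proof
        assume r: "r = \<zero>"
        with rs(4) p have "s \<odot>\<^bsub>M\<^esub> x = \<zero>\<^bsub>M\<^esub>"
          by simp
        with torsion_freeD[OF tf rs(2) x] False rs(3) r show False
          by simp
      qed
      with rs show ?thesis
        by (intro bexI[of _ r] bexI[of _ s]) simp_all
    qed
    then obtain r s where rs: "r \<in> carrier R" "r \<noteq> \<zero>" "s \<in> carrier R" "r \<odot>\<^bsub>M\<^esub> p = s \<odot>\<^bsub>M\<^esub> x"
      by auto
    have e: "\<epsilon> r \<in> carrier K" "\<epsilon> r \<noteq> \<zero>\<^bsub>K\<^esub>" "\<epsilon> s \<in> carrier K"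
      using rs by simp_all
    define q where "q = inv\<^bsub>K\<^esub> \<epsilon> r"
    have q: "q \<in> carrier K" "\<epsilon> r \<otimes>\<^bsub>K\<^esub> q = \<one>\<^bsub>K\<^esub>"
      using e K.field_Units unfolding q_def by simp_all
    have "tensor \<one>\<^bsub>K\<^esub> p = tensor (\<epsilon> r \<otimes>\<^bsub>K\<^esub> q) p"
      by (simp add: q)
    also have "\<dots> = tensor q (r \<odot>\<^bsub>M\<^esub> p)"
      using rs(1) p q(1) by (simp only: tensor_smult_right)
    also have "\<dots> = tensor q (s \<odot>\<^bsub>M\<^esub> x)"
      by (simp only: rs(4))
    also have "\<dots> = tensor (\<epsilon> s \<otimes>\<^bsub>K\<^esub> q) x"
      using rs(3) x q(1) by (simp only: tensor_smult_right)
    also have "\<dots> = (\<epsilon> s \<otimes>\<^bsub>K\<^esub> q) \<odot>\<^bsub>V\<^esub> tensor \<one>\<^bsub>K\<^esub> x"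
      using e q(1) x by (simp only: V_smult_tensor K.m_closed K.one_closed K.r_one)
    also have "\<dots> \<in> W"
      using e q(1) xW by simp
    finally show ?thesis .
  qed
  then have "W = carrier V"
    by (rule V_generated_by_tensors[OF W])
  then show ?thesis
    using V.gen_set_singleton_iff[of "tensor \<one>\<^bsub>K\<^esub> x"] x X by (simp add: W_def)
qed

lemma pairwise_dependent_imp_rank_le_one:
  assumes "torsion_free R M" "pairwise_dependent R M"
  shows "module_rank R M \<le> 1"
proof -
  obtain x where x: "x \<in> carrier M" "x = \<zero>\<^bsub>M\<^esub> \<Longrightarrow> carrier M = {\<zero>\<^bsub>M\<^esub>}"
  proof (cases "carrier M = {\<zero>\<^bsub>M\<^esub>}")
    case True
    with that[of "\<zero>\<^bsub>M\<^esub>"] show thesis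
      by simp
  next
    case False
    then obtain x where "x \<in> carrier M" "x \<noteq> \<zero>\<^bsub>M\<^esub>"
      using M.zero_closed by fastforce
    with that[of x] show thesis
      by simp
  qed
  show ?thesis
    unfolding module_rank_eq
    by (rule V.dim_le_one(2)[of "tensor \<one>\<^bsub>K\<^esub> x"]) (use V_spanned_by_one[OF assms x] x(1) in simp_all)
qed

text \<open>The lower bound requires \<open>1 \<otimes> x \<noteq> 0\<close>. This cannot be read
  off the relations directly, but the extension of a functional with \<open>f x \<noteq> 0\<close>
  takes the nonzero value \<open>f x\<close> there.\<close>

lemma pairwise_dependent_imp_rank_eq_one:
  assumes tl: "torsionless R M" and pd: "pairwise_dependent R M" and x: "x \<in> carrier M" "x \<noteq> \<zero>\<^bsub>M\<^esub>"
  shows "module_rank R M = 1"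
proof -
  have tf: "torsion_free R M"
    by (rule torsionless_imp_torsion_free[OF M.module_axioms tl])
  have fin: "V.fin_dim"
    by (rule V.dim_le_one(1)[of "tensor \<one>\<^bsub>K\<^esub> x"]) (use V_spanned_by_one[OF tf pd x(1)] x in simp_all)
  obtain f where f: "linear_functional R M f" "f x \<noteq> \<zero>"
    using tl x unfolding torsionless_def by auto
  have fx: "f x \<in> carrier R"
    using linear_functionalD(1)[OF f(1)] x by simp
  have "tensor \<one>\<^bsub>K\<^esub> x \<noteq> \<zero>\<^bsub>V\<^esub>"
  proof
    assume 0: "tensor \<one>\<^bsub>K\<^esub> x = \<zero>\<^bsub>V\<^esub>"
    \<comment> \<open>That \<open>\<Phi>\<close> vanishes at zero is obtained from homogeneity with
      the scalar zero.\<close>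
    obtain \<Phi> where \<Phi>: "\<Phi> \<zero>\<^bsub>V\<^esub> \<in> carrier K" "\<Phi> (\<zero>\<^bsub>K\<^esub> \<odot>\<^bsub>V\<^esub> \<zero>\<^bsub>V\<^esub>) = \<zero>\<^bsub>K\<^esub> \<otimes>\<^bsub>K\<^esub> \<Phi> \<zero>\<^bsub>V\<^esub>"
      "\<Phi> (tensor \<one>\<^bsub>K\<^esub> x) = \<one>\<^bsub>K\<^esub> \<otimes>\<^bsub>K\<^esub> \<epsilon> (f x)"
      by (rule extend_functional[OF f(1)]) (use x(1) K.one_closed K.zero_closed V.zero_closed in metis)
    have "\<epsilon> (f x) = \<zero>\<^bsub>K\<^esub>"
      using \<Phi> fx unfolding 0 by simp
    with fx f(2) show False
      by simp
  qed
  from V.dim_pos[OF fin tensor_closed[OF K.one_closed x(1)] this]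
    pairwise_dependent_imp_rank_le_one[OF tf pd]
  show ?thesis
    unfolding module_rank_eq by linarith
qed

end

section \<open>Isomorphism invariance\<close>

lemma module_isomorphicI:
  assumes "\<And>x. x \<in> carrier M \<Longrightarrow> f x \<in> carrier N"
    and "\<And>x y. \<lbrakk>x \<in> carrier M; y \<in> carrier M\<rbrakk> \<Longrightarrow> f (x \<oplus>\<^bsub>M\<^esub> y) = f x \<oplus>\<^bsub>N\<^esub> f y"
    and "\<And>r x. \<lbrakk>r \<in> carrier R; x \<in> carrier M\<rbrakk> \<Longrightarrow> f (r \<odot>\<^bsub>M\<^esub> x) = r \<odot>\<^bsub>N\<^esub> f x"
    and "bij_betw f (carrier M) (carrier N)"
  shows "module_isomorphic R M N"
  unfolding module_isomorphic_def LinearCombinations.module_hom_def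
  using assms by (intro bexI[of _ f]) auto

lemma module_homD:
  assumes "f \<in> LinearCombinations.module_hom R M N"
  shows "x \<in> carrier M \<Longrightarrow> f x \<in> carrier N"
    "x \<in> carrier M \<Longrightarrow> y \<in> carrier M \<Longrightarrow> f (x \<oplus>\<^bsub>M\<^esub> y) = f x \<oplus>\<^bsub>N\<^esub> f y"
    "r \<in> carrier R \<Longrightarrow> x \<in> carrier M \<Longrightarrow> f (r \<odot>\<^bsub>M\<^esub> x) = r \<odot>\<^bsub>N\<^esub> f x"
  using assms by (auto simp: LinearCombinations.module_hom_def)

lemma module_isomorphic_refl: "module_isomorphic R M M"
  by (rule module_isomorphicI[of _ id]) auto

lemma module_isomorphic_sym:
  assumes M: "Module.module R M" and iso: "module_isomorphic R M N"
  shows "module_isomorphic R N M"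
proof -
  interpret M: Module.module R M by (rule M)
  obtain f where f_hom: "f \<in> LinearCombinations.module_hom R M N"
    and f_bij: "bij_betw f (carrier M) (carrier N)"
    using iso unfolding module_isomorphic_def by auto
  note f = module_homD[OF f_hom] f_bij
  define g where "g = inv_into (carrier M) f"
  have g: "bij_betw g (carrier N) (carrier M)"
    unfolding g_def by (rule bij_betw_inv_into[OF f(4)])
  have gc: "g y \<in> carrier M" if "y \<in> carrier N" for y
    using bij_betwE[OF g] that by blast
  have fg: "f (g y) = y" if "y \<in> carrier N" for y
    unfolding g_def by (rule bij_betw_inv_into_right[OF f(4) that])
  have gf: "g (f x) = x" if "x \<in> carrier M" for x
    unfolding g_def by (rule bij_betw_inv_into_left[OF f(4) that])
  show ?thesis
  proof (rule module_isomorphicI[of _ g])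
    fix x y assume x: "x \<in> carrier N" and y: "y \<in> carrier N"
    have "g (f (g x \<oplus>\<^bsub>M\<^esub> g y)) = g x \<oplus>\<^bsub>M\<^esub> g y"
      using gc[OF x] gc[OF y] by (intro gf) simp
    then show "g (x \<oplus>\<^bsub>N\<^esub> y) = g x \<oplus>\<^bsub>M\<^esub> g y"
      by (simp only: f(2)[OF gc[OF x] gc[OF y]] fg[OF x] fg[OF y])
  next
    fix r y assume r: "r \<in> carrier R" and y: "y \<in> carrier N"
    have "g (f (r \<odot>\<^bsub>M\<^esub> g y)) = r \<odot>\<^bsub>M\<^esub> g y"
      using r gc[OF y] by (intro gf) simp
    then show "g (r \<odot>\<^bsub>N\<^esub> y) = r \<odot>\<^bsub>M\<^esub> g y"
      by (simp only: f(3)[OF r gc[OF y]] fg[OF y])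
  qed (use g gc in simp_all)
qed

lemma module_isomorphic_trans:
  assumes "module_isomorphic R L M" "module_isomorphic R M N"
  shows "module_isomorphic R L N"
proof -
  obtain f where f_hom: "f \<in> LinearCombinations.module_hom R L M"
    and f_bij: "bij_betw f (carrier L) (carrier M)"
    using assms(1) unfolding module_isomorphic_def by auto
  note f = module_homD[OF f_hom] f_bij
  obtain g where g_hom: "g \<in> LinearCombinations.module_hom R M N"
    and g_bij: "bij_betw g (carrier M) (carrier N)"
    using assms(2) unfolding module_isomorphic_def by auto
  note g = module_homD[OF g_hom] g_bij
  show ?thesis
    by (rule module_isomorphicI[of _ "g \<circ> f"]) (simp_all add: f(1-3) g(1-3) bij_betw_trans[OF f(4) g(4)])
qed

lemma iso_class_eq:
  assumes "Module.module R M" "Module.module R N" "module_isomorphic R M N"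
  shows "iso_class R M = iso_class R N"
proof -
  have "module_isomorphic R M Q \<longleftrightarrow> module_isomorphic R N Q" for Q :: "'a umodule"
    using module_isomorphic_trans[OF assms(3), of Q]
      module_isomorphic_trans[OF module_isomorphic_sym[OF assms(1,3)], of Q] by auto
  then show ?thesis
    by (simp add: iso_class_def)
qed

text \<open>A module of the fixed type belongs to its own class, so equality of classes places it in
  the other class. This is why the type of \<open>M\<close> is restricted.\<close>

lemma iso_class_eqD:
  fixes M :: "'a umodule"
  assumes "Module.module R M" "iso_class R M = iso_class R N"
  shows "module_isomorphic R N M"
proof -
  have "M \<in> iso_class R M"
    using assms(1) module_isomorphic_refl by (simp add: iso_class_def)
  then show ?thesis
    unfolding assms(2) by (simp add: iso_class_def)
qed

text \<open>In this form a rank bound travels along isomorphisms without an isomorphism of tensor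
  products having to be built.\<close>

lemma pairwise_dependent_isomorphic:
  assumes M: "Module.module R M" and iso: "module_isomorphic R M N" and N: "pairwise_dependent R N"
  shows "pairwise_dependent R M"
  unfolding pairwise_dependent_def
proof (intro ballI)
  interpret M: Module.module R M by (rule M)
  obtain f where f_hom: "f \<in> LinearCombinations.module_hom R M N"
    and f_bij: "bij_betw f (carrier M) (carrier N)"
    using iso unfolding module_isomorphic_def by auto
  note f = module_homD[OF f_hom] bij_betw_imp_inj_on[OF f_bij]
  fix x y assume x: "x \<in> carrier M" and y: "y \<in> carrier M"
  obtain r s where rs: "r \<in> carrier R" "s \<in> carrier R" "r \<noteq> \<zero>\<^bsub>R\<^esub> \<or> s \<noteq> \<zero>\<^bsub>R\<^esub>"
    "r \<odot>\<^bsub>N\<^esub> f x = s \<odot>\<^bsub>N\<^esub> f y"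
    using N[unfolded pairwise_dependent_def, rule_format, OF f(1)[OF x] f(1)[OF y]] by blast
  then have "f (r \<odot>\<^bsub>M\<^esub> x) = f (s \<odot>\<^bsub>M\<^esub> y)"
    using x y by (simp add: f(3))
  then have "r \<odot>\<^bsub>M\<^esub> x = s \<odot>\<^bsub>M\<^esub> y"
    using inj_onD[OF f(4)] rs(1,2) x y by simp
  with rs show "\<exists>r\<in>carrier R. \<exists>s\<in>carrier R. (r \<noteq> \<zero>\<^bsub>R\<^esub> \<or> s \<noteq> \<zero>\<^bsub>R\<^esub>) \<and> r \<odot>\<^bsub>M\<^esub> x = s \<odot>\<^bsub>M\<^esub> y"
    by (intro bexI[of _ r] bexI[of _ s]) simp_all
qed

lemma torsionless_isomorphic:
  assumes M: "Module.module R M" and N: "Module.module R N"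
    and iso: "module_isomorphic R M N" and tl: "torsionless R N"
  shows "torsionless R M"
  unfolding torsionless_def
proof (intro ballI impI)
  interpret M: Module.module R M by (rule M)
  interpret N: Module.module R N by (rule N)
  obtain f where f_hom: "f \<in> LinearCombinations.module_hom R M N"
    and f_bij: "bij_betw f (carrier M) (carrier N)"
    using iso unfolding module_isomorphic_def by auto
  note f = module_homD[OF f_hom] bij_betw_imp_inj_on[OF f_bij]
  have f0: "f \<zero>\<^bsub>M\<^esub> = \<zero>\<^bsub>N\<^esub>"
    using f(3)[of "\<zero>\<^bsub>R\<^esub>" "\<zero>\<^bsub>M\<^esub>"] f(1)[of "\<zero>\<^bsub>M\<^esub>"] by simp
  fix x assume x: "x \<in> carrier M" "x \<noteq> \<zero>\<^bsub>M\<^esub>"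
  then have "f x \<noteq> \<zero>\<^bsub>N\<^esub>"
    using inj_onD[OF f(4), of x "\<zero>\<^bsub>M\<^esub>"] f0 by auto
  then obtain g where g: "linear_functional R N g" "g (f x) \<noteq> \<zero>\<^bsub>R\<^esub>"
    using tl f(1)[OF x(1)] unfolding torsionless_def by auto
  have "linear_functional R M (g \<circ> f)"
    unfolding linear_functional_def
    by (simp add: f(1-3) linear_functionalD[OF g(1)])
  with g(2) show "\<exists>g. linear_functional R M g \<and> g x \<noteq> \<zero>\<^bsub>R\<^esub>"
    by (intro exI[of _ "g \<circ> f"]) simp
qed

section \<open>Projective modules and ideals\<close>

context cring
begin

lemma free_module_simps [simp]:
  "carrier (free_module R S) = {f \<in> S \<rightarrow>\<^sub>E carrier R. finite {s \<in> S. f s \<noteq> \<zero>}}"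
  "add (free_module R S) = (\<lambda>f g. \<lambda>v\<in>S. f v \<oplus> g v)"
  "ring.zero (free_module R S) = (\<lambda>v\<in>S. \<zero>)"
  "smult (free_module R S) = (\<lambda>c f. \<lambda>v\<in>S. c \<otimes> f v)"
  by (simp_all add: free_module_def func_space_def)

text \<open>Over a finite index set the finite support condition is automatic, so the module facts
  about \<open>func_space\<close> become available.\<close>

lemma free_module_finite: "finite S \<Longrightarrow> free_module R S = func_space S"
  by (simp add: free_module_def func_space_def)

text \<open>A nonzero element of a free module has a nonzero coordinate, and coordinate projections
  remain functionals when restricted to a direct summand.\<close>

lemma fgp_module_torsionless:
  assumes "fgp_module R P"
  shows "torsionless R P"
proof -
  obtain S :: "'c set" and N where N: "direct_summand R (free_module R S) N"
    and iso: "module_isomorphic R P ((free_module R S)\<lparr>carrier := N\<rparr>)"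
    using assms unfolding fgp_module_def projective_module_def by auto
  then have sub: "LinearCombinations.submodule R N (free_module R S)"
    by (auto simp: direct_summand_def internal_direct_sum_def)
  have "N \<subseteq> S \<rightarrow>\<^sub>E carrier R"
    using LinearCombinations.submodule.subset[OF sub] by auto
  have "torsionless R ((free_module R S)\<lparr>carrier := N\<rparr>)"
    unfolding torsionless_def
  proof (intro ballI impI)
    fix x assume "x \<in> carrier ((free_module R S)\<lparr>carrier := N\<rparr>)"
      and ne: "x \<noteq> \<zero>\<^bsub>(free_module R S)\<lparr>carrier := N\<rparr>\<^esub>"
    then have x: "x \<in> S \<rightarrow>\<^sub>E carrier R"
      using \<open>N \<subseteq> S \<rightarrow>\<^sub>E carrier R\<close> by auto
    have "\<exists>s\<in>S. x s \<noteq> \<zero>"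
    proof (rule ccontr)
      assume "\<not> ?thesis"
      then have "x = (\<lambda>v\<in>S. \<zero>)"
        using x by (intro extensionalityI[of _ S]) (auto simp: PiE_def)
      with ne show False
        by simp
    qed
    then obtain s where s: "s \<in> S" "x s \<noteq> \<zero>"
      by auto
    then have "linear_functional R ((free_module R S)\<lparr>carrier := N\<rparr>) (\<lambda>h. h s)"
      unfolding linear_functional_def using \<open>N \<subseteq> S \<rightarrow>\<^sub>E carrier R\<close> by auto
    with s show "\<exists>f. linear_functional R ((free_module R S)\<lparr>carrier := N\<rparr>) f \<and> f x \<noteq> \<zero>"
      by (intro exI[of _ "\<lambda>h. h s"]) simp
  qed
  moreover have "Module.module R P"
    using assms by (simp add: fgp_module_def)
  moreover have "Module.module R ((free_module R S)\<lparr>carrier := N\<rparr>)"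
    by (rule LinearCombinations.module.submodule_is_module
        [OF LinearCombinations.submodule.module[OF sub] sub])
  ultimately show ?thesis
    using torsionless_isomorphic[OF _ _ iso] by simp
qed

text \<open>An ideal as a module whose elements are the constant functions \<open>nat \<Rightarrow> 'a\<close>.\<close>

definition ideal_module :: "'a set \<Rightarrow> 'a umodule" where
  "ideal_module I = \<lparr>carrier = (\<lambda>r _. r) ` I, monoid.mult = (\<lambda>u v. u), one = (\<lambda>_. \<zero>),
     ring.zero = (\<lambda>_. \<zero>), add = (\<lambda>u v n. u n \<oplus> v n), smult = (\<lambda>r u n. r \<otimes> u n)\<rparr>"

lemma ideal_module_simps [simp]:
  "carrier (ideal_module I) = (\<lambda>r _. r) ` I"
  "u \<oplus>\<^bsub>ideal_module I\<^esub> v = (\<lambda>n. u n \<oplus> v n)"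
  "\<zero>\<^bsub>ideal_module I\<^esub> = (\<lambda>_. \<zero>)"
  "r \<odot>\<^bsub>ideal_module I\<^esub> u = (\<lambda>n. r \<otimes> u n)"
  by (simp_all add: ideal_module_def)

lemma ideal_module_module:
  assumes "ideal I R"
  shows "Module.module R (ideal_module I)"
proof (rule moduleI)
  interpret I: ideal I R by (rule assms)
  show "cring R"
    by (rule is_cring)
  show "abelian_group (ideal_module I)"
  proof (rule abelian_groupI)
    fix x assume "x \<in> carrier (ideal_module I)"
    then obtain r where "r \<in> I" "x = (\<lambda>_. r)"
      by auto
    then show "\<exists>y\<in>carrier (ideal_module I). y \<oplus>\<^bsub>ideal_module I\<^esub> x = \<zero>\<^bsub>ideal_module I\<^esub>"
      by (intro bexI[of _ "\<lambda>_. \<ominus> r"]) (auto simp: l_neg)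
  qed (auto simp: a_ac)
qed (auto simp: l_distr r_distr m_assoc ideal.I_l_closed[OF assms] ideal.Icarr[OF assms])

lemma ideal_module_functional:
  assumes "ideal I R"
  shows "linear_functional R (ideal_module I) (\<lambda>u. u 0)"
  unfolding linear_functional_def by (auto simp: ideal.Icarr[OF assms])

lemma ideal_module_torsionless:
  assumes "ideal I R"
  shows "torsionless R (ideal_module I)"
  unfolding torsionless_def
proof (intro ballI impI)
  fix x assume "x \<in> carrier (ideal_module I)" "x \<noteq> \<zero>\<^bsub>ideal_module I\<^esub>"
  then show "\<exists>f. linear_functional R (ideal_module I) f \<and> f x \<noteq> \<zero>"
    using ideal_module_functional[OF assms] by (intro exI[of _ "\<lambda>u. u 0"]) auto
qed

text \<open>Commutativity is the dependence: \<open>s r = r s\<close> relates the elements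
  \<open>r\<close> and \<open>s\<close>, with \<open>\<one>\<close> and \<open>\<zero>\<close> as
  coefficients when \<open>r\<close> is zero.\<close>

lemma ideal_module_pairwise_dependent:
  assumes "ideal I R" "\<one> \<noteq> \<zero>"
  shows "pairwise_dependent R (ideal_module I)"
  unfolding pairwise_dependent_def
proof (intro ballI)
  interpret I: ideal I R by (rule assms)
  fix x y assume "x \<in> carrier (ideal_module I)" "y \<in> carrier (ideal_module I)"
  then obtain r s where rs: "r \<in> I" "s \<in> I" "x = (\<lambda>_. r)" "y = (\<lambda>_. s)"
    by auto
  show "\<exists>r\<in>carrier R. \<exists>s\<in>carrier R. (r \<noteq> \<zero> \<or> s \<noteq> \<zero>) \<and>
      r \<odot>\<^bsub>ideal_module I\<^esub> x = s \<odot>\<^bsub>ideal_module I\<^esub> y"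
  proof (cases "r = \<zero>")
    case True
    with rs assms(2) show ?thesis
      by (intro bexI[of _ \<one>] bexI[of _ \<zero>]) simp_all
  next
    case False
    with rs show ?thesis
      by (intro bexI[of _ s] bexI[of _ r]) (simp_all add: m_comm)
  qed
qed

end

section \<open>Nonzero ideals as finitely generated projective modules\<close>

text \<open>Noetherianity provides generators in the sense of \<open>Idl\<close>, whereas a module
  span is wanted. The elements of \<open>I\<close> whose constant function lies in the span form an
  ideal containing the generators, hence all of \<open>I\<close>.\<close>

lemma (in noetherian_domain) ideal_module_fin_gen:
  assumes "ideal I R"
  shows "fin_gen_module R (ideal_module I)"
proof -
  interpret I: ideal I R by (rule assms)
  interpret U: Module.module R "ideal_module I" by (rule ideal_module_module[OF assms])
  obtain A where A: "finite A" "A \<subseteq> carrier R" "I = Idl A"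
    using finetely_gen[OF assms] by auto
  have "A \<subseteq> I"
    using genideal_self[OF A(2)] A(3) by simp
  define B where "B = (\<lambda>r (_::nat). r) ` A"
  have B: "finite B" "B \<subseteq> carrier (ideal_module I)"
    using A(1) \<open>A \<subseteq> I\<close> by (auto simp: B_def)
  define W where "W = LinearCombinations.module.span R (ideal_module I) B"
  have W: "LinearCombinations.submodule R W (ideal_module I)"
    unfolding W_def by (rule U.span_is_submodule[OF B(2)])
  interpret W: LinearCombinations.submodule R W "ideal_module I" by (rule W)
  have "ideal {r \<in> I. (\<lambda>_. r) \<in> W} R"
  proof (rule ideal_criterion)
    show "\<zero> \<in> {r \<in> I. (\<lambda>_. r) \<in> W}"
      using W.zero_closed by simp
  next
    fix r s assume "r \<in> {r \<in> I. (\<lambda>_. r) \<in> W}" "s \<in> {r \<in> I. (\<lambda>_. r) \<in> W}"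
    then show "r \<oplus> s \<in> {r \<in> I. (\<lambda>_. r) \<in> W}"
      using W.m_closed[of "\<lambda>_. r" "\<lambda>_. s"] by simp
  next
    fix t r assume "t \<in> carrier R" "r \<in> {r \<in> I. (\<lambda>_. r) \<in> W}"
    then show "t \<otimes> r \<in> {r \<in> I. (\<lambda>_. r) \<in> W}"
      using W.smult_closed[of t "\<lambda>_. r"] by (simp add: I.I_l_closed)
  qed auto
  moreover have "A \<subseteq> {r \<in> I. (\<lambda>_. r) \<in> W}"
    using \<open>A \<subseteq> I\<close> U.in_own_span[OF B(2)] by (auto simp: W_def B_def)
  ultimately have "I \<subseteq> {r \<in> I. (\<lambda>_. r) \<in> W}"
    unfolding A(3) by (rule genideal_minimal)
  then have "carrier (ideal_module I) \<subseteq> W"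
    by auto
  with W.subset have "W = carrier (ideal_module I)"
    by (rule equalityI)
  with B show ?thesis
    unfolding fin_gen_module_def W_def by (intro exI[of _ B]) simp
qed

text \<open>A finite generating set \<open>S\<close> yields a functional on the free module over
  \<open>S\<close> with image \<open>I\<close>. Its section embeds \<open>I\<close> as a direct
  summand. Indexing by elements of the module itself matches the index type in
  \<open>projective_module\<close>.\<close>

lemma (in dedekind_domain) ideal_module_projective:
  assumes I: "ideal I R" "I \<noteq> {\<zero>}"
  shows "projective_module R (ideal_module I)"
proof -
  interpret I: ideal I R by (rule I)
  interpret U: Module.module R "ideal_module I" by (rule ideal_module_module[OF I(1)])
  obtain S where S: "finite S" "S \<subseteq> carrier (ideal_module I)"
    "LinearCombinations.module.span R (ideal_module I) S = carrier (ideal_module I)"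
    using ideal_module_fin_gen[OF I(1)] unfolding fin_gen_module_def by auto
  interpret L: mod_hom R "func_space S" "ideal_module I" "\<lambda>a. U.lincomb a S"
    by (rule U.lincomb_is_mod_hom[OF S(1,2)])
  \<comment> \<open>Linear combinations in \<open>ideal_module I\<close> are constant functions;
    evaluating at \<open>0\<close> recovers the ring element.\<close>
  define f where "f a = U.lincomb a S 0" for a
  have f: "linear_functional R (func_space S) f"
    unfolding linear_functional_def
  proof (intro conjI ballI funcsetI)
    fix a assume "a \<in> carrier (func_space S)"
    from L.f_im[OF this] show "f a \<in> carrier R"
      unfolding f_def by auto
  qed (simp_all add: f_def)
  have image: "f ` carrier (func_space S) = I"
  proof (intro equalityI subsetI)
    fix i assume "i \<in> f ` carrier (func_space S)"
    then obtain a where "a \<in> carrier (func_space S)" "i = f a"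
      by auto
    with L.f_im[of a] show "i \<in> I"
      unfolding f_def by auto
  next
    fix i assume "i \<in> I"
    then have "(\<lambda>_. i) \<in> LinearCombinations.module.span R (ideal_module I) S"
      unfolding S(3) by simp
    then obtain a where a: "a \<in> S \<rightarrow> carrier R" "(\<lambda>_. i) = U.lincomb a S"
      unfolding U.finite_span[OF S(1,2)] by auto
    have "U.lincomb (restrict a S) S = U.lincomb a S"
      using a(1) S(2) by (intro U.lincomb_cong) auto
    then have "f (restrict a S) = i"
      unfolding f_def a(2)[symmetric] by simp
    moreover have "restrict a S \<in> carrier (func_space S)"
      using a(1) by (simp add: func_space_def)
    ultimately show "i \<in> f ` carrier (func_space S)"
      by (intro image_eqI[of _ f "restrict a S"]) simp_all
  qed
  have "f ` carrier (func_space S) \<noteq> {\<zero>}"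
    using image I(2) by simp
  from exists_functional_section[OF func_space_is_module f this] obtain \<sigma>
    where "functional_section R (func_space S) f \<sigma> I"
    unfolding image ..
  then interpret s: functional_section R "func_space S" f \<sigma> I .
  have "direct_summand R (free_module R S) (\<sigma> ` I)"
    unfolding direct_summand_def free_module_finite[OF S(1)]
    using s.section_image_direct_sum by (rule exI)
  moreover have "module_isomorphic R (ideal_module I) ((free_module R S)\<lparr>carrier := \<sigma> ` I\<rparr>)"
    unfolding free_module_finite[OF S(1)]
  proof (rule module_isomorphicI[of _ "\<lambda>u. \<sigma> (u 0)"])
    show "bij_betw (\<lambda>u. \<sigma> (u 0)) (carrier (ideal_module I))
        (carrier (func_space S\<lparr>carrier := \<sigma> ` I\<rparr>))"
      unfolding bij_betw_def
    proof
      show "inj_on (\<lambda>u. \<sigma> (u 0)) (carrier (ideal_module I))"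
      proof (rule inj_onI)
        fix u v assume "u \<in> carrier (ideal_module I)" "v \<in> carrier (ideal_module I)"
          and eq: "\<sigma> (u 0) = \<sigma> (v 0)"
        then obtain i j where ij: "i \<in> I" "j \<in> I" "u = (\<lambda>_. i)" "v = (\<lambda>_. j)"
          by auto
        have "f (\<sigma> (u 0)) = f (\<sigma> (v 0))"
          by (simp only: eq)
        then have "i = j"
          by (simp only: ij s.section_right_inverse)
        then show "u = v"
          by (simp only: ij)
      qed
    qed (simp add: image_image)
  qed (auto simp: s.section_add s.section_mult)
  ultimately show ?thesis
    unfolding projective_module_def by (intro exI[of _ S] exI[of _ "\<sigma> ` I"] conjI)
qed

lemma (in dedekind_domain) ideal_module_fgp:
  assumes "ideal I R" "I \<noteq> {\<zero>}"
  shows "fgp_module R (ideal_module I)"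
  unfolding fgp_module_def
  by (intro conjI ideal_module_module[OF assms(1)] ideal_module_fin_gen[OF assms(1)]
      ideal_module_projective[OF assms])

section \<open>Invertible fractional ideals\<close>

context domain_with_fractions
begin

lemma frac_module_module: "Module.module R (frac_module R)"
proof (rule moduleI)
  show "cring R" ..
  show "abelian_group (frac_module R)"
  proof (rule abelian_groupI)
    fix x assume "x \<in> carrier (frac_module R)"
    then show "\<exists>y\<in>carrier (frac_module R). y \<oplus>\<^bsub>frac_module R\<^esub> x = \<zero>\<^bsub>frac_module R\<^esub>"
      by (intro bexI[of _ "\<ominus>\<^bsub>K\<^esub> x"]) (simp_all add: K.l_neg)
  qed (simp_all add: K.a_ac)
qed (simp_all add: frac_embed_add frac_embed_mult K.l_distr K.r_distr K.m_assoc)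

text \<open>If all products \<open>x y\<close> vanished, so would every sum of them, although
  \<open>I J\<close> contains \<open>1\<close>.\<close>

lemma ideal_prod_nonzero:
  assumes "ideal_prod K I J = \<epsilon> ` carrier R" "I \<subseteq> carrier K" "J \<subseteq> carrier K"
  shows "\<exists>x\<in>I. x \<noteq> \<zero>\<^bsub>K\<^esub>" "\<exists>y\<in>J. y \<noteq> \<zero>\<^bsub>K\<^esub>"
proof -
  have nz: "\<exists>x\<in>I. \<exists>y\<in>J. x \<otimes>\<^bsub>K\<^esub> y \<noteq> \<zero>\<^bsub>K\<^esub>"
  proof (rule ccontr)
    assume zero: "\<not> ?thesis"
    have "z = \<zero>\<^bsub>K\<^esub>" if "z \<in> ideal_prod K I J" for z
      using that
    proof induction
      case (prod i j)
      with zero show ?case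
        by auto
    next
      case (sum u v)
      then show ?case
        by simp
    qed
    moreover have "\<one>\<^bsub>K\<^esub> \<in> ideal_prod K I J"
      unfolding assms(1) by (rule image_eqI[of _ _ \<one>]) simp_all
    ultimately show False
      using K.one_not_zero by metis
  qed
  then obtain x y where xy: "x \<in> I" "y \<in> J" "x \<otimes>\<^bsub>K\<^esub> y \<noteq> \<zero>\<^bsub>K\<^esub>"
    by auto
  have "x \<noteq> \<zero>\<^bsub>K\<^esub>" "y \<noteq> \<zero>\<^bsub>K\<^esub>"
    using xy assms(2,3) by auto
  with xy show "\<exists>x\<in>I. x \<noteq> \<zero>\<^bsub>K\<^esub>" "\<exists>y\<in>J. y \<noteq> \<zero>\<^bsub>K\<^esub>"
    by auto
qed

text \<open>Multiplication by a nonzero element of the inverse maps an invertible ideal into \<open>R\<close>.\<close>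

lemma invertible_ideal_isomorphic_ideal:
  assumes "invertible_ideal R I"
  obtains I' where "ideal I' R" "I' \<noteq> {\<zero>}"
    "module_isomorphic R ((frac_module R)\<lparr>carrier := I\<rparr>) (ideal_module I')"
proof -
  obtain J where I: "LinearCombinations.submodule R I (frac_module R)"
    and J: "LinearCombinations.submodule R J (frac_module R)"
    and IJ: "ideal_prod K I J = \<epsilon> ` carrier R"
    using assms unfolding invertible_ideal_def by auto
  interpret I: LinearCombinations.submodule R I "frac_module R" by (rule I)
  interpret J: LinearCombinations.submodule R J "frac_module R" by (rule J)
  have IK: "I \<subseteq> carrier K" and JK: "J \<subseteq> carrier K"
    using I.subset J.subset by simp_all
  obtain y where y: "y \<in> I" "y \<noteq> \<zero>\<^bsub>K\<^esub>"
    using ideal_prod_nonzero(1)[OF IJ IK JK] by auto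
  obtain x where x: "x \<in> J" "x \<noteq> \<zero>\<^bsub>K\<^esub>"
    using ideal_prod_nonzero(2)[OF IJ IK JK] by auto
  have xc: "x \<in> carrier K"
    using x JK by auto
  have Ic: "u \<in> carrier K" if "u \<in> I" for u
    using that IK by auto
  \<comment> \<open>\<open>\<psi> u\<close> is the product \<open>u x\<close> read as an element of
    \<open>R\<close>, which is possible because \<open>u x\<close> lies in \<open>I J = R\<close>.
    Injectivity of the embedding makes \<open>\<psi>\<close> linear, and \<open>x \<noteq> 0\<close>
    makes it injective.\<close>
  define \<psi> where "\<psi> u = inv_into (carrier R) \<epsilon> (u \<otimes>\<^bsub>K\<^esub> x)" for u
  have \<psi>: "\<psi> u \<in> carrier R" "\<epsilon> (\<psi> u) = u \<otimes>\<^bsub>K\<^esub> x" if "u \<in> I" for u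
  proof -
    have "u \<otimes>\<^bsub>K\<^esub> x \<in> ideal_prod K I J"
      using that x(1) by (rule ideal_prod.prod)
    then have "u \<otimes>\<^bsub>K\<^esub> x \<in> \<epsilon> ` carrier R"
      by (simp add: IJ)
    then show "\<psi> u \<in> carrier R" "\<epsilon> (\<psi> u) = u \<otimes>\<^bsub>K\<^esub> x"
      unfolding \<psi>_def by (rule inv_into_into, rule f_inv_into_f)
  qed
  have \<psi>_eqI: "\<psi> u = r" if "u \<in> I" "r \<in> carrier R" "\<epsilon> r = u \<otimes>\<^bsub>K\<^esub> x" for u r
    using frac_embed_eq_iff[OF \<psi>(1)[OF that(1)] that(2)] \<psi>(2)[OF that(1)] that(3) by simp
  have add: "u \<oplus>\<^bsub>K\<^esub> v \<in> I" "\<psi> (u \<oplus>\<^bsub>K\<^esub> v) = \<psi> u \<oplus> \<psi> v" if "u \<in> I" "v \<in> I" for u v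
  proof -
    show uv: "u \<oplus>\<^bsub>K\<^esub> v \<in> I"
      using I.m_closed[OF that] by simp
    show "\<psi> (u \<oplus>\<^bsub>K\<^esub> v) = \<psi> u \<oplus> \<psi> v"
      by (rule \<psi>_eqI[OF uv])
        (simp_all add: frac_embed_add \<psi> that K.l_distr Ic xc)
  qed
  have smult: "\<epsilon> r \<otimes>\<^bsub>K\<^esub> u \<in> I" "\<psi> (\<epsilon> r \<otimes>\<^bsub>K\<^esub> u) = r \<otimes> \<psi> u" if "r \<in> carrier R" "u \<in> I" for r u
  proof -
    show ru: "\<epsilon> r \<otimes>\<^bsub>K\<^esub> u \<in> I"
      using I.smult_closed[OF that] by simp
    show "\<psi> (\<epsilon> r \<otimes>\<^bsub>K\<^esub> u) = r \<otimes> \<psi> u"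
      by (rule \<psi>_eqI[OF ru])
        (simp_all add: frac_embed_mult \<psi> that K.m_assoc Ic xc)
  qed
  have "ideal (\<psi> ` I) R"
  proof (rule ideal_criterion)
    have "\<zero>\<^bsub>K\<^esub> \<in> I"
      using I.zero_closed by simp
    moreover from this have "\<psi> \<zero>\<^bsub>K\<^esub> = \<zero>"
      by (rule \<psi>_eqI) (simp_all add: xc)
    ultimately show "\<zero> \<in> \<psi> ` I"
      by (intro image_eqI[where x = "\<zero>\<^bsub>K\<^esub>"]) simp_all
  next
    fix a b assume "a \<in> \<psi> ` I" "b \<in> \<psi> ` I"
    then obtain u v where "u \<in> I" "v \<in> I" "a = \<psi> u" "b = \<psi> v"
      by auto
    then show "a \<oplus> b \<in> \<psi> ` I"
      by (intro image_eqI[where x = "u \<oplus>\<^bsub>K\<^esub> v"]) (simp_all add: add)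
  next
    fix r a assume "r \<in> carrier R" "a \<in> \<psi> ` I"
    then obtain u where "r \<in> carrier R" "u \<in> I" "a = \<psi> u"
      by auto
    then show "r \<otimes> a \<in> \<psi> ` I"
      by (intro image_eqI[where x = "\<epsilon> r \<otimes>\<^bsub>K\<^esub> u"]) (simp_all add: smult)
  qed (use \<psi> in auto)
  moreover have "\<psi> ` I \<noteq> {\<zero>}"
  proof
    assume "\<psi> ` I = {\<zero>}"
    with y(1) have "\<psi> y = \<zero>"
      by auto
    with \<psi>(2)[OF y(1)] have "y \<otimes>\<^bsub>K\<^esub> x = \<zero>\<^bsub>K\<^esub>"
      by simp
    with y x(2) xc Ic K.integral_iff show False
      by simp
  qed
  moreover have "module_isomorphic R ((frac_module R)\<lparr>carrier := I\<rparr>) (ideal_module (\<psi> ` I))"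
  proof (rule module_isomorphicI[of _ "\<lambda>u _. \<psi> u"])
    have "inj_on \<psi> I"
    proof (rule inj_onI)
      fix u v assume u: "u \<in> I" and v: "v \<in> I" and "\<psi> u = \<psi> v"
      then have "x \<otimes>\<^bsub>K\<^esub> u = x \<otimes>\<^bsub>K\<^esub> v"
        using \<psi>(2)[OF u] \<psi>(2)[OF v] Ic xc by (simp add: K.m_comm)
      then show "u = v"
        using K.m_lcancel[OF x(2) xc Ic[OF u] Ic[OF v]] by simp
    qed
    then show "bij_betw (\<lambda>u _. \<psi> u) (carrier ((frac_module R)\<lparr>carrier := I\<rparr>))
        (carrier (ideal_module (\<psi> ` I)))"
      by (simp add: bij_betw_def inj_on_def image_image fun_eq_iff)
  qed (simp_all add: add smult)
  ultimately show thesis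
    by (rule that)
qed

end

section \<open>The C4 loci\<close>

context dedekind_domain
begin

lemma tensor_module: "Module.module R M \<Longrightarrow> tensor_module R M"
  by (intro tensor_module.intro domain_with_fractions_axioms)

lemma fgp_module_rank_le_one_iff:
  assumes P: "fgp_module R P"
  shows "module_rank R P \<le> 1 \<longleftrightarrow> pairwise_dependent R P"
proof -
  have M: "Module.module R P" and fg: "fin_gen_module R P"
    using P by (simp_all add: fgp_module_def)
  interpret tensor_module R P by (rule tensor_module[OF M])
  have tl: "torsionless R P"
    by (rule fgp_module_torsionless[OF P])
  show ?thesis
    using rank_le_one_imp_pairwise_dependent[OF tl fg]
      pairwise_dependent_imp_rank_le_one[OF torsionless_imp_torsion_free[OF M tl]] by auto
qed

lemma fgp_module_C4_properties:
  assumes P: "fgp_module R P" and "\<not> field R"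
  shows "C4_module R P \<longleftrightarrow> module_rank R P \<le> 1"
    and "C4_star_module R P \<longleftrightarrow> module_rank R P \<le> 1"
    and "semi_weak_CS_module R P"
    and "strongly_C4_star_module R P \<longleftrightarrow> module_rank R P \<le> 1"
proof -
  \<comment> \<open>A domain in which every nonzero element is a unit would be a field. This nonunit
    is where the assumption on \<open>R\<close> enters both the C4 and the semi-weak-CS
    arguments.\<close>
  obtain c where c: "c \<in> carrier R" "c \<noteq> \<zero>" "c \<notin> Units R"
  proof -
    have "Units R \<noteq> carrier R - {\<zero>}"
      using assms(2) cring_fieldI by auto
    moreover have "Units R \<subseteq> carrier R - {\<zero>}"
      using Units_closed zero_not_one Units_r_inv_ex[of \<zero>] by fastforce
    ultimately show thesis
      using that by blast
  qed
  have M: "Module.module R P"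
    using P by (simp add: fgp_module_def)
  have tl: "torsionless R P"
    by (rule fgp_module_torsionless[OF P])
  have tf: "torsion_free R P"
    by (rule torsionless_imp_torsion_free[OF M tl])
  note rank = fgp_module_rank_le_one_iff[OF P]
  note C4 = C4_imp_pairwise_dependent[OF M tl _ c]
  note star = pairwise_dependent_imp_C4_star[OF M tf]
  note star_C4 = module.C4_star_imp_C4[OF M]
  show "C4_module R P \<longleftrightarrow> module_rank R P \<le> 1"
    using rank C4 star star_C4 by auto
  show 2: "C4_star_module R P \<longleftrightarrow> module_rank R P \<le> 1"
    using rank C4 star star_C4 by auto
  show 3: "semi_weak_CS_module R P"
    by (rule torsion_free_imp_semi_weak_CS[OF M tf c])
  show "strongly_C4_star_module R P \<longleftrightarrow> module_rank R P \<le> 1"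
    using 2 3 by (simp add: strongly_C4_star_module_def)
qed

text \<open>The carrier of \<open>I\<close> consists of fractions, so \<open>I\<close> is not itself
  of type \<open>umodule\<close>; an isomorphic ideal of \<open>R\<close>, realised by constant
  functions, represents its class. The rank is computed for \<open>I\<close> itself, from
  torsionlessness and pairwise dependence pulled back along the isomorphism.\<close>

lemma invertible_ideal_class:
  assumes "invertible_ideal R I"
  obtains P :: "'a umodule" where "fgp_module R P" "module_rank R P \<le> 1"
    "iso_class R ((frac_module R)\<lparr>carrier := I\<rparr>) = iso_class R P"
    "module_rank R ((frac_module R)\<lparr>carrier := I\<rparr>) = 1"
proof -
  define M where "M = (frac_module R)\<lparr>carrier := I\<rparr>"
  obtain I' where I': "ideal I' R" "I' \<noteq> {\<zero>}" and iso: "module_isomorphic R M (ideal_module I')"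
    using invertible_ideal_isomorphic_ideal[OF assms] unfolding M_def by blast
  have fgp: "fgp_module R (ideal_module I')"
    by (rule ideal_module_fgp[OF I'])
  have N: "Module.module R (ideal_module I')"
    by (rule ideal_module_module[OF I'(1)])
  have "LinearCombinations.submodule R I (frac_module R)"
    using assms by (simp add: invertible_ideal_def)
  then have M: "Module.module R M"
    unfolding M_def by (rule LinearCombinations.module.submodule_is_module[OF frac_module_module])
  have pd: "pairwise_dependent R (ideal_module I')"
    by (rule ideal_module_pairwise_dependent[OF I'(1)]) simp
  have pdM: "pairwise_dependent R M"
    by (rule pairwise_dependent_isomorphic[OF M iso pd])
  have tlM: "torsionless R M"
    by (rule torsionless_isomorphic[OF M N iso ideal_module_torsionless[OF I'(1)]])
  obtain u where u: "u \<in> carrier M" "u \<noteq> \<zero>\<^bsub>M\<^esub>"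
  proof -
    interpret M: Module.module R M by (rule M)
    have "carrier M \<noteq> {\<zero>\<^bsub>M\<^esub>}"
    proof
      assume 0: "carrier M = {\<zero>\<^bsub>M\<^esub>}"
      obtain g where "bij_betw g (carrier M) (carrier (ideal_module I'))"
        using iso unfolding module_isomorphic_def by auto
      then have "carrier (ideal_module I') = {g \<zero>\<^bsub>M\<^esub>}"
        unfolding 0 bij_betw_def by auto
      then obtain w where "(\<lambda>r (_::nat). r) ` I' = {w}"
        by auto
      moreover have "\<zero> \<in> I'"
        using I'(1) by (simp add: additive_subgroup.zero_closed ideal.axioms(1))
      ultimately have "I' \<subseteq> {\<zero>}"
        by (metis (no_types, lifting) image_eqI singleton_iff subsetI)
      with \<open>\<zero> \<in> I'\<close> I'(2) show False
        by auto
    qed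
    then show thesis
      using that M.zero_closed by fastforce
  qed
  interpret tensor_module R M by (rule tensor_module[OF M])
  show thesis
  proof (rule that[of "ideal_module I'"])
    show "module_rank R (ideal_module I') \<le> 1"
      using fgp_module_rank_le_one_iff[OF fgp] pd by simp
    show "iso_class R ((frac_module R)\<lparr>carrier := I\<rparr>) = iso_class R (ideal_module I')"
      using iso_class_eq[OF M N iso] by (simp only: M_def)
    show "module_rank R ((frac_module R)\<lparr>carrier := I\<rparr>) = 1"
      using pairwise_dependent_imp_rank_eq_one[OF tlM pdM u] by (simp only: M_def)
  qed (rule fgp)
qed

text \<open>Membership of the class only provides some representative \<open>P'\<close> with the
  property, possibly different from \<open>P\<close>. The rank bound of \<open>P'\<close> is turned
  into pairwise dependence, moved to \<open>P\<close>, and turned back.\<close>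

lemma V_prop_rank_le_one:
  assumes "iso_class R P \<in> V_prop R Q" "fgp_module R P"
    and "\<And>P'. \<lbrakk>fgp_module R P'; Q P'\<rbrakk> \<Longrightarrow> module_rank R P' \<le> 1"
  shows "module_rank R P \<le> 1"
proof -
  obtain P' where P': "iso_class R P = iso_class R P'" "fgp_module R P'" "Q P'"
    using assms(1) by (auto simp: V_prop_def)
  have M: "Module.module R P" "Module.module R P'"
    using assms(2) P'(2) by (simp_all add: fgp_module_def)
  have "module_isomorphic R P P'"
    by (rule iso_class_eqD[OF M(2) P'(1)[symmetric]])
  moreover have "pairwise_dependent R P'"
    using assms(3)[OF P'(2,3)] fgp_module_rank_le_one_iff[OF P'(2)] by simp
  ultimately show ?thesis
    using pairwise_dependent_isomorphic[OF M(1)] fgp_module_rank_le_one_iff[OF assms(2)] by simp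
qed

end

lemma V_prop_cong:
  assumes "\<And>P. fgp_module R P \<Longrightarrow> Q P \<longleftrightarrow> Q' P"
  shows "V_prop R Q = V_prop R Q'"
  unfolding V_prop_def using assms by (intro Collect_cong ex_cong1) auto

theorem theorem8p3:
  fixes D :: "('a, 'r) ring_scheme"
  assumes "dedekind_domain D" and "\<not> field D"
  shows "V_prop D (C4_module D) = V_prop D (C4_star_module D)
    \<and> V_prop D (C4_star_module D) = V_prop D (strongly_C4_star_module D)
    \<and> V_prop D (strongly_C4_star_module D) = V_prop D (\<lambda>P. module_rank D P \<le> 1)
    \<and> V_prop D (semi_weak_CS_module D) = V_proj D
    \<and> (\<forall>I. invertible_ideal D I \<longrightarrow>
         (let P = (frac_module D)\<lparr>carrier := I\<rparr> in
          iso_class D P \<in> V_proj D \<and> module_rank D P = 1 \<and>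
          iso_class D P \<in> V_prop D (C4_module D) \<inter> V_prop D (C4_star_module D)
                            \<inter> V_prop D (strongly_C4_star_module D)))
    \<and> (\<forall>P :: 'a umodule. fgp_module D P \<and> module_rank D P \<ge> 2 \<longrightarrow>
         iso_class D P \<notin> V_prop D (C4_module D) \<union> V_prop D (C4_star_module D)
                           \<union> V_prop D (strongly_C4_star_module D))"
proof -
  interpret dedekind_domain D by (rule assms(1))
  note props = fgp_module_C4_properties[OF _ assms(2)]
  have V1: "V_prop D (C4_module D) = V_prop D (\<lambda>P. module_rank D P \<le> 1)"
    by (rule V_prop_cong) (rule props(1))
  have V2: "V_prop D (C4_star_module D) = V_prop D (\<lambda>P. module_rank D P \<le> 1)"
    by (rule V_prop_cong) (rule props(2))
  have V3: "V_prop D (strongly_C4_star_module D) = V_prop D (\<lambda>P. module_rank D P \<le> 1)"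
    by (rule V_prop_cong) (rule props(4))
  have V4: "V_prop D (semi_weak_CS_module D) = V_proj D"
    unfolding V_prop_def V_proj_def using props(3) by (intro Collect_cong ex_cong1) auto
  have invertible: "iso_class D ((frac_module D)\<lparr>carrier := I\<rparr>) \<in> V_proj D \<and>
      module_rank D ((frac_module D)\<lparr>carrier := I\<rparr>) = 1 \<and>
      iso_class D ((frac_module D)\<lparr>carrier := I\<rparr>) \<in> V_prop D (\<lambda>P. module_rank D P \<le> 1)"
    if I: "invertible_ideal D I" for I
  proof -
    obtain P :: "'a umodule" where P: "fgp_module D P" "module_rank D P \<le> 1"
      "iso_class D ((frac_module D)\<lparr>carrier := I\<rparr>) = iso_class D P"
      "module_rank D ((frac_module D)\<lparr>carrier := I\<rparr>) = 1"
      by (rule invertible_ideal_class[OF I])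
    then show ?thesis
      unfolding P(3) V_proj_def V_prop_def by auto
  qed
  have rank: "iso_class D P \<notin> V_prop D (\<lambda>P. module_rank D P \<le> 1)"
    if "fgp_module D P" "module_rank D P \<ge> 2" for P :: "'a umodule"
    using V_prop_rank_le_one[of P "\<lambda>P. module_rank D P \<le> 1"] that by force
  show ?thesis
    unfolding V1 V2 V3 V4 Let_def using invertible rank by simp
qed

end
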